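(* Let $\mathcal M,\mathcal N\subset\mathbb R^3$ be compact, connected, oriented smooth surfaces (possibly with boundary), let $\{\mathcal M_h\}_{h>0}$ be a family of simplicial approximations of $\mathcal M$ satisfying the Triangulation Assumption, and let $\widetilde f:\mathcal M\to\mathcal N$ be a diffeomorphism. Let $f:\mathcal M_h\to\mathcal N_h$ be the piecewise linear interpolant of $\widetilde f$ on $\mathcal M_h$. Then there is a constant $C>0$, independent of $h$, such that for all sufficiently small $h$ $$\big|E_{\mathrm S}(f)-\mathcal E_{\mathrm S}(\widetilde f)\big|\le C\,h .$$
   Context: Simplicial surfaces. A simplicial (triangular) surface $\mathcal M_h\subset\mathbb R^3$ has finite vertex set $\mathcal V$ and set $\mathcal F$ of oriented triangular faces; $h=\max_{\tau\in\mathcal F}\mathrm{diam}(\tau)$ is its mesh size, and $|\tau|$ is the area of $\tau$. The piecewise linear interpolant $f$ of $\widetilde f$ is the map on $\mathcal M_h$, affine on each face, with $f(v)=\widetilde f(v)$ for every $v\in\mathcal V$ (vertices lie on $\mathcal M$); $\mathcal N_h:=f(\mathcal M_h)\subset\mathbb R^3$. Energies. $\mathcal E_{\mathrm S}(\widetilde f)=\int_{\mathcal M}J_{\widetilde f}^2\,dA$, where $J_{\widetilde f}>0$ is the area ratio (area Jacobian) of $\widetilde f$ with respect to the induced Riemannian metrics. The discrete stretch energy is $E_{\mathrm S}(f)=\int_{\mathcal M_h}J_f^2\,dA=\sum_{\tau\in\mathcal F}|f(\tau)|^2/|\tau|$, where $J_f=|f(\tau)|/|\tau|$ on $\tau$.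 Projection. If $\partial\mathcal M=\varnothing$, $\pi_{\mathcal M}:\mathcal M_h\to\mathcal M$ is the closest-point projection $\pi_{\mathcal M}(x)=\arg\min_{p\in\mathcal M}\|p-x\|^2$. If $\partial\mathcal M\ne\varnothing$, one fixes a compatible smooth extension $\mathcal M^e\supset\mathcal M$, and $\pi_{\mathcal M}$ denotes the restriction to $\mathcal M_h$ of the closest-point projection onto $\mathcal M^e$. The lift is $\mathcal M_h^\ell:=\pi_{\mathcal M}(\mathcal M_h)$. Triangulation Assumption. $\{\mathcal M_h\}_{h>0}$ is a family of simplicial approximations of the compact, connected, oriented smooth surface $\mathcal M\subset\mathbb R^3$ (possibly with boundary), with all vertices on $\mathcal M$, such that: (1) (Closest-point projection) If $\partial\mathcal M=\varnothing$, $\mathcal M_h$ lies in a tubular neighborhood of $\mathcal M$ such that $\pi_{\mathcal M}:\mathcal M_h\to\mathcal M$ is well-defined and bijective. If $\partial\mathcal M\neq\varnothing$, the closest-point projection onto a smooth extension $\mathcal M^e\supset\mathcal M$ is well-defined and bijective from $\mathcal M_h$ onto $\mathcal M_h^\ell$. (2) (Boundary extensions) If $\partial\mathcal M\ne\varnothing$, the boundary vertices satisfy $\mathcal V\cap\partial\mathcal M_h\subset\partial\mathcal M$, and there is a constant $C>0$ independent of $h$ with $\mathcal M_h^\ell\,\triangle\,\mathcal M\subset\{x\in\mathcal M^e:\rho_{\partial\mathcal M}(x)\le Ch^2\}$, where $\rho_{\partial\mathcal M}(x)=\mathrm{dist}_{\mathcal M^e}(x,\partial\mathcal M)$ and $\triangle$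 is symmetric difference. Moreover the closest-point projection $\pi_{\partial\mathcal M}:\partial\mathcal M_h^\ell\to\partial\mathcal M$ is bijective. (3) (Shape-regularity) There is a constant $C>0$ independent of $h$ with $\max_{\tau\in\mathcal F}\mathrm{diam}(\tau)/\mathrm{inrad}(\tau)\le C$, where $\mathrm{inrad}(\tau)$ is the in-ball (inscribed disk) radius of $\tau$. *)

theory Defs
  imports "HOL-Analysis.Analysis"
begin

section \<open>Smooth maps between subsets of Euclidean spaces\<close>

primrec Ck_on :: "nat \<Rightarrow> 'a::euclidean_space set \<Rightarrow> ('a \<Rightarrow> 'b::real_normed_vector) \<Rightarrow> bool" where
  "Ck_on 0 U f \<longleftrightarrow> continuous_on U f"
| "Ck_on (Suc k) U f \<longleftrightarrow>
     (\<exists>f'. (\<forall>x\<in>U. (f has_derivative f' x) (at x)) \<and> (\<forall>v. Ck_on k U (\<lambda>x. f' x v)))"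

text \<open>On a set that need not be open, smoothness means that the map extends, near each point of the
  set, to a \<open>C\<^sup>\<infinity>\<close> map on an open subset of the ambient space.\<close>

definition smooth_on :: "'a::euclidean_space set \<Rightarrow> ('a \<Rightarrow> 'b::real_normed_vector) \<Rightarrow> bool" where
  "smooth_on S f \<longleftrightarrow>
     (\<forall>x\<in>S. \<exists>U g. open U \<and> x \<in> U \<and> (\<forall>k. Ck_on k U g) \<and> (\<forall>y\<in>S \<inter> U. g y = f y))"

definition diffeomorphism ::
    "'a::euclidean_space set \<Rightarrow> 'b::euclidean_space set \<Rightarrow> ('a \<Rightarrow> 'b) \<Rightarrow> bool" where
  "diffeomorphism S T f \<longleftrightarrow>
     bij_betw f S T \<and> smooth_on S f \<and> smooth_on T (the_inv_into S f)"


section \<open>Smooth surfaces with boundary in three-space\<close>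

definition half_plane :: "(real^2) set" where
  "half_plane = {x. 0 \<le> x $ 2}"

text \<open>A local parametrization of \<open>M\<close>, the inverse of a chart. Its domain may or may not meet the
  boundary line of the half plane.\<close>

definition local_param :: "(real^3) set \<Rightarrow> (real^2) set \<Rightarrow> (real^2 \<Rightarrow> real^3) \<Rightarrow> bool" where
  "local_param M W \<phi> \<longleftrightarrow>
     openin (top_of_set half_plane) W \<and> openin (top_of_set M) (\<phi> ` W) \<and>
     diffeomorphism W (\<phi> ` W) \<phi>"

definition smooth_surface :: "(real^3) set \<Rightarrow> bool" where
  "smooth_surface M \<longleftrightarrow> (\<forall>p\<in>M. \<exists>W \<phi>. local_param M W \<phi> \<and> p \<in> \<phi> ` W)"

definition surface_boundary :: "(real^3) set \<Rightarrow> (real^3) set" where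
  "surface_boundary M = {\<phi> x | W \<phi> x. local_param M W \<phi> \<and> x \<in> W \<and> x $ 2 = 0}"

definition tangent_plane :: "(real^3) set \<Rightarrow> real^3 \<Rightarrow> (real^3) set" where
  "tangent_plane M p =
     {D w | W \<phi> x D w. local_param M W \<phi> \<and> x \<in> W \<and> \<phi> x = p \<and> (\<phi> has_derivative D) (at x within W)}"

text \<open>An orientation of a surface in three-space is given by a continuous unit normal field.\<close>

definition surface_orientation :: "(real^3) set \<Rightarrow> (real^3 \<Rightarrow> real^3) \<Rightarrow> bool" where
  "surface_orientation M \<nu> \<longleftrightarrow>
     continuous_on M \<nu> \<and> (\<forall>p\<in>M. norm (\<nu> p) = 1 \<and> (\<forall>v\<in>tangent_plane M p. \<nu> p \<bullet> v = 0))"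

definition smooth_extension :: "(real^3) set \<Rightarrow> (real^3) set \<Rightarrow> bool" where
  "smooth_extension M Me \<longleftrightarrow> smooth_surface Me \<and> M \<subseteq> Me - surface_boundary Me"


section \<open>Surface area and the stretch energy\<close>

text \<open>The area density of a local parametrization, i.e. the square root of the determinant of its
  first fundamental form.\<close>

definition area_density :: "(real^2) set \<Rightarrow> (real^2 \<Rightarrow> real^3) \<Rightarrow> real^2 \<Rightarrow> real" where
  "area_density W \<phi> x =
     (let D = frechet_derivative \<phi> (at x within W) in norm (cross3 (D (axis 1 1)) (D (axis 2 1))))"

definition is_area_measure :: "(real^3) set \<Rightarrow> (real^3) measure \<Rightarrow> bool" where
  "is_area_measure M \<mu> \<longleftrightarrow>
     space \<mu> = M \<and> sets \<mu> = sets (restrict_space borel M) \<and>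
     (\<forall>W \<phi>. local_param M W \<phi> \<longrightarrow>
        (\<forall>B\<in>sets borel. B \<subseteq> W \<longrightarrow>
           emeasure \<mu> (\<phi> ` B) = (\<integral>\<^sup>+x\<in>B. ennreal (area_density W \<phi> x) \<partial>lborel)))"

definition area_measure :: "(real^3) set \<Rightarrow> (real^3) measure" where
  "area_measure M = (THE \<mu>. is_area_measure M \<mu>)"

text \<open>A derivative of \<open>f\<close> at \<open>p\<close> within \<open>M\<close> is not unique as a linear map on three-space, but its
  restriction to the tangent plane is: it is the differential of \<open>f\<close>. The area ratio is its effect on
  the areas of tangent parallelograms.\<close>

definition area_jacobian :: "(real^3) set \<Rightarrow> (real^3 \<Rightarrow> real^3) \<Rightarrow> real^3 \<Rightarrow> real" where
  "area_jacobian M f p =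
     (THE j. \<forall>A. (f has_derivative A) (at p within M) \<longrightarrow>
        (\<forall>u\<in>tangent_plane M p. \<forall>v\<in>tangent_plane M p.
           norm (cross3 (A u) (A v)) = j * norm (cross3 u v)))"

definition stretch_energy :: "(real^3) set \<Rightarrow> (real^3 \<Rightarrow> real^3) \<Rightarrow> real" where
  "stretch_energy M f = (\<integral>p. (area_jacobian M f p)\<^sup>2 \<partial>area_measure M)"


section \<open>Intrinsic distance and closest-point projection\<close>

definition path_length :: "(real \<Rightarrow> real^3) \<Rightarrow> ennreal" where
  "path_length \<gamma> = (\<integral>\<^sup>+t\<in>{0..1}. ennreal (norm (vector_derivative \<gamma> (at t))) \<partial>lborel)"

text \<open>The infimum is infinite when no curve in \<open>S\<close> joins \<open>x\<close> to \<open>A\<close>.\<close>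

definition intrinsic_dist :: "(real^3) set \<Rightarrow> real^3 \<Rightarrow> (real^3) set \<Rightarrow> ennreal" where
  "intrinsic_dist S x A =
     (INF \<gamma> \<in> {\<gamma>. valid_path \<gamma> \<and> path_image \<gamma> \<subseteq> S \<and> pathstart \<gamma> = x \<and> pathfinish \<gamma> \<in> A}.
        path_length \<gamma>)"

text \<open>\<open>closest_point S x\<close> is an arbitrary choice unless \<open>S\<close> has exactly one point nearest to \<open>x\<close>.\<close>

definition projection_well_defined :: "(real^3) set \<Rightarrow> (real^3) set \<Rightarrow> bool" where
  "projection_well_defined S X \<longleftrightarrow>
     (\<forall>x\<in>X. \<exists>!p. p \<in> S \<and> (\<forall>q\<in>S. dist x p \<le> dist x q))"


section \<open>Simplicial surfaces\<close>

text \<open>An oriented triangle is an ordered triple of corners. A simplicial surface is given by its set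
  of oriented faces, which contains one triple for each geometric triangle.\<close>

type_synonym face = "(real^3) \<times> (real^3) \<times> (real^3)"

fun corners :: "face \<Rightarrow> (real^3) set" where
  "corners (a, b, c) = {a, b, c}"

fun edges :: "face \<Rightarrow> (real^3) set set" where
  "edges (a, b, c) = {{a, b}, {b, c}, {c, a}}"

fun directed_edges :: "face \<Rightarrow> ((real^3) \<times> (real^3)) set" where
  "directed_edges (a, b, c) = {(a, b), (b, c), (c, a)}"

definition triangle :: "face \<Rightarrow> (real^3) set" where
  "triangle \<tau> = convex hull (corners \<tau>)"

definition vertices :: "face set \<Rightarrow> (real^3) set" where
  "vertices F = (\<Union>\<tau>\<in>F. corners \<tau>)"

definition carrier :: "face set \<Rightarrow> (real^3) set" where
  "carrier F = (\<Union>\<tau>\<in>F. triangle \<tau>)"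

definition mesh_boundary :: "face set \<Rightarrow> (real^3) set" where
  "mesh_boundary F = (\<Union>e\<in>{e. card {\<tau>\<in>F. e \<in> edges \<tau>} = 1}. convex hull e)"

definition mesh_size :: "face set \<Rightarrow> real" where
  "mesh_size F = Max ((\<lambda>\<tau>. diameter (triangle \<tau>)) ` F)"

definition topological_surface :: "(real^3) set \<Rightarrow> bool" where
  "topological_surface S \<longleftrightarrow>
     (\<forall>x\<in>S. \<exists>U W. openin (top_of_set S) U \<and> x \<in> U \<and>
        openin (top_of_set half_plane) W \<and> U homeomorphic W)"

text \<open>Disjointness of the sets of directed edges says that two faces sharing an edge traverse it in
  opposite directions, i.e. that the faces are coherently oriented; in particular an edge belongs to
  at most two faces.\<close>

definition simplicial_surface :: "face set \<Rightarrow> bool" where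
  "simplicial_surface F \<longleftrightarrow>
     finite F \<and> F \<noteq> {} \<and> (\<forall>\<tau>\<in>F. 2 simplex (triangle \<tau>)) \<and>
     inj_on triangle F \<and> triangulation (triangle ` F) \<and>
     topological_surface (carrier F) \<and>
     (\<forall>\<sigma>\<in>F. \<forall>\<tau>\<in>F. \<sigma> \<noteq> \<tau> \<longrightarrow> directed_edges \<sigma> \<inter> directed_edges \<tau> = {})"

text \<open>The disks are taken in the plane of the triangle.\<close>

definition inradius :: "(real^3) set \<Rightarrow> real" where
  "inradius T = Sup {r. 0 \<le> r \<and> (\<exists>c\<in>T. cball c r \<inter> affine hull T \<subseteq> T)}"


section \<open>Piecewise linear interpolation and the discrete stretch energy\<close>

definition pl_interpolant :: "face set \<Rightarrow> (real^3 \<Rightarrow> real^3) \<Rightarrow> (real^3 \<Rightarrow> real^3) \<Rightarrow> bool" where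
  "pl_interpolant F g f \<longleftrightarrow>
     (\<forall>\<tau>\<in>F. \<exists>A b. linear A \<and> (\<forall>x\<in>triangle \<tau>. f x = A x + b)) \<and> (\<forall>v\<in>vertices F. f v = g v)"

fun face_area :: "face \<Rightarrow> real" where
  "face_area (a, b, c) = norm (cross3 (b - a) (c - a)) / 2"

text \<open>For \<open>f\<close> affine on \<open>\<tau>\<close>, the image of the triangle \<open>\<tau>\<close> is the triangle \<open>image_face f \<tau>\<close>.\<close>

fun image_face :: "(real^3 \<Rightarrow> real^3) \<Rightarrow> face \<Rightarrow> face" where
  "image_face f (a, b, c) = (f a, f b, f c)"

definition discrete_stretch_energy :: "face set \<Rightarrow> (real^3 \<Rightarrow> real^3) \<Rightarrow> real" where
  "discrete_stretch_energy F f = (\<Sum>\<tau>\<in>F. (face_area (image_face f \<tau>))\<^sup>2 / face_area \<tau>)"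


section \<open>Families of simplicial approximations\<close>

text \<open>The family is indexed by a set \<open>H\<close> of mesh sizes rather than by all positive reals: a mesh with
  vertices on \<open>M\<close> has mesh size at most the diameter of \<open>M\<close>.\<close>

definition simplicial_approximations ::
    "(real^3) set \<Rightarrow> real set \<Rightarrow> (real \<Rightarrow> face set) \<Rightarrow> bool" where
  "simplicial_approximations M H Mh \<longleftrightarrow>
     (\<forall>h\<in>H. 0 < h \<and> simplicial_surface (Mh h) \<and> mesh_size (Mh h) = h \<and> vertices (Mh h) \<subseteq> M)"

definition closed_projection_condition ::
    "(real^3) set \<Rightarrow> real set \<Rightarrow> (real \<Rightarrow> face set) \<Rightarrow> bool" where
  "closed_projection_condition M H Mh \<longleftrightarrow>
     (\<forall>h\<in>H. (\<exists>U. open U \<and> M \<subseteq> U \<and> carrier (Mh h) \<subseteq> U \<and> projection_well_defined M U) \<and>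
        bij_betw (closest_point M) (carrier (Mh h)) M)"

definition lift :: "(real^3) set \<Rightarrow> face set \<Rightarrow> (real^3) set" where
  "lift Me F = closest_point Me ` carrier F"

text \<open>Since the projection is a homeomorphism of the mesh onto its lift, the boundary of the lift is
  the image of the boundary of the mesh.\<close>

definition lift_boundary :: "(real^3) set \<Rightarrow> face set \<Rightarrow> (real^3) set" where
  "lift_boundary Me F = closest_point Me ` mesh_boundary F"

definition extension_projection_condition ::
    "(real^3) set \<Rightarrow> real set \<Rightarrow> (real \<Rightarrow> face set) \<Rightarrow> bool" where
  "extension_projection_condition Me H Mh \<longleftrightarrow>
     (\<forall>h\<in>H. projection_well_defined Me (carrier (Mh h)) \<and>
        bij_betw (closest_point Me) (carrier (Mh h)) (lift Me (Mh h)))"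

definition boundary_condition ::
    "(real^3) set \<Rightarrow> (real^3) set \<Rightarrow> real set \<Rightarrow> (real \<Rightarrow> face set) \<Rightarrow> bool" where
  "boundary_condition M Me H Mh \<longleftrightarrow>
     (\<forall>h\<in>H. vertices (Mh h) \<inter> mesh_boundary (Mh h) \<subseteq> surface_boundary M) \<and>
     (\<exists>C>0. \<forall>h\<in>H. sym_diff (lift Me (Mh h)) M
        \<subseteq> {x\<in>Me. intrinsic_dist Me x (surface_boundary M) \<le> ennreal (C * h\<^sup>2)}) \<and>
     (\<forall>h\<in>H. projection_well_defined (surface_boundary M) (lift_boundary Me (Mh h)) \<and>
        bij_betw (closest_point (surface_boundary M)) (lift_boundary Me (Mh h)) (surface_boundary M))"

definition shape_regular :: "real set \<Rightarrow> (real \<Rightarrow> face set) \<Rightarrow> bool" where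
  "shape_regular H Mh \<longleftrightarrow>
     (\<exists>C>0. \<forall>h\<in>H. \<forall>\<tau>\<in>Mh h. diameter (triangle \<tau>) / inradius (triangle \<tau>) \<le> C)"

text \<open>The extension \<open>Me\<close> plays no role when \<open>M\<close> has empty boundary.\<close>

definition triangulation_assumption ::
    "(real^3) set \<Rightarrow> (real^3) set \<Rightarrow> real set \<Rightarrow> (real \<Rightarrow> face set) \<Rightarrow> bool" where
  "triangulation_assumption M Me H Mh \<longleftrightarrow>
     simplicial_approximations M H Mh \<and>
     (surface_boundary M = {} \<longrightarrow> closed_projection_condition M H Mh) \<and>
     (surface_boundary M \<noteq> {} \<longrightarrow>
        smooth_extension M Me \<and> extension_projection_condition Me H Mh \<and>
        boundary_condition M Me H Mh) \<and>
     shape_regular H Mh"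

end

theory Submission
  imports Defs
begin

text \<open>In a coordinate patch of the surface, let \<phi> be the parametrization and let \<open>F\<close> be its composition with
the given diffeomorphism. A face with corners \<open>\<phi> \<alpha>\<close>, \<open>\<phi> \<beta>\<close>, \<open>\<phi> \<gamma>\<close> and diameter \<open>d\<close> comes from a planar
triangle \<open>t\<close> of area \<open>\<bar>t\<bar>\<close>, and its image under the interpolant has the corners \<open>F \<alpha>\<close>, \<open>F \<beta>\<close>, \<open>F \<gamma>\<close>. By
Taylor expansion the two areas are the area factors of the derivatives of \<phi> and \<open>F\<close> at \<alpha> times
\<open>\<bar>t\<bar>\<close>, up to errors of order \<open>d\<^sup>3\<close>. Shape regularity makes \<open>\<bar>t\<bar>\<close> comparable to \<open>d\<^sup>2\<close>, so the energy of
the face is \<open>q \<alpha> \<bar>t\<bar>\<close> up to an error of order \<open>d \<bar>t\<bar>\<close>, where \<open>q\<close> is the squared area factor of \<open>F\<close>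
divided by that of \<phi>. The same Lipschitz function \<open>q\<close> is the density, in coordinates, of the stretch
energy of the smooth map. What remains is to compare a sum over planar triangles with an integral over
the surface.

The comparison rests on the continuity and injectivity of the closest-point projection on the
mesh. Every face is at distance of order \<open>d\<^sup>2\<close> from the surface, hence the projection of a face, read in
coordinates, is a continuous map that moves the points of \<open>t\<close> by at most a multiple of \<open>d\<^sup>2\<close>. Since \<open>t\<close>
contains a disk of radius comparable to \<open>d\<close>, the image is contained in a dilation of \<open>t\<close> by a factor
\<open>1 + O(d)\<close> (the halo), and by Brouwer's fixed point theorem it contains a dilation by a factor \<open>1 - O(d)\<close>
(the core). The halos cover the projected mesh and the cores are disjoint because the projection is
injective; both have area \<open>(1 + O(h)) \<bar>t\<bar>\<close>. This bounds the integral from above and from below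
(\<open>mesh_energy_estimate\<close>).

If the surface has a boundary, the projected mesh and the surface differ by a strip of width \<open>O(h\<^sup>2)\<close>
around the boundary. The boundary is locally a Lipschitz image of a segment, so it is covered by
\<open>O(1 / h)\<close> balls of radius \<open>h\<close>, and the strip contributes at most \<open>O(h)\<close>.

The area measure and the area ratio are defined by descriptions. That these determine the
objects follows from the change of variables formula (\<open>area_measure_properties\<close>) and from the uniqueness of
derivatives in charts (\<open>area_jacobian_chart\<close>).\<close>

unbundle cross3_syntax
unbundle no set_product_syntax

section \<open>Maps with Lipschitz derivative\<close>

text \<open>One constant bounds the derivative and its Lipschitz constant. The error bounds below
depend on the maps only through this constant, so that a finite cover of the surface by coordinate
patches makes them uniform in the mesh.\<close>

definition C11_on ::
    "'a::euclidean_space set \<Rightarrow> real \<Rightarrow> ('a \<Rightarrow> 'b::real_normed_vector) \<Rightarrow> ('a \<Rightarrow> 'a \<Rightarrow> 'b) \<Rightarrow> bool" where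
  "C11_on B K g g' \<longleftrightarrow>
     (\<forall>x\<in>B. (g has_derivative g' x) (at x)) \<and> (\<forall>x\<in>B. \<forall>v. norm (g' x v) \<le> K * norm v) \<and>
     (\<forall>x\<in>B. \<forall>y\<in>B. \<forall>v. norm (g' x v - g' y v) \<le> K * dist x y * norm v)"

lemma C11_onD:
  assumes "C11_on B K g g'" "x \<in> B"
  shows "(g has_derivative g' x) (at x)" "norm (g' x v) \<le> K * norm v"
    "y \<in> B \<Longrightarrow> norm (g' x v - g' y v) \<le> K * dist x y * norm v"
  using assms unfolding C11_on_def by auto

lemma C11_on_linear:
  assumes "C11_on B K g g'" "x \<in> B"
  shows "linear (g' x)"
  using C11_onD(1)[OF assms] has_derivative_linear by blast

lemma C11_on_mono:
  assumes "C11_on B K g g'" "A \<subseteq> B" "K \<le> L"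
  shows "C11_on A L g g'"
  unfolding C11_on_def
proof (intro conjI ballI allI)
  fix x v assume x: "x \<in> A"
  show "(g has_derivative g' x) (at x)" using assms x by (auto simp: C11_on_def)
  have "norm (g' x v) \<le> K * norm v" using assms x by (auto simp: C11_on_def)
  also have "\<dots> \<le> L * norm v" using assms(3) by (intro mult_right_mono) auto
  finally show "norm (g' x v) \<le> L * norm v" .
  fix y assume y: "y \<in> A"
  have "norm (g' x v - g' y v) \<le> K * dist x y * norm v"
    using assms x y by (intro C11_onD(3)[OF assms(1)]) auto
  also have "\<dots> \<le> L * dist x y * norm v" using assms(3) by (intro mult_right_mono) auto
  finally show "norm (g' x v - g' y v) \<le> L * dist x y * norm v" .
qed

lemma C11_on_continuous:
  assumes "C11_on B K g g'"
  shows "continuous_on B g"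
  using assms by (meson C11_onD(1) continuous_at_imp_continuous_on has_derivative_continuous)

lemma C11_on_lipschitz:
  assumes "C11_on B K g g'" "convex B" "x \<in> B" "y \<in> B"
  shows "norm (g x - g y) \<le> K * norm (x - y)"
proof (rule differentiable_bound[OF assms(2)])
  fix z assume z: "z \<in> B"
  show "(g has_derivative g' z) (at z within B)"
    using C11_onD(1)[OF assms(1) z] has_derivative_at_withinI by blast
  show "onorm (g' z) \<le> K"
    using C11_onD(2)[OF assms(1) z] by (intro onorm_le)
qed (use assms in auto)

text \<open>The map \<open>g - g' x\<close> has a derivative of norm at most \<open>K * norm (y - x)\<close> on the segment from \<open>x\<close> to \<open>y\<close>.\<close>

lemma C11_on_taylor:
  assumes C: "C11_on B K g g'" and "convex B" "x \<in> B" "y \<in> B"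
  shows "norm (g y - g x - g' x (y - x)) \<le> K * (norm (y - x))\<^sup>2"
proof -
  have seg: "closed_segment x y \<subseteq> B"
    using assms by (meson closed_segment_subset)
  have K0: "K * norm (y - x) \<ge> 0"
    using C11_onD(2)[OF C assms(3), of "y - x"] norm_ge_zero order_trans by blast
  have "norm (g y - g x - g' x (y - x)) \<le> norm (y - x) * (K * norm (y - x))"
  proof (rule differentiable_bound_linearization[where S = "closed_segment x y" and f' = g'])
    fix t :: real assume t: "t \<in> {0..1}"
    then show "x + t *\<^sub>R (y - x) \<in> closed_segment x y"
      by (auto simp: in_segment algebra_simps intro!: exI[of _ t])
  next
    fix z assume z: "z \<in> closed_segment x y"
    then have zB: "z \<in> B" using seg by auto
    show "(g has_derivative g' z) (at z within closed_segment x y)"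
      using C11_onD(1)[OF C zB] has_derivative_at_withinI by blast
    show "onorm (g' z - g' x) \<le> K * norm (y - x)"
    proof (rule onorm_le)
      fix v
      have "norm (g' z v - g' x v) \<le> K * dist z x * norm v"
        by (rule C11_onD(3)[OF C zB assms(3)])
      also have "\<dots> \<le> K * norm (y - x) * norm v"
      proof (cases "x = y")
        case True then show ?thesis using z by auto
      next
        case False
        then have "K \<ge> 0" using K0 by (simp add: zero_le_mult_iff)
        moreover have "dist z x \<le> norm (y - x)"
          using segment_bound1[OF z] by (simp add: dist_norm)
        ultimately show ?thesis by (intro mult_right_mono mult_left_mono) auto
      qed
      finally show "norm ((g' z - g' x) v) \<le> K * norm (y - x) * norm v" by simp
    qed
  qed auto
  then show ?thesis by (simp add: power2_eq_square algebra_simps)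
qed

lemma C11_on_compose:
  assumes f: "C11_on A K f f'" and g: "C11_on B L g g'" and sub: "f ` A \<subseteq> B"
    and "convex A" "K \<ge> 0" "L \<ge> 0"
  shows "C11_on A (L * K + L * K * K) (\<lambda>x. g (f x)) (\<lambda>x v. g' (f x) (f' x v))"
  unfolding C11_on_def
proof (intro conjI ballI allI)
  fix x v assume x: "x \<in> A"
  then have fx: "f x \<in> B" using sub by auto
  show "((\<lambda>x. g (f x)) has_derivative (\<lambda>v. g' (f x) (f' x v))) (at x)"
    using diff_chain_at[OF C11_onD(1)[OF f x] C11_onD(1)[OF g fx]] by (simp add: o_def)
  have "norm (g' (f x) (f' x v)) \<le> L * norm (f' x v)" by (rule C11_onD(2)[OF g fx])
  also have "\<dots> \<le> L * (K * norm v)"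
    by (intro mult_left_mono C11_onD(2)[OF f x] assms)
  also have "\<dots> \<le> (L * K + L * K * K) * norm v"
    using assms by (simp add: algebra_simps)
  finally show "norm (g' (f x) (f' x v)) \<le> (L * K + L * K * K) * norm v" .
  fix y assume y: "y \<in> A"
  then have fy: "f y \<in> B" using sub by auto
  have lin: "linear (g' (f x))" by (rule C11_on_linear[OF g fx])
  have "g' (f x) (f' x v) - g' (f y) (f' y v)
      = g' (f x) (f' x v - f' y v) + (g' (f x) (f' y v) - g' (f y) (f' y v))"
    by (simp add: linear_diff[OF lin])
  also have "norm \<dots> \<le> L * norm (f' x v - f' y v) + L * dist (f x) (f y) * norm (f' y v)"
    by (intro order_trans[OF norm_triangle_ineq] add_mono C11_onD(2)[OF g fx] C11_onD(3)[OF g fx fy])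
  also have "\<dots> \<le> L * (K * dist x y * norm v) + L * (K * dist x y) * (K * norm v)"
    using assms C11_onD(3)[OF f x y] C11_onD(2)[OF f y] C11_on_lipschitz[OF f assms(4) x y]
    by (intro add_mono mult_left_mono mult_mono) (auto simp: dist_norm)
  also have "\<dots> = (L * K + L * K * K) * dist x y * norm v"
    by (simp add: algebra_simps)
  finally show "norm (g' (f x) (f' x v) - g' (f y) (f' y v)) \<le> (L * K + L * K * K) * dist x y * norm v" .
qed

lemma Ck_on_1_imp_lipschitz:
  fixes d :: "'a::euclidean_space \<Rightarrow> 'b::real_normed_vector"
  assumes "Ck_on 1 U d" "cball x r \<subseteq> U"
  obtains C where "C \<ge> 0" "\<And>y z. \<lbrakk>y \<in> cball x r; z \<in> cball x r\<rbrakk> \<Longrightarrow> norm (d y - d z) \<le> C * dist y z"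
    "\<And>y. y \<in> cball x r \<Longrightarrow> norm (d y) \<le> C"
proof -
  obtain d' where d': "\<And>y. y \<in> U \<Longrightarrow> (d has_derivative d' y) (at y)"
    "\<And>v. continuous_on U (\<lambda>y. d' y v)"
    using assms(1) by auto
  have "\<forall>v. \<exists>C. 0 \<le> C \<and> (\<forall>y\<in>cball x r. norm (d' y v) \<le> C)"
  proof
    fix v
    have "compact ((\<lambda>y. d' y v) ` cball x r)"
      by (intro compact_continuous_image continuous_on_subset[OF d'(2)] assms) auto
    then obtain C where C: "\<forall>y\<in>cball x r. norm (d' y v) \<le> C"
      by (auto dest!: compact_imp_bounded simp: bounded_iff)
    then show "\<exists>C. 0 \<le> C \<and> (\<forall>y\<in>cball x r. norm (d' y v) \<le> C)"
      by (intro exI[of _ "max C 0"]) (auto simp: le_max_iff_disj)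
  qed
  from choice[OF this] obtain C where C: "\<And>v. C v \<ge> 0" "\<And>v y. y \<in> cball x r \<Longrightarrow> norm (d' y v) \<le> C v"
    by blast
  define C1 where "C1 = (\<Sum>b\<in>Basis. C b)"
  have C1: "norm (d' y v) \<le> C1 * norm v" if y: "y \<in> cball x r" for y v
  proof -
    have lin: "linear (d' y)" using d'(1) y assms(2) has_derivative_linear by blast
    have "d' y v = d' y (\<Sum>b\<in>Basis. (v \<bullet> b) *\<^sub>R b)" by (simp add: euclidean_representation)
    also have "\<dots> = (\<Sum>b\<in>Basis. (v \<bullet> b) *\<^sub>R d' y b)"
      by (simp add: linear_sum[OF lin] linear_scale[OF lin])
    also have "norm \<dots> \<le> (\<Sum>b\<in>Basis. norm v * C b)"
      by (intro order_trans[OF norm_sum] sum_mono)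
        (unfold norm_scaleR real_norm_def, intro mult_mono Basis_le_norm C y, auto)
    finally show ?thesis by (simp add: C1_def sum_distrib_left mult.commute)
  qed
  have dc: "continuous_on (cball x r) d"
    using d'(1) assms(2) by (meson continuous_at_imp_continuous_on has_derivative_continuous subsetD)
  then have "bounded (d ` cball x r)"
    by (rule compact_imp_bounded[OF compact_continuous_image[OF _ compact_cball]])
  then obtain C2 where C2: "\<forall>y\<in>cball x r. norm (d y) \<le> C2"
    by (auto simp: bounded_iff)
  have C10: "C1 \<ge> 0" unfolding C1_def by (intro sum_nonneg C)
  show ?thesis
  proof (rule that[of "max C1 C2"])
    show "0 \<le> max C1 C2" using C10 by auto
    fix y assume y: "y \<in> cball x r"
    show "norm (d y) \<le> max C1 C2" using C2 y by (auto simp: le_max_iff_disj)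
    fix z assume z: "z \<in> cball x r"
    have "norm (d y - d z) \<le> C1 * norm (y - z)"
    proof (rule differentiable_bound[OF convex_cball[of x r], where f' = d'])
      fix w assume w: "w \<in> cball x r"
      then show "(d has_derivative d' w) (at w within cball x r)"
        using d'(1) assms(2) has_derivative_at_withinI by blast
      show "onorm (d' w) \<le> C1" by (intro onorm_le C1 w)
    qed (use y z in auto)
    also have "\<dots> \<le> max C1 C2 * norm (y - z)" by (intro mult_right_mono) auto
    finally show "norm (d y - d z) \<le> max C1 C2 * dist y z" by (simp add: dist_norm)
  qed
qed

text \<open>The definition of smoothness speaks of directional derivatives. The bounds are obtained on a compact
ball for each of the finitely many basis directions and then added up.\<close>

lemma smooth_imp_locally_C11:
  fixes g :: "'a::euclidean_space \<Rightarrow> 'b::real_normed_vector"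
  assumes "\<forall>k. Ck_on k U g" "cball x r \<subseteq> U"
  obtains K g' where "K \<ge> 1" "C11_on (cball x r) K g g'"
proof -
  have "Ck_on 2 U g" using assms by auto
  then obtain g' where g': "\<And>y. y \<in> U \<Longrightarrow> (g has_derivative g' y) (at y)"
    "\<And>v. Ck_on 1 U (\<lambda>y. g' y v)"
    by (auto simp: numeral_2_eq_2)
  have "\<forall>v. \<exists>C. 0 \<le> C \<and> (\<forall>y\<in>cball x r. \<forall>z\<in>cball x r. norm (g' y v - g' z v) \<le> C * dist y z) \<and>
       (\<forall>y\<in>cball x r. norm (g' y v) \<le> C)"
  proof
    fix v
    obtain C where "0 \<le> C" "\<And>y z. \<lbrakk>y \<in> cball x r; z \<in> cball x r\<rbrakk> \<Longrightarrow> norm (g' y v - g' z v) \<le> C * dist y z"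
      "\<And>y. y \<in> cball x r \<Longrightarrow> norm (g' y v) \<le> C"
      using Ck_on_1_imp_lipschitz[OF g'(2)[of v] assms(2)] by blast
    then show "\<exists>C. 0 \<le> C \<and> (\<forall>y\<in>cball x r. \<forall>z\<in>cball x r. norm (g' y v - g' z v) \<le> C * dist y z) \<and>
       (\<forall>y\<in>cball x r. norm (g' y v) \<le> C)" by blast
  qed
  from choice[OF this] obtain C where C: "\<And>v. C v \<ge> 0"
     "\<And>v y z. y\<in>cball x r \<Longrightarrow> z\<in>cball x r \<Longrightarrow> norm (g' y v - g' z v) \<le> C v * dist y z"
     "\<And>v y. y\<in>cball x r \<Longrightarrow> norm (g' y v) \<le> C v"
    by blast
  define K where "K = (\<Sum>b\<in>Basis. C b) + 1"
  have K0: "0 \<le> (\<Sum>b\<in>Basis. C b)" by (intro sum_nonneg C)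
  have ex: "g' y v = (\<Sum>b\<in>Basis. (v \<bullet> b) *\<^sub>R g' y b)" if y: "y \<in> cball x r" for y v
  proof -
    have lin: "linear (g' y)" using g'(1) y assms(2) has_derivative_linear by blast
    have "g' y v = g' y (\<Sum>b\<in>Basis. (v \<bullet> b) *\<^sub>R b)" by (simp add: euclidean_representation)
    also have "\<dots> = (\<Sum>b\<in>Basis. (v \<bullet> b) *\<^sub>R g' y b)"
      by (simp add: linear_sum[OF lin] linear_scale[OF lin])
    finally show ?thesis .
  qed
  show ?thesis
  proof (rule that[of K g'])
    show "K \<ge> 1" using K0 by (simp add: K_def)
    show "C11_on (cball x r) K g g'"
      unfolding C11_on_def
    proof (intro conjI ballI allI)
      fix y v assume y: "y \<in> cball x r"
      show "(g has_derivative g' y) (at y)" using g'(1) y assms(2) by auto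
      have "norm (g' y v) \<le> (\<Sum>b\<in>Basis. norm v * C b)"
        unfolding ex[OF y, of v]
        by (intro order_trans[OF norm_sum] sum_mono)
        (unfold norm_scaleR real_norm_def, intro mult_mono Basis_le_norm C y, auto)
      also have "\<dots> = (\<Sum>b\<in>Basis. C b) * norm v"
        by (subst sum_distrib_left[symmetric]) (rule mult.commute)
      also have "\<dots> \<le> K * norm v"
        by (intro mult_right_mono) (auto simp: K_def)
      finally show "norm (g' y v) \<le> K * norm v" .
      fix z assume z: "z \<in> cball x r"
      have "norm (g' y v - g' z v) = norm (\<Sum>b\<in>Basis. (v \<bullet> b) *\<^sub>R (g' y b - g' z b))"
        by (simp add: ex[OF y, of v] ex[OF z, of v] scaleR_right_diff_distrib sum_subtractf)
      also have "\<dots> \<le> (\<Sum>b\<in>Basis. norm v * (C b * dist y z))"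
        by (intro order_trans[OF norm_sum] sum_mono)
        (unfold norm_scaleR real_norm_def, intro mult_mono Basis_le_norm C y z, auto)
      also have "\<dots> = (\<Sum>b\<in>Basis. C b) * dist y z * norm v"
        unfolding sum_distrib_right by (intro sum.cong) auto
      also have "\<dots> \<le> K * dist y z * norm v"
        by (intro mult_right_mono) (auto simp: K_def)
      finally show "norm (g' y v - g' z v) \<le> K * dist y z * norm v" .
    qed
  qed
qed

section \<open>Area of parallelograms\<close>

definition det2 :: "real^2 \<Rightarrow> real^2 \<Rightarrow> real" where
  "det2 u v = u $ 1 * v $ 2 - u $ 2 * v $ 1"

text \<open>The factor by which a linear map multiplies areas, i.e. the square root of its Gram determinant.\<close>

definition area_factor :: "(real^2 \<Rightarrow> real^3) \<Rightarrow> real" where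
  "area_factor D = norm (D (axis 1 1) \<times> D (axis 2 1))"

lemma vec2_expand: "v = v $ 1 *\<^sub>R axis 1 1 + v $ 2 *\<^sub>R axis 2 (1::real)" for v :: "real^2"
  by (simp add: vec_eq_iff forall_2 axis_def)

lemma linear_cross:
  assumes "linear D"
  shows "D u \<times> D v = det2 u v *\<^sub>R (D (axis 1 1) \<times> D (axis 2 1))"
proof -
  have *: "D w = w $ 1 *\<^sub>R D (axis 1 1) + w $ 2 *\<^sub>R D (axis 2 1)" for w
    using arg_cong[OF vec2_expand[of w], of D] by (simp add: linear_add[OF assms] linear_scale[OF assms])
  have **: "(a *\<^sub>R p + b *\<^sub>R q) \<times> (c *\<^sub>R p + d *\<^sub>R q) = (a * d - b * c) *\<^sub>R (p \<times> q)"
    for a b c d and p q :: "real^3"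
    by (simp add: vec_eq_iff forall_3 cross_components algebra_simps)
  show ?thesis
    unfolding det2_def by (rule trans[OF arg_cong2[OF *[of u] *[of v], of "(\<times>)"] **])
qed

lemma norm_linear_cross:
  assumes "linear D"
  shows "norm (D u \<times> D v) = \<bar>det2 u v\<bar> * area_factor D"
  by (simp add: linear_cross[OF assms, of u v] area_factor_def)

lemma norm_cross_le: "norm (x \<times> y) \<le> norm x * norm y" for x y :: "real^3"
proof -
  have "(norm (x \<times> y))\<^sup>2 \<le> (norm x * norm y)\<^sup>2"
    using norm_cross_dot[of x y] by (smt (verit) zero_le_power2)
  then show ?thesis by (simp add: power2_le_iff_abs_le)
qed

lemma abs_det2_le: "\<bar>det2 u v\<bar> \<le> norm u * norm v"
proof -
  have "(u \<bullet> u) * (v \<bullet> v) - (det2 u v)\<^sup>2 = (u $ 1 * v $ 1 + u $ 2 * v $ 2)\<^sup>2"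
    unfolding det2_def inner_vec_def sum_2 by (simp add: power2_eq_square algebra_simps)
  then have "(det2 u v)\<^sup>2 \<le> (u \<bullet> u) * (v \<bullet> v)"
    by (smt (verit) zero_le_power2)
  then have "(det2 u v)\<^sup>2 \<le> (norm u * norm v)\<^sup>2"
    by (simp add: dot_square_norm power_mult_distrib)
  then show ?thesis by (simp add: power2_le_iff_abs_le)
qed

lemma area_factor_le:
  assumes "\<And>v. norm (D v) \<le> K * norm v"
  shows "area_factor D \<le> K\<^sup>2"
proof -
  have K: "0 \<le> K" using order_trans[OF norm_ge_zero assms[of "axis 1 1"]] by simp
  have "area_factor D \<le> norm (D (axis 1 1)) * norm (D (axis 2 1))"
    unfolding area_factor_def by (rule norm_cross_le)
  also have "\<dots> \<le> K * K"
    using assms[of "axis 1 1"] assms[of "axis 2 1"] K by (intro mult_mono) auto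
  finally show ?thesis by (simp add: power2_eq_square)
qed

text \<open>The component of the first column orthogonal to the second column is the image of a vector whose
first coordinate is 1. Hence both its length and that of the second column are at least \<open>1 / K\<close>, and the
area factor is the product of these two lengths.\<close>

lemma area_factor_ge:
  assumes "linear D" "K > 0" "\<And>v. norm v \<le> K * norm (D v)"
  shows "1 / K\<^sup>2 \<le> area_factor D"
proof -
  define u where "u = D (axis 1 1)"
  define v where "v = D (axis 2 1)"
  have v: "1 \<le> K * norm v" using assms(3)[of "axis 2 1"] by (simp add: v_def)
  then have v0: "v \<noteq> 0" by auto
  define w where "w = u - (u \<bullet> v / (v \<bullet> v)) *\<^sub>R v"
  define e where "e = axis 1 1 - (u \<bullet> v / (v \<bullet> v)) *\<^sub>R (axis 2 1 :: real^2)"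
  have we: "w = D e"
    by (simp add: w_def e_def u_def v_def linear_diff[OF assms(1)] linear_scale[OF assms(1)])
  have "1 = \<bar>e $ 1\<bar>" by (simp add: e_def axis_def)
  also have "\<dots> \<le> norm e" by (rule component_le_norm_cart)
  also have "\<dots> \<le> K * norm w" using assms(3)[of e] we by simp
  finally have w: "1 \<le> K * norm w" .
  have "w \<bullet> v = 0" using v0 by (simp add: w_def inner_diff_left)
  then have "norm (w \<times> v) = norm w * norm v"
    using norm_cross_dot[of w v] by (simp add: power_eq_iff_eq_base)
  moreover have "w \<times> v = u \<times> v" by (simp add: w_def Cross3.left_diff_distrib cross_mult_left)
  ultimately have "area_factor D = norm w * norm v" by (simp add: area_factor_def u_def v_def)
  moreover have "1 * 1 \<le> (K * norm w) * (K * norm v)" using v w by (intro mult_mono) auto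
  ultimately show ?thesis using assms(2)
    by (simp add: field_simps power2_eq_square)
qed

lemma norm_cross_diff_le:
  fixes u v x y :: "real^3"
  assumes "norm u \<le> A" "norm y \<le> A" "norm (u - x) \<le> e" "norm (v - y) \<le> e"
  shows "norm (u \<times> v - x \<times> y) \<le> 2 * A * e"
proof -
  have "u \<times> v - x \<times> y = u \<times> (v - y) + (u - x) \<times> y"
    by (simp add: Cross3.left_diff_distrib Cross3.right_diff_distrib)
  also have "norm \<dots> \<le> norm u * norm (v - y) + norm (u - x) * norm y"
    by (intro order_trans[OF norm_triangle_ineq] add_mono norm_cross_le)
  also have "\<dots> \<le> A * e + e * A"
    using assms by (intro add_mono mult_mono) (auto intro: order_trans[OF norm_ge_zero])
  finally show ?thesis by simp
qed

lemma area_factor_diff_le: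
  assumes "\<And>v. norm (D v) \<le> K * norm v" "\<And>v. norm (D' v) \<le> K * norm v"
    "\<And>v. norm (D v - D' v) \<le> e * norm v"
  shows "\<bar>area_factor D - area_factor D'\<bar> \<le> 2 * K * e"
proof -
  have "\<bar>area_factor D - area_factor D'\<bar>
      \<le> norm (D (axis 1 1) \<times> D (axis 2 1) - D' (axis 1 1) \<times> D' (axis 2 1))"
    unfolding area_factor_def by (rule norm_triangle_ineq3)
  also have "\<dots> \<le> 2 * K * e"
    using assms(1)[of "axis 1 1"] assms(2)[of "axis 2 1"] assms(3)[of "axis 1 1"] assms(3)[of "axis 2 1"]
    by (intro norm_cross_diff_le) auto
  finally show ?thesis .
qed

section \<open>A triangle in one coordinate patch\<close>

subsection \<open>Dilations of a convex set\<close>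

definition dilate :: "'a::real_vector \<Rightarrow> real \<Rightarrow> 'a \<Rightarrow> 'a" where
  "dilate g k x = g + k *\<^sub>R (x - g)"

text \<open>The point \<open>g + e / s\<close> lies in the ball, and \<open>x + e\<close> is the dilation of a convex combination of this
point and \<open>x\<close>. The next lemma rests on the same convex combination.\<close>

lemma dilate_absorbs:
  fixes C :: "'a::real_normed_vector set"
  assumes "convex C" "cball g \<rho> \<subseteq> C" "0 < \<rho>" "0 < s" "x \<in> C" "norm e \<le> s * \<rho>"
  shows "x + e \<in> dilate g (1 + s) ` C"
proof -
  define z where "z = g + (1 / s) *\<^sub>R e"
  have "norm ((1 / s) *\<^sub>R e) \<le> \<rho>"
    using assms by (simp add: field_simps)
  then have z: "z \<in> C" using assms(2) by (auto simp: z_def dist_norm)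
  define w where "w = (1 / (1 + s)) *\<^sub>R x + (s / (1 + s)) *\<^sub>R z"
  have "w \<in> C" unfolding w_def
    using assms z by (intro convexD) (auto simp: field_simps)
  moreover have "dilate g (1 + s) w = x + e"
  proof -
    have "(1 + s) *\<^sub>R w = x + s *\<^sub>R z"
      using assms(4) by (simp add: w_def scaleR_add_right)
    also have "s *\<^sub>R z = s *\<^sub>R g + e" using assms(4) by (simp add: z_def scaleR_add_right)
    finally show ?thesis by (simp add: dilate_def scaleR_diff_right scaleR_add_left)
  qed
  ultimately show ?thesis by (metis image_eqI)
qed

lemma dilate_margin:
  fixes C :: "'a::real_normed_vector set"
  assumes "convex C" "cball g \<rho> \<subseteq> C" "0 < \<rho>" "0 < s" "s \<le> 1" "x \<in> C" "norm e \<le> s * \<rho>"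
  shows "dilate g (1 - s) x + e \<in> C"
proof -
  define z where "z = g + (1 / s) *\<^sub>R e"
  have "norm ((1 / s) *\<^sub>R e) \<le> \<rho>"
    using assms by (simp add: field_simps)
  then have z: "z \<in> C" using assms(2) by (auto simp: z_def dist_norm)
  have "(1 - s) *\<^sub>R x + s *\<^sub>R z \<in> C"
    using assms z by (intro convexD) auto
  also have "(1 - s) *\<^sub>R x + s *\<^sub>R z = dilate g (1 - s) x + e"
    using assms(4) by (simp add: z_def dilate_def scaleR_add_right scaleR_diff_right scaleR_diff_left)
  finally show ?thesis .
qed

lemma measure_dilate:
  fixes g :: "'a::euclidean_space"
  shows "measure lebesgue (dilate g k ` S) = \<bar>k\<bar> ^ DIM('a) * measure lebesgue S"
proof -
  have "dilate g k = (\<lambda>x. k *\<^sub>R x + (g - k *\<^sub>R g))"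
    by (auto simp: dilate_def fun_eq_iff scaleR_diff_right)
  then show ?thesis using measure_lebesgue_affine[of k "g - k *\<^sub>R g" S] by simp
qed

subsection \<open>Comparison of areas\<close>

lemma det2_simps [simp]:
  "det2 u u = 0" "det2 (a *\<^sub>R u) v = a * det2 u v" "det2 u (a *\<^sub>R v) = a * det2 u v"
  "det2 (u + w) v = det2 u v + det2 w v" "det2 u (v + w) = det2 u v + det2 u w"
  "det2 (u - w) v = det2 u v - det2 w v" "det2 u (v - w) = det2 u v - det2 u w"
  "det2 0 v = 0" "det2 u 0 = 0"
  by (auto simp: det2_def algebra_simps)

text \<open>Cramer's rule.\<close>

lemma det2_cramer: "det2 u v *\<^sub>R e = det2 e v *\<^sub>R u + det2 u e *\<^sub>R v"
  by (simp add: vec_eq_iff forall_2 det2_def algebra_simps)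

lemma quotient_square_diff_le:
  fixes X Y x y :: real
  assumes "0 \<le> X" "X \<le> A" "0 \<le> Y" "Y \<le> A" "m \<le> x" "m / 2 \<le> y" "0 < m"
    "\<bar>X - Y\<bar> \<le> e" "\<bar>x - y\<bar> \<le> e"
  shows "\<bar>X\<^sup>2 / x - Y\<^sup>2 / y\<bar> \<le> 2 * A * e / m + 2 * A\<^sup>2 * e / m\<^sup>2"
proof -
  have pos: "0 < x" "0 < y" "0 \<le> e" "0 \<le> A" using assms by auto
  have "X\<^sup>2 / x - Y\<^sup>2 / y = (X + Y) * (X - Y) / x + Y\<^sup>2 * (y - x) / (x * y)"
    using pos by (simp add: field_simps power2_eq_square)
  also have "\<bar>\<dots>\<bar> \<le> \<bar>(X + Y) * (X - Y) / x\<bar> + \<bar>Y\<^sup>2 * (y - x) / (x * y)\<bar>"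
    by (rule abs_triangle_ineq)
  also have "\<bar>(X + Y) * (X - Y) / x\<bar> = (X + Y) * \<bar>X - Y\<bar> / x"
    using pos assms by (simp add: abs_mult)
  also have "\<bar>Y\<^sup>2 * (y - x) / (x * y)\<bar> = Y\<^sup>2 * \<bar>x - y\<bar> / (x * y)"
    using pos assms by (simp add: abs_mult abs_minus_commute)
  also have "(X + Y) * \<bar>X - Y\<bar> / x \<le> 2 * A * e / m"
    using pos assms by (intro frac_le mult_mono) auto
  also have "Y\<^sup>2 * \<bar>x - y\<bar> / (x * y) \<le> A\<^sup>2 * e / (m * (m / 2))"
    using pos assms by (intro frac_le mult_mono power_mono) auto
  also have "A\<^sup>2 * e / (m * (m / 2)) = 2 * A\<^sup>2 * e / m\<^sup>2"
    by (simp add: power2_eq_square)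
  finally show ?thesis by simp
qed

text \<open>A planar triangle with corners \<alpha>, \<beta>, \<gamma> whose corners are mapped by \<phi> to the corners of a face and by \<open>F\<close>
to the corners of the image face. The edges of the face at \<open>\<phi> \<alpha>\<close> have length at most \<open>d\<close>, and \<kappa> is a
lower bound that shape regularity provides. The smallness of \<open>d\<close> keeps the dilation factors of core and halo
between \<open>1 / 2\<close> and \<open>5 / 4\<close>.\<close>

locale patch_triangle =
  fixes B :: "(real^2) set" and K \<kappa> d :: real
    and \<phi> F :: "real^2 \<Rightarrow> real^3" and \<phi>' F' :: "real^2 \<Rightarrow> real^2 \<Rightarrow> real^3"
    and \<alpha> \<beta> \<gamma> :: "real^2"
  assumes convex_B: "convex B" and K: "1 \<le> K" and \<kappa>: "0 < \<kappa>" and d: "0 < d"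
    and \<phi>: "C11_on B K \<phi> \<phi>'" and F: "C11_on B K F F'"
    and expanding: "\<And>x y. \<lbrakk>x \<in> B; y \<in> B\<rbrakk> \<Longrightarrow> norm (x - y) \<le> K * norm (\<phi> x - \<phi> y)"
    and nondegenerate: "\<And>x v. x \<in> B \<Longrightarrow> norm v \<le> K * norm (\<phi>' x v)"
    and corners_B: "\<alpha> \<in> B" "\<beta> \<in> B" "\<gamma> \<in> B"
    and edges_le: "norm (\<phi> \<beta> - \<phi> \<alpha>) \<le> d" "norm (\<phi> \<gamma> - \<phi> \<alpha>) \<le> d"
    and shape: "\<kappa> * d\<^sup>2 \<le> norm ((\<phi> \<beta> - \<phi> \<alpha>) \<times> (\<phi> \<gamma> - \<phi> \<alpha>))"
    and small: "192 * K ^ 7 * d \<le> \<kappa>"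
begin

text \<open>The centroid \<open>g\<close> is the center of a disk of radius \<rho> in the triangle \<open>t\<close>. The projection of the face,
read in coordinates, moves points by at most \<epsilon>, which is quadratic in \<open>d\<close> while \<rho> is linear; hence the
quotient \<open>s\<close> is linear in \<open>d\<close>. The core keeps a margin of \<open>2 * \<epsilon>\<close> to the boundary of \<open>t\<close>: one \<epsilon> is needed
to cover the core by Brouwer's theorem, the other one to keep the preimages of core points away from the
edges of the face. The affine map \<open>plane_map\<close> sends \<open>t\<close> onto the face.\<close>

definition "u = \<beta> - \<alpha>"
definition "v = \<gamma> - \<alpha>"
definition "\<delta> = det2 u v"
definition "t = convex hull {\<alpha>, \<beta>, \<gamma>}"
definition "g = \<alpha> + (1/3) *\<^sub>R u + (1/3) *\<^sub>R v"
definition "q y = (area_factor (F' y))\<^sup>2 / area_factor (\<phi>' y)"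
definition "s = 48 * K ^ 7 * d / \<kappa>"
definition "\<epsilon> = 4 * K ^ 4 * d\<^sup>2"
definition "\<rho> = \<kappa> * d / (12 * K ^ 3)"
definition "halo = dilate g (1 + s) ` t"
definition "core = dilate g (1 - 2 * s) ` t"
definition "plane_map x = \<phi> \<alpha> + (det2 (x - \<alpha>) v / \<delta>) *\<^sub>R (\<phi> \<beta> - \<phi> \<alpha>)
    + (det2 u (x - \<alpha>) / \<delta>) *\<^sub>R (\<phi> \<gamma> - \<phi> \<alpha>)"

lemma u_le: "norm u \<le> K * d" and v_le: "norm v \<le> K * d"
  using expanding[OF corners_B(2,1)] expanding[OF corners_B(3,1)] edges_le K
  unfolding u_def v_def by (smt (verit) mult_left_mono)+

lemma K_power_mono: "m \<le> n \<Longrightarrow> K ^ m \<le> K ^ n"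
  by (rule power_increasing[OF _ K])

lemma K0 [simp]: "0 < K" "0 \<le> K" "K \<noteq> 0" using K by auto

lemma square_le: "norm y \<le> K * d \<Longrightarrow> K * (norm y)\<^sup>2 \<le> K ^ 3 * d\<^sup>2"
proof -
  assume "norm y \<le> K * d"
  then have "K * (norm y)\<^sup>2 \<le> K * (K * d)\<^sup>2" by (intro mult_left_mono power_mono) auto
  then show ?thesis by (simp add: eval_nat_numeral mult_ac)
qed

lemma cross_approx:
  assumes G: "C11_on B K G G'"
  shows "\<bar>norm ((G \<beta> - G \<alpha>) \<times> (G \<gamma> - G \<alpha>)) - \<bar>\<delta>\<bar> * area_factor (G' \<alpha>)\<bar> \<le> 2 * K ^ 5 * d ^ 3"
    and "norm ((G \<beta> - G \<alpha>) \<times> (G \<gamma> - G \<alpha>)) \<le> K ^ 4 * d\<^sup>2"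
    and "area_factor (G' \<alpha>) \<le> K\<^sup>2"
proof -
  have Kd: "0 \<le> K * d" using d by auto
  have lin: "linear (G' \<alpha>)" using C11_on_linear[OF G corners_B(1)] .
  have 1: "norm (G \<beta> - G \<alpha>) \<le> K\<^sup>2 * d" "norm (G \<gamma> - G \<alpha>) \<le> K\<^sup>2 * d"
    using C11_on_lipschitz[OF G convex_B corners_B(2,1)] C11_on_lipschitz[OF G convex_B corners_B(3,1)]
      mult_left_mono[OF u_le K0(2)] mult_left_mono[OF v_le K0(2)]
    unfolding u_def v_def power2_eq_square mult.assoc by linarith+
  have 2: "norm (G' \<alpha> v) \<le> K\<^sup>2 * d"
    using C11_onD(2)[OF G corners_B(1), of v] mult_left_mono[OF v_le K0(2)]
    unfolding power2_eq_square mult.assoc by linarith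
  have 3: "norm (G \<beta> - G \<alpha> - G' \<alpha> u) \<le> K ^ 3 * d\<^sup>2" "norm (G \<gamma> - G \<alpha> - G' \<alpha> v) \<le> K ^ 3 * d\<^sup>2"
    using C11_on_taylor[OF G convex_B corners_B(1,2)] C11_on_taylor[OF G convex_B corners_B(1,3)]
      square_le[OF u_le] square_le[OF v_le]
    unfolding u_def v_def by linarith+
  have "norm ((G \<beta> - G \<alpha>) \<times> (G \<gamma> - G \<alpha>) - G' \<alpha> u \<times> G' \<alpha> v) \<le> 2 * (K\<^sup>2 * d) * (K ^ 3 * d\<^sup>2)"
    by (rule norm_cross_diff_le[OF 1(1) 2 3])
  also have "\<dots> = 2 * K ^ 5 * d ^ 3" by (simp add: eval_nat_numeral)
  finally show "\<bar>norm ((G \<beta> - G \<alpha>) \<times> (G \<gamma> - G \<alpha>)) - \<bar>\<delta>\<bar> * area_factor (G' \<alpha>)\<bar> \<le> 2 * K ^ 5 * d ^ 3"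
    unfolding \<delta>_def norm_linear_cross[OF lin, symmetric]
    using norm_triangle_ineq3 order_trans by blast
  have "norm ((G \<beta> - G \<alpha>) \<times> (G \<gamma> - G \<alpha>)) \<le> (K\<^sup>2 * d) * (K\<^sup>2 * d)"
    using d by (intro order_trans[OF norm_cross_le] mult_mono 1) auto
  then show "norm ((G \<beta> - G \<alpha>) \<times> (G \<gamma> - G \<alpha>)) \<le> K ^ 4 * d\<^sup>2"
    by (simp add: eval_nat_numeral mult_ac)
  show "area_factor (G' \<alpha>) \<le> K\<^sup>2"
    by (rule area_factor_le[OF C11_onD(2)[OF G corners_B(1)]])
qed

lemma small_error: "2 * K ^ 5 * d ^ 3 \<le> \<kappa> * d\<^sup>2 / 2"
proof -
  have "2 * K ^ 5 * d \<le> 96 * K ^ 7 * d"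
    using d by (intro mult_right_mono mult_mono K_power_mono) auto
  also have "\<dots> \<le> \<kappa> / 2" using small by simp
  finally have "2 * K ^ 5 * d * d\<^sup>2 \<le> \<kappa> / 2 * d\<^sup>2" by (intro mult_right_mono) auto
  then show ?thesis by (simp add: eval_nat_numeral)
qed

lemma area_ge: "\<kappa> * d\<^sup>2 / 2 \<le> \<bar>\<delta>\<bar> * area_factor (\<phi>' \<alpha>)"
  using cross_approx(1)[OF \<phi>] small_error shape by linarith

lemma delta_ge: "\<kappa> * d\<^sup>2 / (2 * K\<^sup>2) \<le> \<bar>\<delta>\<bar>"
proof -
  have "\<bar>\<delta>\<bar> * area_factor (\<phi>' \<alpha>) \<le> \<bar>\<delta>\<bar> * K\<^sup>2"
    using cross_approx(3)[OF \<phi>] by (intro mult_left_mono) auto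
  then have "\<kappa> * d\<^sup>2 / 2 \<le> \<bar>\<delta>\<bar> * K\<^sup>2" using area_ge by linarith
  then show ?thesis by (simp add: pos_divide_le_eq mult_ac)
qed

lemma delta_nz: "\<delta> \<noteq> 0" "0 < \<bar>\<delta>\<bar>"
  using delta_ge \<kappa> d by (smt (verit) K0 divide_pos_pos mult_pos_pos zero_less_power)+

definition "c_energy = (4 * K ^ 9 / \<kappa> + 4 * K ^ 13 / \<kappa>\<^sup>2) * (2 * K\<^sup>2 / \<kappa>)"

text \<open>The numerator and the denominator are each replaced by their linearizations at \<alpha>. Both are of order
\<open>d\<^sup>2\<close> with errors of order \<open>d\<^sup>3\<close>, and the area of \<open>t\<close> is bounded below by a multiple of \<open>d\<^sup>2\<close>.\<close>

lemma face_energy_approx: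
  "\<bar>(norm ((F \<beta> - F \<alpha>) \<times> (F \<gamma> - F \<alpha>)) / 2)\<^sup>2 / (norm ((\<phi> \<beta> - \<phi> \<alpha>) \<times> (\<phi> \<gamma> - \<phi> \<alpha>)) / 2) - q \<alpha> * (\<bar>\<delta>\<bar> / 2)\<bar>
    \<le> c_energy * d * (\<bar>\<delta>\<bar> / 2)"
proof -
  let ?X = "norm ((F \<beta> - F \<alpha>) \<times> (F \<gamma> - F \<alpha>))"
  let ?x = "norm ((\<phi> \<beta> - \<phi> \<alpha>) \<times> (\<phi> \<gamma> - \<phi> \<alpha>))"
  let ?Y = "\<bar>\<delta>\<bar> * area_factor (F' \<alpha>)"
  let ?y = "\<bar>\<delta>\<bar> * area_factor (\<phi>' \<alpha>)"
  have dle: "\<bar>\<delta>\<bar> \<le> K\<^sup>2 * d\<^sup>2"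
    using order_trans[OF abs_det2_le mult_mono[OF u_le v_le]] d
    by (simp add: \<delta>_def power2_eq_square mult_ac)
  have "?Y \<le> (K\<^sup>2 * d\<^sup>2) * K\<^sup>2"
    using dle cross_approx(3)[OF F] by (intro mult_mono) (auto simp: area_factor_def)
  then have Y: "?Y \<le> K ^ 4 * d\<^sup>2" by (simp add: eval_nat_numeral mult_ac)
  have "\<bar>?X\<^sup>2 / ?x - ?Y\<^sup>2 / ?y\<bar> \<le> 2 * (K ^ 4 * d\<^sup>2) * (2 * K ^ 5 * d ^ 3) / (\<kappa> * d\<^sup>2)
      + 2 * (K ^ 4 * d\<^sup>2)\<^sup>2 * (2 * K ^ 5 * d ^ 3) / (\<kappa> * d\<^sup>2)\<^sup>2"
    by (rule quotient_square_diff_le)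
      (use Y cross_approx[OF F] cross_approx[OF \<phi>] shape area_ge d \<kappa> in \<open>auto simp: area_factor_def\<close>)
  also have "\<dots> = (4 * K ^ 9 / \<kappa> + 4 * K ^ 13 / \<kappa>\<^sup>2) * d * d\<^sup>2"
    using d \<kappa> by (simp add: field_simps eval_nat_numeral)
  also have "\<dots> \<le> (4 * K ^ 9 / \<kappa> + 4 * K ^ 13 / \<kappa>\<^sup>2) * d * (2 * K\<^sup>2 / \<kappa> * \<bar>\<delta>\<bar>)"
    using delta_ge \<kappa> d by (intro mult_left_mono) (simp_all add: pos_divide_le_eq pos_le_divide_eq mult_ac)
  finally have *: "\<bar>?X\<^sup>2 / ?x - ?Y\<^sup>2 / ?y\<bar> \<le> c_energy * d * \<bar>\<delta>\<bar>"
    by (simp add: c_energy_def mult_ac)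
  have "?Y\<^sup>2 / ?y = q \<alpha> * \<bar>\<delta>\<bar>"
    using delta_nz by (simp add: q_def power2_eq_square)
  moreover have "(?X / 2)\<^sup>2 / (?x / 2) = ?X\<^sup>2 / ?x / 2"
    by (simp add: power2_eq_square)
  ultimately have "(?X / 2)\<^sup>2 / (?x / 2) - q \<alpha> * (\<bar>\<delta>\<bar> / 2) = (?X\<^sup>2 / ?x - ?Y\<^sup>2 / ?y) / 2"
    by (simp add: diff_divide_distrib)
  then show ?thesis using * by (simp only: abs_divide) simp
qed

lemma t_alt: "t = {\<alpha> + a *\<^sub>R u + b *\<^sub>R v | a b. 0 \<le> a \<and> 0 \<le> b \<and> a + b \<le> 1}"
  unfolding t_def u_def v_def by (rule convex_hull_3_alt)

lemma t_subset: "t \<subseteq> B" "convex t" "compact t" "t \<noteq> {}" "\<alpha> \<in> t"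
proof -
  show "t \<subseteq> B" unfolding t_def using convex_B corners_B by (intro hull_minimal) auto
  show "compact t" unfolding t_def by (intro compact_convex_hull finite_imp_compact) auto
qed (auto simp: t_def hull_inc)

lemma plane_map_coords:
  "plane_map (\<alpha> + a *\<^sub>R u + b *\<^sub>R v) = \<phi> \<alpha> + a *\<^sub>R (\<phi> \<beta> - \<phi> \<alpha>) + b *\<^sub>R (\<phi> \<gamma> - \<phi> \<alpha>)"
proof -
  have "\<alpha> + a *\<^sub>R u + b *\<^sub>R v - \<alpha> = a *\<^sub>R u + b *\<^sub>R v" by simp
  moreover have "det2 (a *\<^sub>R u + b *\<^sub>R v) v = a * \<delta>" "det2 u (a *\<^sub>R u + b *\<^sub>R v) = b * \<delta>"
    by (auto simp: \<delta>_def)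
  ultimately show ?thesis using delta_nz by (simp add: plane_map_def del: det2_simps)
qed

lemma plane_map_image: "plane_map ` t = convex hull {\<phi> \<alpha>, \<phi> \<beta>, \<phi> \<gamma>}"
  unfolding t_alt convex_hull_3_alt by (force simp: plane_map_coords image_iff)

lemma plane_map_affine:
  "plane_map (x + c *\<^sub>R (x - y)) = plane_map x + c *\<^sub>R (plane_map x - plane_map y)"
  unfolding plane_map_def
  by (simp add: algebra_simps add_divide_distrib diff_divide_distrib)

lemma plane_map_continuous: "continuous_on A plane_map"
  unfolding plane_map_def det2_def by (intro continuous_intros) (use delta_nz in auto)

lemma t_dist: "x \<in> t \<Longrightarrow> norm (x - \<alpha>) \<le> K * d"
proof -
  assume x: "x \<in> t"
  have "t \<subseteq> cball \<alpha> (K * d)"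
    unfolding t_def using u_le v_le d
    by (intro hull_minimal convex_cball) (auto simp: u_def v_def dist_norm norm_minus_commute)
  then show ?thesis using x by (auto simp: dist_norm norm_minus_commute)
qed

text \<open>Both maps agree up to terms of order \<open>d\<^sup>2\<close> with the affine map whose linear part is the derivative of
\<phi> at \<alpha>.\<close>

lemma plane_map_approx:
  assumes "x \<in> t"
  shows "norm (\<phi> x - plane_map x) \<le> 2 * K ^ 3 * d\<^sup>2"
proof -
  obtain a b where ab: "0 \<le> a" "0 \<le> b" "a + b \<le> 1" and x: "x = \<alpha> + a *\<^sub>R u + b *\<^sub>R v"
    using assms unfolding t_alt by auto
  have lin: "linear (\<phi>' \<alpha>)" using C11_on_linear[OF \<phi> corners_B(1)] .
  have xa: "x - \<alpha> = a *\<^sub>R u + b *\<^sub>R v" by (simp add: x)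
  have 1: "norm (\<phi> x - \<phi> \<alpha> - \<phi>' \<alpha> (x - \<alpha>)) \<le> K ^ 3 * d\<^sup>2"
    using C11_on_taylor[OF \<phi> convex_B corners_B(1), of x] square_le[OF t_dist[OF assms]] assms t_subset
    by (meson order_trans subsetD)
  have 2: "norm (\<phi> \<beta> - \<phi> \<alpha> - \<phi>' \<alpha> u) \<le> K ^ 3 * d\<^sup>2" "norm (\<phi> \<gamma> - \<phi> \<alpha> - \<phi>' \<alpha> v) \<le> K ^ 3 * d\<^sup>2"
    using C11_on_taylor[OF \<phi> convex_B corners_B(1,2)] C11_on_taylor[OF \<phi> convex_B corners_B(1,3)]
      square_le[OF u_le] square_le[OF v_le]
    unfolding u_def v_def by linarith+
  have "\<phi> x - plane_map x = (\<phi> x - \<phi> \<alpha> - \<phi>' \<alpha> (x - \<alpha>))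
      - (a *\<^sub>R (\<phi> \<beta> - \<phi> \<alpha> - \<phi>' \<alpha> u) + b *\<^sub>R (\<phi> \<gamma> - \<phi> \<alpha> - \<phi>' \<alpha> v))"
    unfolding xa unfolding x plane_map_coords
    by (simp add: linear_add[OF lin] linear_scale[OF lin] algebra_simps)
  also have "norm \<dots> \<le> K ^ 3 * d\<^sup>2 + (a * (K ^ 3 * d\<^sup>2) + b * (K ^ 3 * d\<^sup>2))"
    using ab 2
    by (intro order_trans[OF norm_triangle_ineq4] add_mono[OF 1] order_trans[OF norm_triangle_ineq] add_mono)
      (auto intro!: mult_left_mono)
  also have "\<dots> = K ^ 3 * d\<^sup>2 + (a + b) * (K ^ 3 * d\<^sup>2)" by (simp add: algebra_simps)
  also have "\<dots> \<le> K ^ 3 * d\<^sup>2 + 1 * (K ^ 3 * d\<^sup>2)"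
    using ab by (intro add_left_mono mult_right_mono) auto
  finally show ?thesis by simp
qed

lemma rho_pos: "0 < \<rho>" and s_pos: "0 < s" and s_le: "s \<le> 1 / 4" and eps: "\<epsilon> = s * \<rho>" and eps_pos: "0 < \<epsilon>"
  using \<kappa> d small by (auto simp: \<rho>_def s_def \<epsilon>_def field_simps eval_nat_numeral)

text \<open>The centroid has barycentric coordinates \<open>1 / 3\<close>. By Cramer's rule a displacement by a vector of
length at most \<rho> changes two of them by at most \<open>1 / 6\<close> each, hence the third by at most \<open>1 / 3\<close>.\<close>

lemma inner_ball: "cball g \<rho> \<subseteq> t"
proof
  fix x assume "x \<in> cball g \<rho>"
  define e where "e = x - g"
  have e: "norm e \<le> \<rho>" using \<open>x \<in> cball g \<rho>\<close> by (simp add: e_def dist_norm norm_minus_commute)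
  have bnd: "\<bar>D / \<delta>\<bar> \<le> 1 / 6" if "\<bar>D\<bar> \<le> norm e * (K * d)" for D :: real
  proof -
    have "\<bar>D\<bar> \<le> \<rho> * (K * d)" using that e d by (smt (verit) K0 mult_pos_pos mult_right_mono)
    also have "\<dots> = (1 / 6) * (\<kappa> * d\<^sup>2 / (2 * K\<^sup>2))"
      by (simp add: \<rho>_def field_simps eval_nat_numeral)
    also have "\<dots> \<le> (1 / 6) * \<bar>\<delta>\<bar>" using delta_ge by (intro mult_left_mono) auto
    finally show ?thesis using delta_nz by (simp add: field_simps abs_divide)
  qed
  define a where "a = det2 e v / \<delta>"
  define b where "b = det2 u e / \<delta>"
  have "\<bar>a\<bar> \<le> 1 / 6" unfolding a_def
    by (intro bnd order_trans[OF abs_det2_le] mult_left_mono v_le) auto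
  moreover have "\<bar>b\<bar> \<le> 1 / 6" unfolding b_def
    using order_trans[OF abs_det2_le mult_right_mono[OF u_le norm_ge_zero], of e]
    by (intro bnd) (simp add: mult_ac)
  moreover have "e = a *\<^sub>R u + b *\<^sub>R v"
  proof -
    have "\<delta> *\<^sub>R e = \<delta> *\<^sub>R (a *\<^sub>R u + b *\<^sub>R v)"
      using det2_cramer[of u v e] delta_nz by (simp add: a_def b_def scaleR_add_right \<delta>_def)
    then show ?thesis using delta_nz by simp
  qed
  then have "x = \<alpha> + (1/3 + a) *\<^sub>R u + (1/3 + b) *\<^sub>R v"
    by (simp add: e_def g_def algebra_simps)
  ultimately show "x \<in> t" unfolding t_alt
    by (intro CollectI exI[of _ "1/3 + a"] exI[of _ "1/3 + b"]) auto
qed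

lemma measure_t: "measure lebesgue t = \<bar>\<delta>\<bar> / 2"
proof -
  have "t \<in> sets lborel" using t_subset by (simp add: borel_compact)
  then have "measure lebesgue t = measure lborel t" by simp
  also have "\<dots> = \<bar>\<delta>\<bar> / 2"
    unfolding t_def content_triangle
    by (simp add: \<delta>_def det2_def u_def v_def abs_minus_commute algebra_simps)
  finally show ?thesis .
qed

lemma measure_halo: "measure lebesgue halo = (1 + s)\<^sup>2 * (\<bar>\<delta>\<bar> / 2)"
  and measure_core: "measure lebesgue core = (1 - 2 * s)\<^sup>2 * (\<bar>\<delta>\<bar> / 2)"
  using s_pos s_le by (simp_all add: halo_def core_def measure_dilate measure_t)

lemma compact_halo: "compact halo" and compact_core: "compact core"
  unfolding halo_def core_def dilate_def
  using t_subset by (auto intro!: compact_continuous_image continuous_intros)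

lemma core_subset: "core \<subseteq> t"
  using dilate_margin[OF t_subset(2) inner_ball rho_pos, of "2 * s" _ 0] s_pos s_le rho_pos
  by (auto simp: core_def)

lemma core_margin: "\<lbrakk>y \<in> core; norm e \<le> 2 * \<epsilon>\<rbrakk> \<Longrightarrow> y + e \<in> t"
  using dilate_margin[OF t_subset(2) inner_ball rho_pos, of "2 * s" _ e] s_pos s_le rho_pos
  by (auto simp: core_def eps)

lemma halo_absorbs: "\<lbrakk>x \<in> t; norm e \<le> \<epsilon>\<rbrakk> \<Longrightarrow> x + e \<in> halo"
  using dilate_absorbs[OF t_subset(2) inner_ball rho_pos s_pos, of x e]
  by (auto simp: halo_def eps)

lemma g_in_t: "g \<in> t" using inner_ball rho_pos by auto

lemma halo_dist: "x \<in> halo \<Longrightarrow> norm (x - \<alpha>) \<le> 2 * K * d"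
proof -
  assume "x \<in> halo"
  then obtain w where w: "w \<in> t" and x: "x = dilate g (1 + s) w" by (auto simp: halo_def)
  have "x - \<alpha> = (1 + s) *\<^sub>R (w - \<alpha>) - s *\<^sub>R (g - \<alpha>)"
    by (simp add: x dilate_def algebra_simps)
  also have "norm \<dots> \<le> (1 + s) * (K * d) + s * (K * d)"
    using s_pos t_dist[OF w] t_dist[OF g_in_t]
    by (intro order_trans[OF norm_triangle_ineq4] add_mono) (auto intro!: mult_mono)
  also have "\<dots> = (1 + 2 * s) * (K * d)" by (simp add: algebra_simps)
  also have "\<dots> \<le> 2 * (K * d)" using s_le d by (intro mult_right_mono) auto
  finally show ?thesis by (simp add: mult_ac)
qed

end

subsection \<open>The closest-point projection of a triangle\<close>

text \<open>The face together with its closest-point projection to the surface \<open>E\<close>. The patch is large enough to contain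
the projected face, so that the projection can be read in coordinates as a continuous map \<Phi> on \<open>t\<close>.\<close>

locale projected_triangle = patch_triangle +
  fixes E :: "(real^3) set" and proj :: "real^3 \<Rightarrow> real^3"
  assumes patch_sub: "\<phi> ` B \<subseteq> E"
    and nearest: "\<And>x e. \<lbrakk>x \<in> convex hull {\<phi> \<alpha>, \<phi> \<beta>, \<phi> \<gamma>}; e \<in> E\<rbrakk> \<Longrightarrow> dist x (proj x) \<le> dist x e"
    and proj_in: "\<And>x. x \<in> convex hull {\<phi> \<alpha>, \<phi> \<beta>, \<phi> \<gamma>} \<Longrightarrow> proj x \<in> \<phi> ` B"
    and proj_cont: "continuous_on (convex hull {\<phi> \<alpha>, \<phi> \<beta>, \<phi> \<gamma>}) proj"
begin

definition "coord = the_inv_into B \<phi>"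
definition "\<Phi> x = coord (proj (plane_map x))"

lemma inj_phi: "inj_on \<phi> B"
proof (rule inj_onI)
  fix x y assume "x \<in> B" "y \<in> B" "\<phi> x = \<phi> y"
  then show "x = y" using expanding[of x y] by simp
qed

lemma coord_phi [simp]: "x \<in> B \<Longrightarrow> coord (\<phi> x) = x"
  unfolding coord_def by (rule the_inv_into_f_f[OF inj_phi])

lemma plane_map_in: "x \<in> t \<Longrightarrow> plane_map x \<in> convex hull {\<phi> \<alpha>, \<phi> \<beta>, \<phi> \<gamma>}"
  using plane_map_image by blast

lemma Phi_B: "x \<in> t \<Longrightarrow> \<Phi> x \<in> B" and phi_Phi: "x \<in> t \<Longrightarrow> \<phi> (\<Phi> x) = proj (plane_map x)"
  using proj_in[OF plane_map_in[of x]] by (auto simp: \<Phi>_def)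

text \<open>The point \<open>\<phi> x\<close> of the surface competes with the closest point, so the latter is at most as far from
\<open>plane_map x\<close>. The distance of the two surface points then bounds that of their coordinates.\<close>

lemma Phi_displacement:
  assumes x: "x \<in> t"
  shows "norm (\<Phi> x - x) \<le> \<epsilon>"
proof -
  have xB: "x \<in> B" using x t_subset by auto
  have 1: "dist (plane_map x) (\<phi> x) \<le> 2 * K ^ 3 * d\<^sup>2"
    using plane_map_approx[OF x] by (simp add: dist_norm norm_minus_commute)
  have 2: "dist (plane_map x) (proj (plane_map x)) \<le> dist (plane_map x) (\<phi> x)"
    using nearest[OF plane_map_in[OF x]] patch_sub xB by blast
  have "norm (\<Phi> x - x) \<le> K * norm (\<phi> (\<Phi> x) - \<phi> x)"
    by (rule expanding[OF Phi_B[OF x] xB])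
  also have "norm (\<phi> (\<Phi> x) - \<phi> x) \<le> 4 * K ^ 3 * d\<^sup>2"
    using 1 2 dist_triangle3[of "proj (plane_map x)" "\<phi> x" "plane_map x"]
    by (simp add: phi_Phi[OF x] dist_norm[symmetric])
  finally show ?thesis by (simp add: \<epsilon>_def eval_nat_numeral mult_ac)
qed

lemma Phi_continuous: "continuous_on t \<Phi>"
proof -
  have "dist (\<Phi> x) (\<Phi> y) \<le> K * dist (proj (plane_map x)) (proj (plane_map y))" if "x \<in> t" "y \<in> t" for x y
    using expanding[OF Phi_B Phi_B] that by (simp add: dist_norm phi_Phi)
  moreover have c: "continuous_on t (\<lambda>x. proj (plane_map x))"
    by (rule continuous_on_compose2[OF proj_cont plane_map_continuous]) (use plane_map_in in auto)
  ultimately show ?thesis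
    unfolding continuous_on_iff
  proof (intro ballI allI impI)
    fix x and e :: real assume x: "x \<in> t" and e: "0 < e"
    assume lip: "\<And>x y. x \<in> t \<Longrightarrow> y \<in> t \<Longrightarrow> dist (\<Phi> x) (\<Phi> y) \<le> K * dist (proj (plane_map x)) (proj (plane_map y))"
    have "0 < e / K" using e by simp
    then obtain r where r: "0 < r" "\<And>y. y \<in> t \<Longrightarrow> dist y x < r \<Longrightarrow> dist (proj (plane_map y)) (proj (plane_map x)) < e / K"
      using c x unfolding continuous_on_iff by blast
    show "\<exists>r>0. \<forall>y\<in>t. dist y x < r \<longrightarrow> dist (\<Phi> y) (\<Phi> x) < e"
    proof (intro exI conjI ballI impI)
      fix y assume y: "y \<in> t" "dist y x < r"
      have "K * dist (proj (plane_map y)) (proj (plane_map x)) < e"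
        using r(2)[OF y] by (simp add: pos_less_divide_eq mult.commute)
      then show "dist (\<Phi> y) (\<Phi> x) < e" using lip[OF y(1) x] by linarith
    qed (rule r(1))
  qed
qed

lemma proj_in_halo:
  assumes "z \<in> convex hull {\<phi> \<alpha>, \<phi> \<beta>, \<phi> \<gamma>}"
  obtains y where "y \<in> halo" "y \<in> B" "proj z = \<phi> y"
proof -
  obtain x where x: "x \<in> t" "z = plane_map x" using assms plane_map_image by blast
  have "x + (\<Phi> x - x) \<in> halo" by (rule halo_absorbs[OF x(1) Phi_displacement[OF x(1)]])
  then show ?thesis using that[of "\<Phi> x"] Phi_B[OF x(1)] phi_Phi[OF x(1)] x(2) by simp
qed

text \<open>A solution of \<open>\<Phi> x = y\<close> is a fixed point of the map that sends \<open>x\<close> to \<open>x + (y - \<Phi> x)\<close>, and this map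
sends \<open>t\<close> into itself because \<open>y\<close> is a core point and \<open>\<Phi> x - x\<close> is short.\<close>

lemma core_covered:
  assumes y: "y \<in> core"
  obtains z where "z \<in> convex hull {\<phi> \<alpha>, \<phi> \<beta>, \<phi> \<gamma>}" "proj z = \<phi> y"
proof -
  obtain x where x: "x \<in> t" "x + (y - \<Phi> x) = x"
  proof (rule brouwer[OF t_subset(3) t_subset(2) t_subset(4)])
    show "continuous_on t (\<lambda>x. x + (y - \<Phi> x))"
      by (intro continuous_intros Phi_continuous)
    show "(\<lambda>x. x + (y - \<Phi> x)) \<in> t \<rightarrow> t"
    proof
      fix x assume x: "x \<in> t"
      have "y + (x - \<Phi> x) \<in> t"
        using Phi_displacement[OF x] eps_pos
        by (intro core_margin[OF y]) (simp add: norm_minus_commute)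
      then show "x + (y - \<Phi> x) \<in> t" by (simp add: algebra_simps)
    qed
  qed (rule that)
  then show ?thesis
    using that[OF plane_map_in[OF x(1)]] phi_Phi[OF x(1)] by simp
qed

text \<open>Segments of the face that end at \<open>z\<close> can be prolonged beyond \<open>z\<close>: this says that \<open>z\<close> is in the relative
interior of the face, in the form in which the face property of the triangulation uses it.\<close>

lemma core_deep:
  assumes y: "y \<in> core" and z: "z \<in> convex hull {\<phi> \<alpha>, \<phi> \<beta>, \<phi> \<gamma>}" "proj z = \<phi> y"
    and w: "w \<in> convex hull {\<phi> \<alpha>, \<phi> \<beta>, \<phi> \<gamma>}"
  obtains \<eta> where "0 < \<eta>" "z + \<eta> *\<^sub>R (z - w) \<in> convex hull {\<phi> \<alpha>, \<phi> \<beta>, \<phi> \<gamma>}"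
proof -
  obtain \<xi> where \<xi>: "\<xi> \<in> t" "z = plane_map \<xi>" using z plane_map_image by blast
  obtain \<zeta> where \<zeta>: "\<zeta> \<in> t" "w = plane_map \<zeta>" using w plane_map_image by blast
  have "y \<in> B" using y core_subset t_subset by auto
  then have Phi: "\<Phi> \<xi> = y" using z \<xi> by (simp add: \<Phi>_def)
  define \<eta> where "\<eta> = \<epsilon> / (norm (\<xi> - \<zeta>) + 1)"
  have pos: "0 < norm (\<xi> - \<zeta>) + 1" using norm_ge_zero[of "\<xi> - \<zeta>"] by linarith
  have \<eta>: "0 < \<eta>" using eps_pos pos by (simp add: \<eta>_def)
  have "norm (\<eta> *\<^sub>R (\<xi> - \<zeta>)) \<le> \<epsilon>"
    using eps_pos pos by (simp add: \<eta>_def pos_divide_le_eq)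
  then have "norm ((\<xi> - y) + \<eta> *\<^sub>R (\<xi> - \<zeta>)) \<le> 2 * \<epsilon>"
    using Phi_displacement[OF \<xi>(1)] unfolding Phi
    by (intro order_trans[OF norm_triangle_ineq]) (simp add: norm_minus_commute)
  from core_margin[OF y this] have "\<xi> + \<eta> *\<^sub>R (\<xi> - \<zeta>) \<in> t" by (simp add: algebra_simps)
  from plane_map_in[OF this] show ?thesis
    by (intro that[OF \<eta>]) (simp add: plane_map_affine \<xi> \<zeta>)
qed

end

section \<open>The area measure of a compact surface\<close>

subsection \<open>Derivatives within relatively open subsets of the half plane\<close>

text \<open>At a point of the boundary line one half of the second coordinate direction still points into the
half plane, which is enough to determine a derivative.\<close>

lemma half_plane_derivative_unique:
  assumes W: "openin (top_of_set half_plane) W" and x: "x \<in> W"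
    and "(f has_derivative D) (at x within W)" "(f has_derivative D') (at x within W)"
  shows "D = D'"
proof (rule frechet_derivative_unique_within[OF assms(3,4)])
  fix i :: "real^2" and e :: real assume i: "i \<in> Basis" and e: "0 < e"
  obtain r where r: "0 < r" "\<And>y. y \<in> half_plane \<Longrightarrow> dist y x < r \<Longrightarrow> y \<in> W"
    using W x unfolding openin_euclidean_subtopology_iff by blast
  define c where "c = min e r / 2"
  have c: "0 < c" "c < e" "c < r" using e r by (auto simp: c_def min_def)
  have "0 \<le> x $ 2" using W x unfolding openin_euclidean_subtopology_iff half_plane_def by auto
  moreover have "0 \<le> i $ 2" using i by (auto simp: Basis_vec_def axis_def)
  ultimately have "x + c *\<^sub>R i \<in> half_plane" using c by (auto simp: half_plane_def)
  moreover have "dist (x + c *\<^sub>R i) x < r" using c i by (simp add: dist_norm)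
  ultimately have "x + c *\<^sub>R i \<in> W" using r by auto
  then show "\<exists>d. 0 < \<bar>d\<bar> \<and> \<bar>d\<bar> < e \<and> x + d *\<^sub>R i \<in> W" using c by (intro exI[of _ c]) auto
qed

lemma smooth_on_local_extension:
  fixes f :: "'a::euclidean_space \<Rightarrow> 'b::real_normed_vector"
  assumes "smooth_on S f" "x \<in> S"
  obtains r K g g' where "0 < r" "1 \<le> K" "C11_on (cball x r) K g g'" "\<And>y. y \<in> S \<inter> cball x r \<Longrightarrow> g y = f y"
proof -
  obtain U g where U: "open U" "x \<in> U" "\<forall>k. Ck_on k U g" "\<forall>y\<in>S \<inter> U. g y = f y"
    using assms unfolding smooth_on_def by blast
  obtain r where r: "0 < r" "cball x r \<subseteq> U" using U(1,2) open_contains_cball by blast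
  obtain K g' where "1 \<le> K" "C11_on (cball x r) K g g'"
    using smooth_imp_locally_C11[OF U(3) r(2)] by blast
  then show ?thesis using that[of r K g g'] r U(4) by blast
qed

lemma local_extension_derivative:
  assumes "C11_on (cball x r) K g g'" "\<And>y. y \<in> S \<inter> cball x r \<Longrightarrow> g y = f y" "y \<in> S" "y \<in> ball x r"
  shows "(f has_derivative g' y) (at y within S)"
proof (rule has_derivative_transform_within)
  show "(g has_derivative g' y) (at y within S)"
    using C11_onD(1)[OF assms(1), of y] assms(4) has_derivative_at_withinI by auto
  show "0 < r - dist x y" using assms(4) by simp
  fix z assume "z \<in> S" "dist z y < r - dist x y"
  then have "z \<in> S \<inter> cball x r" using dist_triangle[of x z y] by (auto simp: dist_commute)
  then show "g z = f z" by (rule assms(2))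
qed (rule assms(3))

lemma smooth_on_has_derivative:
  fixes f :: "'a::euclidean_space \<Rightarrow> 'b::real_normed_vector"
  assumes "smooth_on S f" "x \<in> S"
  obtains D where "(f has_derivative D) (at x within S)"
proof -
  obtain r K g g' where "0 < r" "1 \<le> K" "C11_on (cball x r) K g g'" "\<And>y. y \<in> S \<inter> cball x r \<Longrightarrow> g y = f y"
    using smooth_on_local_extension[OF assms] by blast
  then show ?thesis using that local_extension_derivative[of x r K g g' S f x] assms(2) by auto
qed

lemma smooth_on_continuous:
  fixes f :: "'a::euclidean_space \<Rightarrow> 'b::real_normed_vector"
  assumes "smooth_on S f"
  shows "continuous_on S f"
  unfolding continuous_on_eq_continuous_within
  using smooth_on_has_derivative[OF assms] has_derivative_continuous by blast

definition smooth_chart :: "(real^2) set \<Rightarrow> (real^2 \<Rightarrow> real^3) \<Rightarrow> bool" where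
  "smooth_chart W \<phi> \<longleftrightarrow> openin (top_of_set half_plane) W \<and> diffeomorphism W (\<phi> ` W) \<phi>"

lemma local_param_iff: "local_param M W \<phi> \<longleftrightarrow> smooth_chart W \<phi> \<and> openin (top_of_set M) (\<phi> ` W)"
  by (auto simp: local_param_def smooth_chart_def)

lemma smooth_chartD:
  assumes "smooth_chart W \<phi>"
  shows "openin (top_of_set half_plane) W" "inj_on \<phi> W" "smooth_on W \<phi>"
    "smooth_on (\<phi> ` W) (the_inv_into W \<phi>)" "W \<in> sets borel"
    "continuous_on W \<phi>" "continuous_on (\<phi> ` W) (the_inv_into W \<phi>)"
proof -
  show W: "openin (top_of_set half_plane) W" using assms by (auto simp: smooth_chart_def)
  show "inj_on \<phi> W" and s: "smooth_on W \<phi>" "smooth_on (\<phi> ` W) (the_inv_into W \<phi>)"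
    using assms by (auto simp: smooth_chart_def diffeomorphism_def bij_betw_def)
  show "continuous_on W \<phi>" "continuous_on (\<phi> ` W) (the_inv_into W \<phi>)"
    using s smooth_on_continuous by auto
  obtain U where U: "open U" "W = half_plane \<inter> U" using W by (auto simp: openin_open)
  have "closed half_plane" unfolding half_plane_def by (intro closed_Collect_le continuous_intros)
  then show "W \<in> sets borel" using U by auto
qed

lemma chart_derivative:
  assumes "smooth_chart W \<phi>" "x \<in> W"
  shows "(\<phi> has_derivative frechet_derivative \<phi> (at x within W)) (at x within W)"
    "(\<phi> has_derivative D) (at x within W) \<Longrightarrow> frechet_derivative \<phi> (at x within W) = D"
proof -
  obtain D' where "(\<phi> has_derivative D') (at x within W)"
    using smooth_on_has_derivative[OF smooth_chartD(3)[OF assms(1)] assms(2)] by blast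
  then show *: "(\<phi> has_derivative frechet_derivative \<phi> (at x within W)) (at x within W)"
    using frechet_derivative_works differentiable_def by blast
  show "(\<phi> has_derivative D) (at x within W) \<Longrightarrow> frechet_derivative \<phi> (at x within W) = D"
    using half_plane_derivative_unique[OF smooth_chartD(1)[OF assms(1)] assms(2) *] by blast
qed

lemma area_density_alt: "area_density W \<phi> x = area_factor (frechet_derivative \<phi> (at x within W))"
  by (simp add: area_density_def area_factor_def Let_def)

lemma area_density_nonneg [simp]: "0 \<le> area_density W \<phi> x"
  by (simp add: area_density_alt area_factor_def)

lemma area_density_continuous:
  assumes "smooth_chart W \<phi>"
  shows "continuous_on W (area_density W \<phi>)"
  unfolding continuous_on_iff
proof (intro ballI allI impI)
  fix x and e :: real assume x: "x \<in> W" and e: "0 < e"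
  obtain r K g g' where r: "0 < r" and K: "1 \<le> K" and C: "C11_on (cball x r) K g g'"
    and eq: "\<And>y. y \<in> W \<inter> cball x r \<Longrightarrow> g y = \<phi> y"
    using smooth_on_local_extension[OF smooth_chartD(3)[OF assms] x] by blast
  have ad: "area_density W \<phi> y = area_factor (g' y)" if "y \<in> W" "y \<in> ball x r" for y
    unfolding area_density_alt
    using chart_derivative(2)[OF assms that(1)] local_extension_derivative[OF C eq that] by simp
  show "\<exists>d>0. \<forall>y\<in>W. dist y x < d \<longrightarrow> dist (area_density W \<phi> y) (area_density W \<phi> x) < e"
  proof (intro exI conjI ballI impI)
    show "0 < min r (e / (2 * K * K))" using r e K by simp
    fix y assume y: "y \<in> W" "dist y x < min r (e / (2 * K * K))"
    then have yb: "y \<in> ball x r" by (simp add: dist_commute)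
    have "\<bar>area_factor (g' y) - area_factor (g' x)\<bar> \<le> 2 * K * (K * dist y x)"
      using C11_onD[OF C] yb r
      by (intro area_factor_diff_le) auto
    also have "\<dots> < e" using y(2) K by (simp add: pos_less_divide_eq mult_ac)
    finally show "dist (area_density W \<phi> y) (area_density W \<phi> x) < e"
      using ad[OF y(1) yb] ad[OF x] r by (simp add: dist_real_def)
  qed
qed

subsection \<open>Change of parametrization\<close>

lemma borel_preimage:
  assumes "continuous_on S f" "S \<in> sets borel" "B \<in> sets borel"
  shows "{x \<in> S. f x \<in> B} \<in> sets borel"
proof -
  have "f \<in> borel_measurable (restrict_space borel S)"
    by (rule borel_measurable_continuous_on_restrict[OF assms(1)])
  from measurable_sets[OF this assms(3)]
  have "f -` B \<inter> S \<in> sets (restrict_space borel S)" by (simp add: space_restrict_space)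
  then have "f -` B \<inter> S \<in> sets borel"
    using assms(2) by (auto simp: sets_restrict_space_iff)
  moreover have "{x \<in> S. f x \<in> B} = f -` B \<inter> S" by auto
  ultimately show ?thesis by simp
qed

lemma borel_openin: "openin (top_of_set S) T \<Longrightarrow> S \<in> sets borel \<Longrightarrow> T \<in> sets borel"
  by (auto simp: openin_open)

lemma borel_measurable_restrict_indicator:
  fixes f :: "'a::topological_space \<Rightarrow> real"
  assumes "continuous_on S f" "S \<in> sets borel"
  shows "(\<lambda>x. indicator S x * f x) \<in> borel_measurable borel"
  using borel_measurable_continuous_on_restrict[OF assms(1)] assms(2)
  by (simp add: borel_measurable_restrict_space_iff mult.commute)

text \<open>The change of variables formula for absolutely integrable functions shows that the two integrals attain
the same finite values; hence they also agree when they are infinite.\<close>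

lemma nn_integral_change_of_variables:
  fixes g :: "real^2 \<Rightarrow> real^2" and f :: "real^2 \<Rightarrow> real"
  assumes A: "A \<in> sets borel" and gA: "g ` A \<in> sets borel"
    and der: "\<And>x. x \<in> A \<Longrightarrow> (g has_derivative g' x) (at x within A)" and inj: "inj_on g A"
    and m1: "(\<lambda>x. indicator A x * (\<bar>det (matrix (g' x))\<bar> * f (g x))) \<in> borel_measurable borel"
    and m2: "(\<lambda>x. indicator (g ` A) x * f x) \<in> borel_measurable borel"
    and nonneg: "\<And>x. x \<in> g ` A \<Longrightarrow> 0 \<le> f x"
  shows "(\<integral>\<^sup>+x\<in>A. ennreal (\<bar>det (matrix (g' x))\<bar> * f (g x)) \<partial>lborel) = (\<integral>\<^sup>+x\<in>g ` A. ennreal (f x) \<partial>lborel)"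
proof -
  let ?D = "\<lambda>x. \<bar>det (matrix (g' x))\<bar> * f (g x)"
  have gen: "(\<integral>\<^sup>+x\<in>S. ennreal (h x) \<partial>lborel) = ennreal r \<longleftrightarrow> (h has_integral r) S"
    if m: "(\<lambda>x. indicator S x * h x) \<in> borel_measurable borel" and nn: "\<And>x. x \<in> S \<Longrightarrow> 0 \<le> h x" and r: "0 \<le> r"
    for S :: "(real^2) set" and h :: "real^2 \<Rightarrow> real" and r
  proof -
    have e1: "(\<integral>\<^sup>+x\<in>S. ennreal (h x) \<partial>lborel) = (\<integral>\<^sup>+x. ennreal (indicator S x * h x) \<partial>lborel)"
      by (intro nn_integral_cong) (auto simp: indicator_def)
    have e2: "(h has_integral r) S \<longleftrightarrow> ((\<lambda>x. indicator S x * h x) has_integral r) UNIV"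
      unfolding has_integral_restrict_UNIV[of S h, symmetric]
      by (intro has_integral_cong) (auto simp: indicator_def)
    have nn': "0 \<le> indicator S x * h x" for x using nn by (auto simp: indicator_def)
    show ?thesis unfolding e1 e2
      using nn_integral_has_integral[OF m nn' _ r] nn_integral_has_integral_lborel[OF m nn'] by blast
  qed
  have cov: "(?D has_integral r) A \<longleftrightarrow> (f has_integral r) (g ` A)" for r
  proof -
    have "(\<lambda>x. \<bar>det (matrix (g' x))\<bar> *\<^sub>R (vec (f (g x)) :: real^1)) absolutely_integrable_on A \<and>
           integral A (\<lambda>x. \<bar>det (matrix (g' x))\<bar> *\<^sub>R (vec (f (g x)) :: real^1)) = vec r
         \<longleftrightarrow> (\<lambda>x. vec (f x) :: real^1) absolutely_integrable_on (g ` A) \<and>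
           integral (g ` A) (\<lambda>x. vec (f x) :: real^1) = vec r"
      using A by (intro has_absolute_integral_change_of_variables der inj) auto
    then have *: "?D absolutely_integrable_on A \<and> integral A ?D = r \<longleftrightarrow>
        f absolutely_integrable_on (g ` A) \<and> integral (g ` A) f = r"
      by (simp add: absolutely_integrable_on_1_iff integral_on_1_eq)
    have a1: "?D absolutely_integrable_on A \<longleftrightarrow> ?D integrable_on A"
      by (intro absolutely_integrable_on_iff_nonneg) (auto intro!: mult_nonneg_nonneg nonneg)
    have a2: "f absolutely_integrable_on (g ` A) \<longleftrightarrow> f integrable_on (g ` A)"
      by (intro absolutely_integrable_on_iff_nonneg nonneg)
    show ?thesis
      using * unfolding a1 a2 has_integral_iff .
  qed
  have iff: "(\<integral>\<^sup>+x\<in>A. ennreal (?D x) \<partial>lborel) = ennreal r \<longleftrightarrow> (\<integral>\<^sup>+x\<in>g ` A. ennreal (f x) \<partial>lborel) = ennreal r"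
    if "0 \<le> r" for r
    using gen[OF m1 _ that] gen[OF m2 nonneg that] cov[of r] nonneg by auto
  show ?thesis
  proof (cases "\<integral>\<^sup>+x\<in>A. ennreal (?D x) \<partial>lborel" rule: ennreal_cases)
    case (real r) then show ?thesis using iff[of r] by simp
  next
    case top
    then show ?thesis
      by (cases "\<integral>\<^sup>+x\<in>g ` A. ennreal (f x) \<partial>lborel" rule: ennreal_cases) (use iff in auto)
  qed
qed

lemma det_matrix_2: "det (matrix T) = det2 (T (axis 1 1)) (T (axis 2 1))" for T :: "real^2 \<Rightarrow> real^2"
  by (simp add: det_2 matrix_def det2_def mult.commute)

lemma area_factor_compose:
  assumes "linear D"
  shows "area_factor (\<lambda>w. D (T w)) = \<bar>det2 (T (axis 1 1)) (T (axis 2 1))\<bar> * area_factor D"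
  using norm_linear_cross[OF assms, of "T (axis 1 1)" "T (axis 2 1)"] by (simp add: area_factor_def)

text \<open>The chart \<phi> may belong to a surface \<open>X\<close> that is larger than the one that \<psi> parametrizes, such as the
extension of a surface with boundary. The transition is taken from \<psi> to \<phi> because its domain is relatively
open in the half plane, so that derivatives within it are unique; the domain of the inverse transition
need not be relatively open.\<close>

lemma transition_map:
  assumes \<phi>: "smooth_chart W \<phi>" and \<psi>: "smooth_chart V \<psi>"
    and X: "openin (top_of_set X) (\<phi> ` W)" "\<psi> ` V \<subseteq> X"
    and z: "z \<in> V" "\<psi> z \<in> \<phi> ` W"
  obtains T' where "((\<lambda>x. the_inv_into W \<phi> (\<psi> x)) has_derivative T') (at z within {x \<in> V. \<psi> x \<in> \<phi> ` W})"
    "frechet_derivative \<psi> (at z within V)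
      = (\<lambda>w. frechet_derivative \<phi> (at (the_inv_into W \<phi> (\<psi> z)) within W) (T' w))"
proof -
  let ?T = "\<lambda>x. the_inv_into W \<phi> (\<psi> x)"
  let ?V = "{x \<in> V. \<psi> x \<in> \<phi> ` W}"
  have zV: "z \<in> ?V" using z by auto
  have TW: "?T x \<in> W" if "x \<in> ?V" for x
    using that the_inv_into_into[OF smooth_chartD(2)[OF \<phi>], of "\<psi> x" W] by auto
  have "openin (top_of_set V) (V \<inter> \<psi> -` (\<phi> ` W))"
    using X smooth_chartD(6)[OF \<psi>] continuous_openin_preimage[of V \<psi> X "\<phi> ` W"] by auto
  then have V: "openin (top_of_set half_plane) ?V"
    using openin_trans[OF _ smooth_chartD(1)[OF \<psi>], of ?V]
    by (auto simp: vimage_def Int_def)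
  have D\<psi>: "(\<psi> has_derivative frechet_derivative \<psi> (at z within V)) (at z within ?V)"
    by (rule has_derivative_subset[OF chart_derivative(1)[OF \<psi> z(1)]]) auto
  obtain D where D: "(the_inv_into W \<phi> has_derivative D) (at (\<psi> z) within \<phi> ` W)"
    using smooth_on_has_derivative[OF smooth_chartD(4)[OF \<phi>] z(2)] by blast
  have T: "(?T has_derivative (\<lambda>w. D (frechet_derivative \<psi> (at z within V) w))) (at z within ?V)"
    by (rule has_derivative_in_compose[OF D\<psi> has_derivative_subset[OF D]]) auto
  have "((\<lambda>x. \<phi> (?T x)) has_derivative (\<lambda>w. frechet_derivative \<phi> (at (?T z) within W) (D (frechet_derivative \<psi> (at z within V) w)))) (at z within ?V)"
    by (rule has_derivative_in_compose[OF T has_derivative_subset[OF chart_derivative(1)[OF \<phi> TW[OF zV]]]])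
      (use TW in auto)
  then have "(\<psi> has_derivative (\<lambda>w. frechet_derivative \<phi> (at (?T z) within W) (D (frechet_derivative \<psi> (at z within V) w)))) (at z within ?V)"
  proof (rule has_derivative_transform_within[where d = 1])
    show "\<phi> (?T x) = \<psi> x" if "x \<in> ?V" for x
      using that by (intro f_the_inv_into_f[OF smooth_chartD(2)[OF \<phi>]]) auto
  qed (use zV in auto)
  then show ?thesis
    using that[OF T] half_plane_derivative_unique[OF V zV D\<psi>] by blast
qed

lemma area_change_of_chart:
  assumes \<phi>: "smooth_chart W \<phi>" and \<psi>: "smooth_chart V \<psi>"
    and X: "openin (top_of_set X) (\<phi> ` W)" "\<psi> ` V \<subseteq> X"
    and A: "A \<in> sets borel" "A \<subseteq> V" "\<psi> ` A = \<phi> ` B" and B: "B \<in> sets borel" "B \<subseteq> W"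
  shows "(\<integral>\<^sup>+x\<in>A. ennreal (area_density V \<psi> x) \<partial>lborel) = (\<integral>\<^sup>+x\<in>B. ennreal (area_density W \<phi> x) \<partial>lborel)"
proof -
  let ?T = "\<lambda>x. the_inv_into W \<phi> (\<psi> x)"
  let ?V = "{x \<in> V. \<psi> x \<in> \<phi> ` W}"
  have AV: "A \<subseteq> ?V" using A(2,3) B(2) by blast
  have "\<forall>z\<in>?V. \<exists>T'. (?T has_derivative T') (at z within ?V) \<and>
      frechet_derivative \<psi> (at z within V) = (\<lambda>w. frechet_derivative \<phi> (at (?T z) within W) (T' w))"
  proof
    fix z assume "z \<in> ?V"
    then have z: "z \<in> V" "\<psi> z \<in> \<phi> ` W" by auto
    show "\<exists>T'. (?T has_derivative T') (at z within ?V) \<and>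
      frechet_derivative \<psi> (at z within V) = (\<lambda>w. frechet_derivative \<phi> (at (?T z) within W) (T' w))"
      by (rule transition_map[OF \<phi> \<psi> X z]) blast
  qed
  from bchoice[OF this] obtain T' where T': "\<And>z. z \<in> ?V \<Longrightarrow> (?T has_derivative T' z) (at z within ?V)"
    "\<And>z. z \<in> ?V \<Longrightarrow> frechet_derivative \<psi> (at z within V) = (\<lambda>w. frechet_derivative \<phi> (at (?T z) within W) (T' z w))"
    by blast
  have inv: "the_inv_into W \<phi> (\<phi> y) = y" if "y \<in> B" for y
    using the_inv_into_f_f[OF smooth_chartD(2)[OF \<phi>]] that B by blast
  have "?T ` A = the_inv_into W \<phi> ` (\<psi> ` A)" by auto
  also have "\<dots> = B" unfolding A(3) by (force simp: image_iff inv)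
  finally have TA: "?T ` A = B" .
  have inj: "inj_on ?T A"
  proof (rule inj_onI)
    fix x y assume x: "x \<in> A" and y: "y \<in> A" and eq: "?T x = ?T y"
    have "\<psi> x \<in> \<phi> ` W" "\<psi> y \<in> \<phi> ` W" using x y AV by auto
    then have "\<phi> (?T x) = \<psi> x" "\<phi> (?T y) = \<psi> y"
      using f_the_inv_into_f[OF smooth_chartD(2)[OF \<phi>]] by blast+
    then have "\<psi> x = \<psi> y" unfolding eq by simp
    then show "x = y" using inj_onD[OF smooth_chartD(2)[OF \<psi>]] x y A(2) by blast
  qed
  have dens: "area_density V \<psi> x = \<bar>det (matrix (T' x))\<bar> * area_density W \<phi> (?T x)" if "x \<in> A" for x
  proof -
    have xV: "x \<in> ?V" using that AV by auto
    have "?T x \<in> W" using TA that B by auto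
    then have lin: "linear (frechet_derivative \<phi> (at (?T x) within W))"
      using chart_derivative(1)[OF \<phi>] has_derivative_linear by blast
    show ?thesis
      unfolding area_density_alt T'(2)[OF xV] det_matrix_2
      by (rule area_factor_compose[OF lin])
  qed
  have m1: "(\<lambda>x. indicator A x * area_density V \<psi> x) \<in> borel_measurable borel"
    by (rule borel_measurable_restrict_indicator[OF continuous_on_subset[OF area_density_continuous[OF \<psi>] A(2)] A(1)])
  have m2: "(\<lambda>x. indicator B x * area_density W \<phi> x) \<in> borel_measurable borel"
    by (rule borel_measurable_restrict_indicator[OF continuous_on_subset[OF area_density_continuous[OF \<phi>] B(2)] B(1)])
  have eq: "(\<lambda>x. indicator A x * area_density V \<psi> x) = (\<lambda>x. indicator A x * (\<bar>det (matrix (T' x))\<bar> * area_density W \<phi> (?T x)))"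
    using dens by (auto simp: fun_eq_iff indicator_def)
  have "(\<integral>\<^sup>+x\<in>A. ennreal (area_density V \<psi> x) \<partial>lborel)
      = (\<integral>\<^sup>+x\<in>A. ennreal (\<bar>det (matrix (T' x))\<bar> * area_density W \<phi> (?T x)) \<partial>lborel)"
    using dens by (intro nn_integral_cong) (auto simp: indicator_def)
  also have "\<dots> = (\<integral>\<^sup>+x\<in>?T ` A. ennreal (area_density W \<phi> x) \<partial>lborel)"
  proof (rule nn_integral_change_of_variables[OF A(1) _ _ inj])
    show "?T ` A \<in> sets borel" using TA B by simp
    show "(?T has_derivative T' x) (at x within A)" if "x \<in> A" for x
      using has_derivative_subset[OF T'(1) AV] that AV by auto
  qed (use m1 m2 eq TA in auto)
  finally show ?thesis unfolding TA .
qed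

subsection \<open>Finite atlases\<close>

definition finite_atlas :: "(real^3) set \<Rightarrow> nat \<Rightarrow> (nat \<Rightarrow> (real^2) set) \<Rightarrow> (nat \<Rightarrow> real^2 \<Rightarrow> real^3) \<Rightarrow> bool" where
  "finite_atlas M n V \<psi> \<longleftrightarrow> (\<forall>i<n. local_param M (V i) (\<psi> i)) \<and> M = (\<Union>i<n. \<psi> i ` V i)"

lemma finite_atlas_exists:
  assumes "compact M" "smooth_surface M"
  obtains n V \<psi> where "finite_atlas M n V \<psi>"
proof -
  define C where "C = {\<phi> ` W | W \<phi>. local_param M W \<phi>}"
  have "\<forall>c\<in>C. openin (top_of_set M) c" by (auto simp: C_def local_param_def)
  moreover have "M \<subseteq> \<Union>C"
  proof
    fix p assume "p \<in> M"
    then obtain W \<phi> where "local_param M W \<phi>" "p \<in> \<phi> ` W"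
      using assms(2) unfolding smooth_surface_def by blast
    then show "p \<in> \<Union>C" unfolding C_def by (intro UnionI[of "\<phi> ` W"]) blast+
  qed
  ultimately have "\<exists>D\<subseteq>C. finite D \<and> M \<subseteq> \<Union>D"
    using assms(1)[unfolded compact_eq_openin_cover, rule_format, of C] by simp
  then obtain D where D: "D \<subseteq> C" "finite D" "M \<subseteq> \<Union>D" by blast
  obtain n and e :: "nat \<Rightarrow> (real^3) set" where e: "D = e ` {i. i < n}"
    using finite_imp_nat_seg_image_inj_on[OF D(2)] by blast
  have "\<forall>i\<in>{..<n}. \<exists>p. local_param M (fst p) (snd p) \<and> e i = snd p ` fst p"
    using D(1) unfolding e C_def by force
  from bchoice[OF this] obtain p where
    p: "\<And>i. i < n \<Longrightarrow> local_param M (fst (p i)) (snd (p i)) \<and> e i = snd (p i) ` fst (p i)"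
    by auto
  have "M = (\<Union>i<n. snd (p i) ` fst (p i))"
  proof
    show "M \<subseteq> (\<Union>i<n. snd (p i) ` fst (p i))" using D(3) p unfolding e by force
    show "(\<Union>i<n. snd (p i) ` fst (p i)) \<subseteq> M"
      using p unfolding local_param_def by (meson UN_least lessThan_iff openin_imp_subset)
  qed
  then show ?thesis using that[of n "\<lambda>i. fst (p i)" "\<lambda>i. snd (p i)"] p by (auto simp: finite_atlas_def)
qed

locale atlas =
  fixes M :: "(real^3) set" and n :: nat and V :: "nat \<Rightarrow> (real^2) set" and \<psi> :: "nat \<Rightarrow> real^2 \<Rightarrow> real^3"
  assumes M_borel: "M \<in> sets borel" and atlas: "finite_atlas M n V \<psi>"
begin

text \<open>The surface is cut into disjoint pieces, each inside the image of one chart. The area of a set is then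
the sum of the integrals of the area densities over the coordinate domains of its intersections with the
pieces.\<close>

definition "piece i = \<psi> i ` V i - (\<Union>j<i. \<psi> j ` V j)"
definition "domain_of i S = {x \<in> V i. \<psi> i x \<in> S \<inter> piece i}"
definition "atlas_area S = (\<Sum>i<n. \<integral>\<^sup>+x\<in>domain_of i S. ennreal (area_density (V i) (\<psi> i) x) \<partial>lborel)"

lemma chart: "i < n \<Longrightarrow> smooth_chart (V i) (\<psi> i)" "i < n \<Longrightarrow> openin (top_of_set M) (\<psi> i ` V i)"
  using atlas by (auto simp: finite_atlas_def local_param_iff)

lemma image_borel: "i < n \<Longrightarrow> \<psi> i ` V i \<in> sets borel" "i < n \<Longrightarrow> \<psi> i ` V i \<subseteq> M"
  using borel_openin[OF chart(2) M_borel] openin_imp_subset[OF chart(2)] by auto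

lemma piece_borel: "i < n \<Longrightarrow> piece i \<in> sets borel"
  unfolding piece_def by (intro sets.Diff sets.finite_UN image_borel) auto

lemma disjoint_pieces: "disjoint_family_on piece {..<n}"
  unfolding disjoint_family_on_def piece_def
  by (auto, metis UN_I lessThan_iff linorder_neqE_nat image_eqI)

lemma piece_Union: "M = (\<Union>i<n. piece i)"
proof
  show "M \<subseteq> (\<Union>i<n. piece i)"
  proof
    fix y assume "y \<in> M"
    then have ex: "\<exists>i. i < n \<and> y \<in> \<psi> i ` V i" using atlas by (auto simp: finite_atlas_def)
    define i where "i = (LEAST i. i < n \<and> y \<in> \<psi> i ` V i)"
    have i: "i < n" "y \<in> \<psi> i ` V i" using LeastI_ex[OF ex] by (auto simp: i_def)
    have "y \<notin> \<psi> j ` V j" if "j < i" for j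
      using not_less_Least[of j "\<lambda>i. i < n \<and> y \<in> \<psi> i ` V i"] that i(1) by (auto simp: i_def)
    then show "y \<in> (\<Union>i<n. piece i)" using i by (auto simp: piece_def)
  qed
  show "(\<Union>i<n. piece i) \<subseteq> M" using image_borel(2) by (force simp: piece_def)
qed

lemma domain_borel: "i < n \<Longrightarrow> S \<in> sets borel \<Longrightarrow> domain_of i S \<in> sets borel"
  unfolding domain_of_def
  using smooth_chartD(5,6)[OF chart(1)] piece_borel by (intro borel_preimage) auto

lemma domain_image: "\<psi> i ` domain_of i S = S \<inter> piece i"
  by (auto simp: domain_of_def piece_def)

lemma density_measurable: "i < n \<Longrightarrow> D \<in> sets borel \<Longrightarrow> D \<subseteq> V i \<Longrightarrow>
    (\<lambda>x. ennreal (area_density (V i) (\<psi> i) x) * indicator D x) \<in> borel_measurable borel"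
proof -
  assume i: "i < n" and D: "D \<in> sets borel" "D \<subseteq> V i"
  have "(\<lambda>x. indicator D x * area_density (V i) (\<psi> i) x) \<in> borel_measurable borel"
    by (rule borel_measurable_restrict_indicator[OF continuous_on_subset[OF area_density_continuous[OF chart(1)[OF i]] D(2)] D(1)])
  then have "(\<lambda>x. ennreal (indicator D x * area_density (V i) (\<psi> i) x)) \<in> borel_measurable borel"
    by measurable
  moreover have "ennreal (indicator D x * area_density (V i) (\<psi> i) x) = ennreal (area_density (V i) (\<psi> i) x) * indicator D x" for x
    by (auto simp: indicator_def)
  ultimately show ?thesis by simp
qed

text \<open>Uniqueness: the values on subsets of charts, which the definition prescribes, determine an area measure
by additivity over the pieces.\<close>

lemma area_measure_eq_atlas_area:
  assumes \<mu>: "is_area_measure M \<mu>" and S: "S \<in> sets borel" "S \<subseteq> M"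
  shows "emeasure \<mu> S = atlas_area S"
proof -
  have S': "S \<inter> piece i \<in> sets \<mu>" if "i < n" for i
    using \<mu> S piece_borel[OF that] M_borel by (auto simp: is_area_measure_def sets_restrict_space_iff)
  have "S = (\<Union>i<n. S \<inter> piece i)" using S(2) piece_Union by auto
  also have "emeasure \<mu> \<dots> = (\<Sum>i<n. emeasure \<mu> (S \<inter> piece i))"
    using S' disjoint_pieces
    by (intro sum_emeasure[symmetric]) (auto simp: disjoint_family_on_def)
  also have "\<dots> = atlas_area S"
    unfolding atlas_area_def
  proof (rule sum.cong)
    fix i assume "i \<in> {..<n}"
    then have i: "i < n" by simp
    have "local_param M (V i) (\<psi> i)" using atlas i by (auto simp: finite_atlas_def)
    moreover have "domain_of i S \<in> sets borel" "domain_of i S \<subseteq> V i"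
      using domain_borel[OF i S(1)] by (auto simp: domain_of_def)
    ultimately show "emeasure \<mu> (S \<inter> piece i) = (\<integral>\<^sup>+x\<in>domain_of i S. ennreal (area_density (V i) (\<psi> i) x) \<partial>lborel)"
      using \<mu> unfolding is_area_measure_def domain_image[symmetric] by blast
  qed simp
  finally show ?thesis .
qed

text \<open>Each integral is transported from a chart of the atlas to \<phi>; the coordinate domains of the pieces then
add up to \<open>B\<close>. For \<open>X = M\<close> this is the defining property of an area measure. A larger \<open>X\<close> allows a surface with
boundary to be measured in charts of its extension, which do not see the boundary.\<close>

lemma atlas_area_chart:
  assumes \<phi>: "smooth_chart W \<phi>" "openin (top_of_set X) (\<phi> ` W)" and X: "M \<subseteq> X"
    and B: "B \<in> sets borel" "B \<subseteq> W" "\<phi> ` B \<subseteq> M"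
  shows "\<phi> ` B \<in> sets borel"
    and "atlas_area (\<phi> ` B) = (\<integral>\<^sup>+x\<in>B. ennreal (area_density W \<phi> x) \<partial>lborel)"
proof -
  obtain U where U: "open U" "\<phi> ` W = X \<inter> U" using \<phi>(2) by (auto simp: openin_open)
  then have "M \<inter> \<phi> ` W = M \<inter> U" using X by auto
  then have MW: "M \<inter> \<phi> ` W \<in> sets borel" using U(1) M_borel by auto
  have "\<phi> ` B = {y \<in> M \<inter> \<phi> ` W. the_inv_into W \<phi> y \<in> B}"
    using B the_inv_into_f_f[OF smooth_chartD(2)[OF \<phi>(1)]] f_the_inv_into_f[OF smooth_chartD(2)[OF \<phi>(1)]]
    by (force simp: image_iff)
  then show \<phi>B: "\<phi> ` B \<in> sets borel"
    using borel_preimage[OF continuous_on_subset[OF smooth_chartD(7)[OF \<phi>(1)]] MW B(1)] by simp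
  define C where "C i = {x \<in> B. \<phi> x \<in> piece i}" for i
  have Cb: "C i \<in> sets borel" if "i < n" for i
    unfolding C_def
    using borel_preimage[OF continuous_on_subset[OF smooth_chartD(6)[OF \<phi>(1)] B(2)] B(1) piece_borel[OF that]] .
  have "atlas_area (\<phi> ` B) = (\<Sum>i<n. \<integral>\<^sup>+x\<in>C i. ennreal (area_density W \<phi> x) \<partial>lborel)"
    unfolding atlas_area_def
  proof (rule sum.cong)
    fix i assume "i \<in> {..<n}"
    then have i: "i < n" by simp
    show "(\<integral>\<^sup>+x\<in>domain_of i (\<phi> ` B). ennreal (area_density (V i) (\<psi> i) x) \<partial>lborel)
        = (\<integral>\<^sup>+x\<in>C i. ennreal (area_density W \<phi> x) \<partial>lborel)"
    proof (rule area_change_of_chart[OF \<phi>(1) chart(1)[OF i] \<phi>(2)])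
      show "\<psi> i ` V i \<subseteq> X" using image_borel(2)[OF i] X by auto
      show "\<psi> i ` domain_of i (\<phi> ` B) = \<phi> ` C i" unfolding domain_image C_def by auto
      show "C i \<subseteq> W" using B(2) by (auto simp: C_def)
    qed (use domain_borel[OF i \<phi>B] Cb[OF i] in \<open>auto simp: domain_of_def\<close>)
  qed simp
  also have "\<dots> = (\<integral>\<^sup>+x. (\<Sum>i<n. ennreal (area_density W \<phi> x) * indicator (C i) x) \<partial>lborel)"
  proof (rule nn_integral_sum[symmetric])
    fix i assume "i \<in> {..<n}"
    then have i: "i < n" by simp
    have "(\<lambda>x. indicator (C i) x * area_density W \<phi> x) \<in> borel_measurable borel"
      by (rule borel_measurable_restrict_indicator[OF continuous_on_subset[OF area_density_continuous[OF \<phi>(1)]] Cb[OF i]])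
        (use B(2) in \<open>auto simp: C_def\<close>)
    then have "(\<lambda>x. ennreal (indicator (C i) x * area_density W \<phi> x)) \<in> borel_measurable borel"
      by measurable
    moreover have "ennreal (indicator (C i) x * area_density W \<phi> x) = ennreal (area_density W \<phi> x) * indicator (C i) x" for x
      by (auto simp: indicator_def)
    ultimately show "(\<lambda>x. ennreal (area_density W \<phi> x) * indicator (C i) x) \<in> borel_measurable lborel" by simp
  qed
  also have "\<dots> = (\<integral>\<^sup>+x\<in>B. ennreal (area_density W \<phi> x) \<partial>lborel)"
  proof (rule nn_integral_cong)
    fix x
    have "(\<Sum>i<n. indicator (C i) x :: ennreal) = indicator (\<Union>i<n. C i) x"
      using disjoint_pieces by (intro indicator_UN_disjoint[symmetric]) (auto simp: disjoint_family_on_def C_def)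
    moreover have "(\<Union>i<n. C i) = B"
      using B(3) piece_Union by (auto simp: C_def)
    ultimately show "(\<Sum>i<n. ennreal (area_density W \<phi> x) * indicator (C i) x) = ennreal (area_density W \<phi> x) * indicator B x"
      by (simp add: sum_distrib_left[symmetric])
  qed
  finally show "atlas_area (\<phi> ` B) = (\<integral>\<^sup>+x\<in>B. ennreal (area_density W \<phi> x) \<partial>lborel)" .
qed

lemma atlas_area_countably_additive:
  "countably_additive (sets (restrict_space borel M)) atlas_area"
proof (rule countably_additiveI)
  fix A :: "nat \<Rightarrow> (real^3) set"
  assume A: "range A \<subseteq> sets (restrict_space borel M)" "disjoint_family A" "(\<Union>i. A i) \<in> sets (restrict_space borel M)"
  have Ab: "A j \<in> sets borel" for j
  proof -
    have "A j \<in> sets (restrict_space borel M)" using A(1) by blast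
    then show ?thesis using M_borel by (simp add: sets_restrict_space_iff)
  qed
  have "(\<Sum>j. atlas_area (A j)) = (\<Sum>i<n. \<Sum>j. \<integral>\<^sup>+x\<in>domain_of i (A j). ennreal (area_density (V i) (\<psi> i) x) \<partial>lborel)"
    unfolding atlas_area_def by (rule suminf_sum) simp
  also have "\<dots> = atlas_area (\<Union>i. A i)"
    unfolding atlas_area_def
  proof (rule sum.cong)
    fix i assume "i \<in> {..<n}"
    then have i: "i < n" by simp
    have "(\<Sum>j. \<integral>\<^sup>+x\<in>domain_of i (A j). ennreal (area_density (V i) (\<psi> i) x) \<partial>lborel)
        = (\<integral>\<^sup>+x. (\<Sum>j. ennreal (area_density (V i) (\<psi> i) x) * indicator (domain_of i (A j)) x) \<partial>lborel)"
      using density_measurable[OF i domain_borel[OF i Ab]]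
      by (intro nn_integral_suminf[symmetric]) (auto simp: domain_of_def)
    also have "\<dots> = (\<integral>\<^sup>+x\<in>domain_of i (\<Union>j. A j). ennreal (area_density (V i) (\<psi> i) x) \<partial>lborel)"
    proof (rule nn_integral_cong)
      fix x
      have dis: "disjoint_family (\<lambda>j. domain_of i (A j))"
        using A(2) by (auto simp: disjoint_family_on_def domain_of_def)
      have "(\<Sum>j. ennreal (area_density (V i) (\<psi> i) x) * indicator (domain_of i (A j)) x)
          = ennreal (area_density (V i) (\<psi> i) x) * indicator (\<Union>j. domain_of i (A j)) x"
        by (simp add: suminf_indicator[OF dis])
      moreover have "(\<Union>j. domain_of i (A j)) = domain_of i (\<Union>j. A j)" by (auto simp: domain_of_def)
      ultimately show "(\<Sum>j. ennreal (area_density (V i) (\<psi> i) x) * indicator (domain_of i (A j)) x)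
          = ennreal (area_density (V i) (\<psi> i) x) * indicator (domain_of i (\<Union>j. A j)) x" by simp
    qed
    finally show "(\<Sum>j. \<integral>\<^sup>+x\<in>domain_of i (A j). ennreal (area_density (V i) (\<psi> i) x) \<partial>lborel)
        = (\<integral>\<^sup>+x\<in>domain_of i (\<Union>j. A j). ennreal (area_density (V i) (\<psi> i) x) \<partial>lborel)" .
  qed simp
  finally show "(\<Sum>j. atlas_area (A j)) = atlas_area (\<Union>i. A i)" .
qed

definition "atlas_measure = measure_of M (sets (restrict_space borel M)) atlas_area"

lemma atlas_measure_is_area_measure: "is_area_measure M atlas_measure"
proof -
  have sp: "space (restrict_space borel M) = M" by (simp add: space_restrict_space)
  have sub: "sets (restrict_space borel M) \<subseteq> Pow M"
    using sets.space_closed[of "restrict_space borel M"] sp by simp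
  have sigma: "sigma_sets M (sets (restrict_space borel M)) = sets (restrict_space borel M)"
    using sets.sigma_sets_eq[of "restrict_space borel M"] sp by simp
  have space: "space atlas_measure = M" unfolding atlas_measure_def by (rule space_measure_of[OF sub])
  have sets: "sets atlas_measure = sets (restrict_space borel M)"
    unfolding atlas_measure_def using sigma by (simp add: sets_measure_of[OF sub])
  have pos: "positive (sets (restrict_space borel M)) atlas_area"
    by (simp add: positive_def atlas_area_def domain_of_def)
  have em: "emeasure atlas_measure S = atlas_area S" if "S \<in> sets (restrict_space borel M)" for S
    unfolding atlas_measure_def
    by (rule emeasure_measure_of_sigma[OF _ pos atlas_area_countably_additive that])
      (use sets.sigma_algebra_axioms[of "restrict_space borel M"] sp in simp)
  show ?thesis
    unfolding is_area_measure_def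
  proof (intro conjI allI impI ballI)
    fix W \<phi> B assume p: "local_param M W \<phi>" and B: "B \<in> sets borel" "B \<subseteq> W"
    have \<phi>: "smooth_chart W \<phi>" "openin (top_of_set M) (\<phi> ` W)" using p by (auto simp: local_param_iff)
    have "\<phi> ` B \<subseteq> M" using B(2) openin_imp_subset[OF \<phi>(2)] by auto
    note * = atlas_area_chart[OF \<phi> order_refl B this]
    have "\<phi> ` B \<in> sets (restrict_space borel M)"
      using *(1) \<open>\<phi> ` B \<subseteq> M\<close> M_borel by (auto simp: sets_restrict_space_iff)
    then show "emeasure atlas_measure (\<phi> ` B) = (\<integral>\<^sup>+x\<in>B. ennreal (area_density W \<phi> x) \<partial>lborel)"
      using em *(2) by simp
  qed (use space sets in auto)
qed

lemma area_measure_is_area_measure: "is_area_measure M (area_measure M)"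
proof -
  have "\<mu> = atlas_measure" if \<mu>: "is_area_measure M \<mu>" for \<mu>
  proof (rule measure_eqI)
    show s: "sets \<mu> = sets atlas_measure"
      using \<mu> atlas_measure_is_area_measure by (simp add: is_area_measure_def)
    fix S assume "S \<in> sets \<mu>"
    then have "S \<in> sets borel" "S \<subseteq> M"
      using \<mu> M_borel by (auto simp: is_area_measure_def sets_restrict_space_iff)
    then show "emeasure \<mu> S = emeasure atlas_measure S"
      using area_measure_eq_atlas_area[OF \<mu>] area_measure_eq_atlas_area[OF atlas_measure_is_area_measure] by simp
  qed
  then show ?thesis
    unfolding area_measure_def using theI[of "is_area_measure M"] atlas_measure_is_area_measure by metis
qed

end

lemma area_measure_properties:
  assumes "compact M" "smooth_surface M"
  shows space_area_measure: "space (area_measure M) = M"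
    and sets_area_measure: "sets (area_measure M) = sets (restrict_space borel M)"
    and emeasure_area_chart: "\<lbrakk>smooth_chart W \<phi>; openin (top_of_set X) (\<phi> ` W); M \<subseteq> X;
        B \<in> sets borel; B \<subseteq> W; \<phi> ` B \<subseteq> M\<rbrakk>
      \<Longrightarrow> \<phi> ` B \<in> sets borel \<and>
          emeasure (area_measure M) (\<phi> ` B) = (\<integral>\<^sup>+x\<in>B. ennreal (area_density W \<phi> x) \<partial>lborel)"
proof -
  obtain n V \<psi> where a: "finite_atlas M n V \<psi>" using finite_atlas_exists[OF assms] by blast
  interpret atlas M n V \<psi>
    using a assms(1) by unfold_locales (auto simp: borel_compact)
  note \<mu> = area_measure_is_area_measure
  show "space (area_measure M) = M" "sets (area_measure M) = sets (restrict_space borel M)"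
    using \<mu> by (auto simp: is_area_measure_def)
  assume *: "smooth_chart W \<phi>" "openin (top_of_set X) (\<phi> ` W)" "M \<subseteq> X"
        "B \<in> sets borel" "B \<subseteq> W" "\<phi> ` B \<subseteq> M"
  show "\<phi> ` B \<in> sets borel \<and>
          emeasure (area_measure M) (\<phi> ` B) = (\<integral>\<^sup>+x\<in>B. ennreal (area_density W \<phi> x) \<partial>lborel)"
    using atlas_area_chart[OF *] area_measure_eq_atlas_area[OF \<mu>, of "\<phi> ` B"] *(6) by simp
qed

section \<open>The area ratio in coordinates\<close>

text \<open>The expansion inequality for \<open>x\<close> and \<open>x + t *\<^sub>R v\<close>, divided by \<open>t\<close>, in the limit of small \<open>t\<close>.\<close>

lemma expanding_imp_nondegenerate:
  assumes C: "C11_on (ball c r) L \<phi> \<phi>'" and L: "0 \<le> L" and K: "0 < K" and x: "x \<in> ball c r"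
    and expanding: "\<And>x y. \<lbrakk>x \<in> ball c r; y \<in> ball c r\<rbrakk> \<Longrightarrow> norm (x - y) \<le> K * norm (\<phi> x - \<phi> y)"
  shows "norm v \<le> K * norm (\<phi>' x v)"
proof (cases "v = 0")
  case False
  then have v: "0 < norm v" by simp
  have lin: "linear (\<phi>' x)" by (rule C11_on_linear[OF C x])
  obtain e where e: "0 < e" "ball x e \<subseteq> ball c r"
    using openE[OF open_ball x] by blast
  show ?thesis
  proof (rule field_le_epsilon)
    fix \<epsilon> :: real assume \<epsilon>: "0 < \<epsilon>"
    define m where "m = K * (L * (norm v)\<^sup>2) + 1"
    have m: "0 < m" unfolding m_def using K L by (intro add_nonneg_pos) auto
    define t where "t = min (e / (2 * norm v)) (\<epsilon> / m)"
    have t: "0 < t" using e v \<epsilon> m by (simp add: t_def)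
    have "t * norm v \<le> e / (2 * norm v) * norm v" using v by (intro mult_right_mono) (auto simp: t_def)
    also have "\<dots> < e" using e v by simp
    finally have "x + t *\<^sub>R v \<in> ball x e" using t by (simp add: dist_norm)
    then have y: "x + t *\<^sub>R v \<in> ball c r" using e by blast
    have "norm (\<phi> (x + t *\<^sub>R v) - \<phi> x) \<le> norm (\<phi>' x (t *\<^sub>R v)) + L * (norm (t *\<^sub>R v))\<^sup>2"
      using C11_on_taylor[OF C convex_ball x y] norm_triangle_ineq2[of "\<phi> (x + t *\<^sub>R v) - \<phi> x" "\<phi>' x (t *\<^sub>R v)"]
      by simp
    also have "\<dots> = t * (norm (\<phi>' x v) + t * (L * (norm v)\<^sup>2))"
      using t by (simp add: linear_scale[OF lin] power_mult_distrib power2_eq_square algebra_simps)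
    finally have "norm (t *\<^sub>R v) \<le> K * (t * (norm (\<phi>' x v) + t * (L * (norm v)\<^sup>2)))"
      using expanding[OF y x] K by (smt (verit) add_diff_cancel_left' mult_left_mono)
    then have "t * norm v \<le> t * (K * (norm (\<phi>' x v) + t * (L * (norm v)\<^sup>2)))"
      using t by (simp add: mult_ac)
    then have "norm v \<le> K * (norm (\<phi>' x v) + t * (L * (norm v)\<^sup>2))"
      using t by simp
    also have "\<dots> = K * norm (\<phi>' x v) + t * (K * (L * (norm v)\<^sup>2))" by (simp add: algebra_simps)
    also have "t * (K * (L * (norm v)\<^sup>2)) \<le> t * m" using t by (simp add: m_def)
    also have "t * m \<le> \<epsilon>"
    proof -
      have "t * m \<le> \<epsilon> / m * m" using m by (intro mult_right_mono) (auto simp: t_def)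
      then show ?thesis using m by simp
    qed
    finally show "norm v \<le> K * norm (\<phi>' x v) + \<epsilon>" by simp
  qed
qed (use K in simp)

lemma local_param_image_subset: "local_param M V \<psi> \<Longrightarrow> \<psi> ` V \<subseteq> M"
  unfolding local_param_def by (meson openin_imp_subset)

text \<open>The inverse of the chart is smooth, and the composition of the two derivatives is the identity.\<close>

lemma chart_derivative_bounded_below:
  assumes \<psi>: "smooth_chart V \<psi>" and y: "y \<in> V"
  obtains K where "0 < K" "\<And>v. norm v \<le> K * norm (frechet_derivative \<psi> (at y within V) v)"
proof -
  let ?D = "frechet_derivative \<psi> (at y within V)"
  obtain H where H: "(the_inv_into V \<psi> has_derivative H) (at (\<psi> y) within \<psi> ` V)"
    using smooth_on_has_derivative[OF smooth_chartD(4)[OF \<psi>], of "\<psi> y"] y by blast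
  have D: "(\<psi> has_derivative ?D) (at y within V)" by (rule chart_derivative(1)[OF \<psi> y])
  have "((\<lambda>x. the_inv_into V \<psi> (\<psi> x)) has_derivative (\<lambda>v. H (?D v))) (at y within V)"
    by (rule has_derivative_in_compose[OF D H])
  then have "((\<lambda>x. x) has_derivative (\<lambda>v. H (?D v))) (at y within V)"
    by (rule has_derivative_transform_within[where d = 1])
      (use y the_inv_into_f_f[OF smooth_chartD(2)[OF \<psi>]] in auto)
  then have id: "(\<lambda>v. H (?D v)) = (\<lambda>v. v)"
    using half_plane_derivative_unique[OF smooth_chartD(1)[OF \<psi>] y] has_derivative_ident by blast
  have "bounded_linear H" using H has_derivative_bounded_linear by blast
  then obtain K where K: "0 < K" "\<And>w. norm (H w) \<le> norm w * K"
    using bounded_linear.pos_bounded by blast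
  show ?thesis
    using that[OF K(1)] K(2)[of "?D v" for v] fun_cong[OF id] by (simp add: mult.commute)
qed

text \<open>Every tangent vector is in the range of \<open>\<phi>'\<close>, because every chart of \<open>M\<close> factors through \<phi>. All derivatives
of \<open>f\<close> within \<open>M\<close> agree on tangent vectors, because the derivative of the composition of \<open>f\<close> with a chart is
unique. So the quotient of area factors satisfies the description of the area ratio, and a chart
of \<open>M\<close> provides a nondegenerate tangent parallelogram on which no other number does.\<close>

lemma area_jacobian_chart:
  assumes M: "smooth_surface M" "M \<subseteq> E"
    and \<phi>: "smooth_chart W \<phi>" "openin (top_of_set E) (\<phi> ` W)"
    and x: "x \<in> W" "\<phi> x \<in> M" and \<phi>': "(\<phi> has_derivative \<phi>') (at x within W)"
    and G: "(f has_derivative G) (at (\<phi> x) within M)"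
  shows "area_jacobian M f (\<phi> x) = area_factor (\<lambda>v. G (\<phi>' v)) / area_factor \<phi>'"
proof -
  let ?z = "\<phi> x"
  have \<phi>'_eq: "frechet_derivative \<phi> (at x within W) = \<phi>'" by (rule chart_derivative(2)[OF \<phi>(1) x(1) \<phi>'])
  have lin\<phi>: "linear \<phi>'" using \<phi>' has_derivative_linear by blast
  have linG: "linear G" using G has_derivative_linear by blast
  obtain K where K: "0 < K" "\<And>v. norm v \<le> K * norm (\<phi>' v)"
    using chart_derivative_bounded_below[OF \<phi>(1) x(1)] \<phi>'_eq by auto
  have "1 / K\<^sup>2 \<le> area_factor \<phi>'" by (rule area_factor_ge[OF lin\<phi> K])
  then have pos: "0 < area_factor \<phi>'"
    by (rule less_le_trans[rotated]) (use K(1) in simp)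
  have tangent: "u \<in> range \<phi>'" if "u \<in> tangent_plane M ?z" for u
  proof -
    from that obtain w V \<psi> y D where V: "local_param M V \<psi>" and y: "y \<in> V" "\<psi> y = ?z"
      and D: "(\<psi> has_derivative D) (at y within V)" and u: "u = D w"
      unfolding tangent_plane_def by blast
    have \<psi>: "smooth_chart V \<psi>" "\<psi> ` V \<subseteq> E"
      using V M(2) local_param_image_subset[OF V] by (auto simp: local_param_iff)
    have inv: "the_inv_into W \<phi> (\<psi> y) = x"
      using y x the_inv_into_f_f[OF smooth_chartD(2)[OF \<phi>(1)]] by simp
    obtain T' where "frechet_derivative \<psi> (at y within V) = (\<lambda>w. \<phi>' (T' w))"
      using transition_map[OF \<phi>(1) \<psi>(1) \<phi>(2) \<psi>(2) y(1)] y(2) x(1) \<phi>'_eq inv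
      by (metis imageI)
    then show ?thesis using chart_derivative(2)[OF \<psi>(1) y(1) D] u by auto
  qed
  have unique: "A u = G u" if A: "(f has_derivative A) (at ?z within M)" and u: "u \<in> tangent_plane M ?z" for A u
  proof -
    from u obtain w V \<psi> y D where V: "local_param M V \<psi>" and y: "y \<in> V" "\<psi> y = ?z"
      and D: "(\<psi> has_derivative D) (at y within V)" and u: "u = D w"
      unfolding tangent_plane_def by blast
    have \<psi>: "smooth_chart V \<psi>" "\<psi> ` V \<subseteq> M"
      using V local_param_image_subset[OF V] by (auto simp: local_param_iff)
    have "((\<lambda>x. f (\<psi> x)) has_derivative (\<lambda>v. A (D v))) (at y within V)"
      by (rule has_derivative_in_compose[OF D has_derivative_subset]) (use A y \<psi> in auto)
    moreover have "((\<lambda>x. f (\<psi> x)) has_derivative (\<lambda>v. G (D v))) (at y within V)"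
      by (rule has_derivative_in_compose[OF D has_derivative_subset]) (use G y \<psi> in auto)
    ultimately have "(\<lambda>v. A (D v)) = (\<lambda>v. G (D v))"
      by (rule half_plane_derivative_unique[OF smooth_chartD(1)[OF \<psi>(1)] y(1)])
    then show ?thesis unfolding u by (rule fun_cong)
  qed
  have formula: "norm (A u \<times> A v) = area_factor (\<lambda>v. G (\<phi>' v)) / area_factor \<phi>' * norm (u \<times> v)"
    if A: "(f has_derivative A) (at ?z within M)" and uv: "u \<in> tangent_plane M ?z" "v \<in> tangent_plane M ?z" for A u v
  proof -
    obtain a b where ab: "u = \<phi>' a" "v = \<phi>' b" using tangent uv by blast
    have "linear (\<lambda>v. G (\<phi>' v))" using linear_compose[OF lin\<phi> linG] by (simp add: o_def)
    note cross = norm_linear_cross[OF this, of a b] norm_linear_cross[OF lin\<phi>, of a b]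
    have "A u = G (\<phi>' a)" "A v = G (\<phi>' b)"
      using unique[OF A uv(1)] unique[OF A uv(2)] ab by simp_all
    then show ?thesis using pos cross unfolding ab(1) ab(2) by simp
  qed
  obtain V \<psi> where V: "local_param M V \<psi>" "?z \<in> \<psi> ` V" using M(1) x(2) unfolding smooth_surface_def by blast
  then obtain y where y: "y \<in> V" "\<psi> y = ?z" by auto
  have \<psi>: "smooth_chart V \<psi>" using V by (simp add: local_param_iff)
  define D where "D = frechet_derivative \<psi> (at y within V)"
  have D: "(\<psi> has_derivative D) (at y within V)" unfolding D_def by (rule chart_derivative(1)[OF \<psi> y(1)])
  have tD: "D w \<in> tangent_plane M ?z" for w
    unfolding tangent_plane_def using V(1) y D by blast
  obtain L where L: "0 < L" "\<And>v. norm v \<le> L * norm (D v)"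
    using chart_derivative_bounded_below[OF \<psi> y(1)] D_def by auto
  have linD: "linear D" using D has_derivative_linear by blast
  have "1 / L\<^sup>2 \<le> area_factor D" by (rule area_factor_ge[OF linD L])
  then have posD: "norm (D (axis 1 1) \<times> D (axis 2 1)) \<noteq> 0"
    using L(1) unfolding area_factor_def[symmetric] by auto
  show ?thesis
    unfolding area_jacobian_def
  proof (rule the_equality)
    show "\<forall>A. (f has_derivative A) (at ?z within M) \<longrightarrow>
        (\<forall>u\<in>tangent_plane M ?z. \<forall>v\<in>tangent_plane M ?z.
           norm (A u \<times> A v) = area_factor (\<lambda>v. G (\<phi>' v)) / area_factor \<phi>' * norm (u \<times> v))"
      using formula by blast
    fix j assume j: "\<forall>A. (f has_derivative A) (at ?z within M) \<longrightarrow>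
        (\<forall>u\<in>tangent_plane M ?z. \<forall>v\<in>tangent_plane M ?z. norm (A u \<times> A v) = j * norm (u \<times> v))"
    have "norm (G (D (axis 1 1)) \<times> G (D (axis 2 1))) = j * norm (D (axis 1 1) \<times> D (axis 2 1))"
      using j[rule_format, OF G tD tD] .
    with formula[OF G tD tD, of "axis 1 1" "axis 2 1"]
    have "j * norm (D (axis 1 1) \<times> D (axis 2 1))
        = area_factor (\<lambda>v. G (\<phi>' v)) / area_factor \<phi>' * norm (D (axis 1 1) \<times> D (axis 2 1))"
      by (simp only:)
    then show "j = area_factor (\<lambda>v. G (\<phi>' v)) / area_factor \<phi>'"
      using posD by (simp only: mult_cancel_right) blast
  qed
qed

section \<open>Coordinate patches\<close>

text \<open>A disk in the plane, in the domain \<open>pdomain\<close> of a chart \<open>pmap\<close>, together with a map \<open>pfun\<close> that expresses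
the diffeomorphism in this chart, and the derivatives of both maps.\<close>

record patch =
  pcenter :: "real^2"
  pradius :: real
  pdomain :: "(real^2) set"
  pmap :: "real^2 \<Rightarrow> real^3"
  pderiv :: "real^2 \<Rightarrow> real^2 \<Rightarrow> real^3"
  pfun :: "real^2 \<Rightarrow> real^3"
  pfun_deriv :: "real^2 \<Rightarrow> real^2 \<Rightarrow> real^3"

definition pball :: "patch \<Rightarrow> (real^2) set" where
  "pball P = ball (pcenter P) (pradius P)"

text \<open>The chart belongs to a surface \<open>E\<close> that may be larger than \<open>M\<close>, so that the coordinates can fill a full disk
even at boundary points of \<open>M\<close>. Points of \<open>E\<close> close to \<open>p\<close> have coordinates in the disk of half
the radius; this leaves room for the halos of small triangles.\<close>

definition good_patch ::
    "(real^3) set \<Rightarrow> (real^3) set \<Rightarrow> (real^3 \<Rightarrow> real^3) \<Rightarrow> real^3 \<Rightarrow> real \<Rightarrow> real \<Rightarrow> patch \<Rightarrow> bool" where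
  "good_patch E M f p R K P \<longleftrightarrow>
     0 < R \<and> 0 < pradius P \<and> 1 \<le> K \<and>
     C11_on (pball P) K (pmap P) (pderiv P) \<and> C11_on (pball P) K (pfun P) (pfun_deriv P) \<and>
     (\<forall>x\<in>pball P. \<forall>y\<in>pball P. norm (x - y) \<le> K * norm (pmap P x - pmap P y)) \<and>
     smooth_chart (pdomain P) (pmap P) \<and> openin (top_of_set E) (pmap P ` pdomain P) \<and>
     pball P \<subseteq> pdomain P \<and>
     E \<inter> ball p R \<subseteq> pmap P ` ball (pcenter P) (pradius P / 2) \<and>
     (\<forall>x\<in>pball P. pmap P x \<in> M \<longrightarrow> pfun P x = f (pmap P x) \<and>
        area_jacobian M f (pmap P x) = area_factor (pfun_deriv P x) / area_factor (pderiv P x))"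

lemma chart_image_openin:
  assumes "smooth_chart W \<phi>" "openin (top_of_set E) (\<phi> ` W)" "open U"
  shows "openin (top_of_set E) (\<phi> ` (W \<inter> U))"
proof -
  have "\<phi> ` (W \<inter> U) = \<phi> ` W \<inter> the_inv_into W \<phi> -` U"
    using the_inv_into_f_f[OF smooth_chartD(2)[OF assms(1)]] by force
  then have "openin (top_of_set (\<phi> ` W)) (\<phi> ` (W \<inter> U))"
    using continuous_openin_preimage_gen[OF smooth_chartD(7)[OF assms(1)] assms(3)] by simp
  then show ?thesis using assms(2) openin_trans by blast
qed

lemma openin_contains_ball_part:
  assumes "openin (top_of_set E) S" "p \<in> S"
  obtains R where "0 < R" "E \<inter> ball p R \<subseteq> S"
proof -
  obtain R where "0 < R" "\<And>y. y \<in> E \<Longrightarrow> dist y p < R \<Longrightarrow> y \<in> S"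
    using assms unfolding openin_euclidean_subtopology_iff by blast
  then have "E \<inter> ball p R \<subseteq> S" by (auto simp: dist_commute)
  then show ?thesis using that \<open>0 < R\<close> by blast
qed

lemma good_patch_exists:
  assumes E: "smooth_surface E" "M \<subseteq> E - surface_boundary E" and M: "smooth_surface M"
    and f: "smooth_on M f" and p: "p \<in> M"
  obtains R K P where "good_patch E M f p R K P"
proof -
  have ME: "M \<subseteq> E" using E by auto
  obtain W \<phi> where lp: "local_param E W \<phi>" and "p \<in> \<phi> ` W"
    using E p unfolding smooth_surface_def by blast
  then obtain x0 where x0: "x0 \<in> W" "p = \<phi> x0" by auto
  have \<phi>: "smooth_chart W \<phi>" "openin (top_of_set E) (\<phi> ` W)" using lp by (auto simp: local_param_iff)
  obtain U where U: "open U" "W = half_plane \<inter> U" using smooth_chartD(1)[OF \<phi>(1)] by (auto simp: openin_open)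
  have "x0 $ 2 \<noteq> 0" using E(2) p lp x0 unfolding surface_boundary_def by blast
  then have x0pos: "x0 \<in> {x. 0 < x $ 2} \<inter> U" using x0 U by (auto simp: half_plane_def)
  have "open ({x::real^2. 0 < x $ 2} \<inter> U)"
    by (intro open_Int U open_Collect_less continuous_intros)
  then obtain r1 where r1: "0 < r1" "ball x0 r1 \<subseteq> {x. 0 < x $ 2} \<inter> U"
    using x0pos open_contains_ball by metis
  then have r1W: "ball x0 r1 \<subseteq> W" using U by (auto simp: half_plane_def)
  obtain r2 K2 g g' where r2: "0 < r2" "1 \<le> K2" "C11_on (cball x0 r2) K2 g g'"
    "\<And>y. y \<in> W \<inter> cball x0 r2 \<Longrightarrow> g y = \<phi> y"
    using smooth_on_local_extension[OF smooth_chartD(3)[OF \<phi>(1)] x0(1)] by blast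
  obtain r4 K4 h h' where r4: "0 < r4" "1 \<le> K4" "C11_on (cball p r4) K4 h h'"
    "\<And>y. y \<in> \<phi> ` W \<inter> cball p r4 \<Longrightarrow> h y = the_inv_into W \<phi> y"
    using smooth_on_local_extension[OF smooth_chartD(4)[OF \<phi>(1)] \<open>p \<in> \<phi> ` W\<close>] by blast
  obtain r5 K5 G G' where r5: "0 < r5" "1 \<le> K5" "C11_on (cball p r5) K5 G G'"
    "\<And>y. y \<in> M \<inter> cball p r5 \<Longrightarrow> G y = f y"
    using smooth_on_local_extension[OF f p] by blast
  define \<rho> where "\<rho> = min (min r1 r2) (min r4 r5 / K2)"
  have \<rho>: "0 < \<rho>" "\<rho> \<le> r1" "\<rho> \<le> r2" using r1 r2 r4 r5 by (auto simp: \<rho>_def)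
  define B where "B = ball x0 \<rho>"
  have BW: "B \<subseteq> W" and Br2: "B \<subseteq> cball x0 r2" using \<rho> r1W by (auto simp: B_def)
  have \<phi>eq: "g y = \<phi> y" if "y \<in> B" for y using that BW Br2 by (intro r2(4)) auto
  have Cg: "C11_on B K2 g g'" by (rule C11_on_mono[OF r2(3) Br2 order_refl])
  have C\<phi>: "C11_on B K2 \<phi> g'"
    unfolding C11_on_def
  proof (intro conjI ballI allI)
    fix x assume x: "x \<in> B"
    show "(\<phi> has_derivative g' x) (at x)"
      by (rule has_derivative_transform_within_open[OF C11_onD(1)[OF r2(3)], where s = B])
        (use x Br2 \<phi>eq in \<open>auto simp: B_def\<close>)
  qed (use Cg in \<open>auto simp: C11_on_def\<close>)
  have small: "\<phi> y \<in> ball p (min r4 r5)" if y: "y \<in> B" for y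
  proof -
    have "norm (\<phi> y - \<phi> x0) \<le> K2 * norm (y - x0)"
      using C11_on_lipschitz[OF C\<phi>, of y x0] y \<rho> by (auto simp: B_def)
    also have "\<dots> < K2 * \<rho>" using y r2(2) by (auto simp: B_def dist_norm norm_minus_commute)
    also have "K2 * \<rho> \<le> K2 * (min r4 r5 / K2)" using r2(2) by (intro mult_left_mono) (auto simp: \<rho>_def)
    also have "\<dots> = min r4 r5" using r2(2) by simp
    finally show ?thesis using x0 by (simp add: dist_norm norm_minus_commute)
  qed
  define F where "F = (\<lambda>x. G (\<phi> x))"
  define F' where "F' = (\<lambda>x v. G' (\<phi> x) (g' x v))"
  define L where "L = K5 * K2 + K5 * K2 * K2"
  have "\<phi> ` B \<subseteq> cball p r5" using small by (force simp: less_imp_le)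
  then have CF: "C11_on B L F F'"
    unfolding F_def F'_def L_def
    using C11_on_compose[OF C\<phi> r5(3)] r2(2) r5(2) by (auto simp: B_def)
  have expanding: "norm (x - y) \<le> K4 * norm (\<phi> x - \<phi> y)" if x: "x \<in> B" and y: "y \<in> B" for x y
  proof -
    have "h (\<phi> z) = z" if "z \<in> B" for z
      using r4(4)[of "\<phi> z"] small[OF that] that BW the_inv_into_f_f[OF smooth_chartD(2)[OF \<phi>(1)], of z]
      by (auto simp: less_imp_le)
    then show ?thesis
      using C11_on_lipschitz[OF r4(3) convex_cball, of "\<phi> x" "\<phi> y"] small[OF x] small[OF y] x y by simp
  qed
  define K where "K = max K2 (max K4 L)"
  have K: "K2 \<le> K" "K4 \<le> K" "L \<le> K" "1 \<le> K" using r2(2) by (auto simp: K_def)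
  have "openin (top_of_set E) (\<phi> ` (W \<inter> ball x0 (\<rho> / 2)))"
    by (rule chart_image_openin[OF \<phi>]) simp
  moreover have "p \<in> \<phi> ` (W \<inter> ball x0 (\<rho> / 2))" using x0 \<rho> by auto
  ultimately obtain R where R: "0 < R" "E \<inter> ball p R \<subseteq> \<phi> ` (W \<inter> ball x0 (\<rho> / 2))"
    using openin_contains_ball_part by blast
  have jac: "area_jacobian M f (\<phi> x) = area_factor (F' x) / area_factor (g' x)"
    if x: "x \<in> B" "\<phi> x \<in> M" for x
    unfolding F'_def
  proof (rule area_jacobian_chart[OF M ME \<phi> _ x(2)])
    show "x \<in> W" using x BW by auto
    show "(\<phi> has_derivative g' x) (at x within W)"
      using C11_onD(1)[OF C\<phi> x(1)] has_derivative_at_withinI by blast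
    show "(f has_derivative G' (\<phi> x)) (at (\<phi> x) within M)"
      using small[OF x(1)] by (intro local_extension_derivative[OF r5(3,4) x(2)]) auto
  qed
  define P where "P = \<lparr>pcenter = x0, pradius = \<rho>, pdomain = W, pmap = \<phi>, pderiv = g', pfun = F, pfun_deriv = F'\<rparr>"
  have PB: "pball P = B" by (simp add: P_def pball_def B_def)
  have "good_patch E M f p R K P"
    unfolding good_patch_def PB
  proof (intro conjI ballI impI)
    show "C11_on B K (pmap P) (pderiv P)" using C11_on_mono[OF C\<phi> order_refl K(1)] by (simp add: P_def)
    show "C11_on B K (pfun P) (pfun_deriv P)" using C11_on_mono[OF CF order_refl K(3)] by (simp add: P_def)
    show "norm (x - y) \<le> K * norm (pmap P x - pmap P y)" if "x \<in> B" "y \<in> B" for x y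
      using expanding[OF that] K(2) mult_right_mono[OF K(2) norm_ge_zero[of "\<phi> x - \<phi> y"]] by (simp add: P_def)
    show "E \<inter> ball p R \<subseteq> pmap P ` ball (pcenter P) (pradius P / 2)" using R(2) by (auto simp: P_def)
    fix x assume x: "x \<in> B" "pmap P x \<in> M"
    show "pfun P x = f (pmap P x)"
      using r5(4)[of "\<phi> x"] small[OF x(1)] x(2) by (simp add: P_def F_def less_imp_le)
    show "area_jacobian M f (pmap P x) = area_factor (pfun_deriv P x) / area_factor (pderiv P x)"
      using jac[OF x(1)] x(2) by (simp add: P_def)
  qed (use R(1) \<rho>(1) K(4) \<phi> BW in \<open>auto simp: P_def\<close>)
  then show ?thesis by (rule that)
qed

section \<open>The boundary curve\<close>

text \<open>Otherwise the transition to a chart that sees \<open>\<psi> y\<close> on its boundary line would be a continuous injection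
of a planar neighborhood of \<open>y\<close> into the half plane that hits the boundary line. By invariance of domain its
image is open in the plane, which is impossible.\<close>

lemma boundary_on_boundary_line:
  assumes \<psi>: "smooth_chart V \<psi>" and sub: "\<psi> ` V \<subseteq> M"
    and y: "y \<in> V" "\<psi> y \<in> surface_boundary M"
  shows "y $ 2 = 0"
proof (rule ccontr)
  assume ny: "y $ 2 \<noteq> 0"
  obtain U where U: "open U" "V = half_plane \<inter> U" using smooth_chartD(1)[OF \<psi>] by (auto simp: openin_open)
  obtain V2 \<psi>2 z where lp: "local_param M V2 \<psi>2" and z: "z \<in> V2" "z $ 2 = 0" "\<psi> y = \<psi>2 z"
    using y(2) unfolding surface_boundary_def by auto
  have \<psi>2: "smooth_chart V2 \<psi>2" "openin (top_of_set M) (\<psi>2 ` V2)" using lp by (auto simp: local_param_iff)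
  define S where "S = {x \<in> V. \<psi> x \<in> \<psi>2 ` V2} \<inter> {x. 0 < x $ 2}"
  have S_open: "open S"
  proof -
    obtain T where T: "open T" "\<psi>2 ` V2 = M \<inter> T" using \<psi>2(2) by (auto simp: openin_open)
    have op: "open (U \<inter> {x::real^2. 0 < x $ 2})"
      by (intro open_Int U(1) open_Collect_less continuous_intros)
    have subV: "U \<inter> {x. 0 < x $ 2} \<subseteq> V" using U(2) by (auto simp: half_plane_def)
    have "open ((U \<inter> {x. 0 < x $ 2}) \<inter> \<psi> -` T)"
      by (rule continuous_open_preimage[OF continuous_on_subset[OF smooth_chartD(6)[OF \<psi>] subV] op T(1)])
    also have "(U \<inter> {x. 0 < x $ 2}) \<inter> \<psi> -` T = S"
      using U(2) T(2) subV imageI[of _ V \<psi>, THEN subsetD[OF sub]] by (auto simp: S_def)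
    finally show ?thesis .
  qed
  have yS: "y \<in> S" using y z ny U(2) by (auto simp: S_def half_plane_def)
  define T where "T x = the_inv_into V2 \<psi>2 (\<psi> x)" for x
  have T\<psi>: "\<psi>2 (T x) = \<psi> x" "T x \<in> V2" if "x \<in> S" for x
  proof -
    have "\<psi> x \<in> \<psi>2 ` V2" using that by (auto simp: S_def)
    then show "\<psi>2 (T x) = \<psi> x" "T x \<in> V2" unfolding T_def
      using f_the_inv_into_f[OF smooth_chartD(2)[OF \<psi>2(1)]] the_inv_into_into[OF smooth_chartD(2)[OF \<psi>2(1)], of "\<psi> x" V2] by auto
  qed
  have "inj_on T S"
  proof (rule inj_onI)
    fix a b assume ab: "a \<in> S" "b \<in> S" "T a = T b"
    then have "\<psi> a = \<psi> b" using T\<psi>(1) by metis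
    then show "a = b" using inj_onD[OF smooth_chartD(2)[OF \<psi>]] ab by (auto simp: S_def)
  qed
  moreover have "continuous_on S T"
    unfolding T_def
    by (rule continuous_on_compose2[OF smooth_chartD(7)[OF \<psi>2(1)] continuous_on_subset[OF smooth_chartD(6)[OF \<psi>]]])
      (auto simp: S_def)
  ultimately have "open (T ` S)" using invariance_of_domain S_open by blast
  moreover have "z \<in> T ` S"
  proof -
    have "T y = z" unfolding T_def using the_inv_into_f_f[OF smooth_chartD(2)[OF \<psi>2(1)] z(1)] z(3) by simp
    then show ?thesis using yS by blast
  qed
  ultimately obtain e where e: "0 < e" "ball z e \<subseteq> T ` S" by (rule openE)
  have "z - (e / 2) *\<^sub>R axis 2 1 \<in> ball z e" using e by (simp add: dist_norm)
  then have "z - (e / 2) *\<^sub>R axis 2 1 \<in> T ` S" by (rule subsetD[OF e(2)])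
  then obtain w where "w \<in> S" "z - (e / 2) *\<^sub>R axis 2 1 = T w" by (rule imageE)
  then have "z - (e / 2) *\<^sub>R axis 2 1 \<in> V2" using T\<psi>(2) by simp
  then have "z - (e / 2) *\<^sub>R axis 2 1 \<in> half_plane"
    using smooth_chartD(1)[OF \<psi>2(1)] by (auto simp: openin_open)
  then show False using z(2) e(1) by (simp add: half_plane_def axis_def)
qed

text \<open>The covering numbers grow at most like those of a rectifiable curve. Since a small ball meets a
surface in area of the order of its squared radius, this bounds the area of neighborhoods of \<open>A\<close> in a surface.\<close>

definition curve_covered :: "'a::metric_space set \<Rightarrow> bool" where
  "curve_covered A \<longleftrightarrow> (\<exists>C\<ge>0. \<forall>\<epsilon>. 0 < \<epsilon> \<and> \<epsilon> \<le> 1 \<longrightarrow>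
     (\<exists>Z. finite Z \<and> real (card Z) \<le> C / \<epsilon> \<and> A \<subseteq> (\<Union>z\<in>Z. cball z \<epsilon>)))"

lemma curve_covered_subset: "curve_covered B \<Longrightarrow> A \<subseteq> B \<Longrightarrow> curve_covered A"
  unfolding curve_covered_def by (meson subset_trans)

lemma curve_covered_Un:
  assumes "curve_covered A" "curve_covered B"
  shows "curve_covered (A \<union> B)"
proof -
  obtain C where C: "0 \<le> C" "\<And>\<epsilon>. 0 < \<epsilon> \<and> \<epsilon> \<le> 1 \<Longrightarrow> \<exists>Z. finite Z \<and> real (card Z) \<le> C / \<epsilon> \<and> A \<subseteq> (\<Union>z\<in>Z. cball z \<epsilon>)"
    using assms(1) unfolding curve_covered_def by blast
  obtain D where D: "0 \<le> D" "\<And>\<epsilon>. 0 < \<epsilon> \<and> \<epsilon> \<le> 1 \<Longrightarrow> \<exists>Z. finite Z \<and> real (card Z) \<le> D / \<epsilon> \<and> B \<subseteq> (\<Union>z\<in>Z. cball z \<epsilon>)"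
    using assms(2) unfolding curve_covered_def by blast
  show ?thesis
    unfolding curve_covered_def
  proof (intro exI[of _ "C + D"] conjI allI impI)
    fix \<epsilon> :: real assume \<epsilon>: "0 < \<epsilon> \<and> \<epsilon> \<le> 1"
    obtain Z where Z: "finite Z" "real (card Z) \<le> C / \<epsilon>" "A \<subseteq> (\<Union>z\<in>Z. cball z \<epsilon>)" using C(2)[OF \<epsilon>] by blast
    obtain Y where Y: "finite Y" "real (card Y) \<le> D / \<epsilon>" "B \<subseteq> (\<Union>z\<in>Y. cball z \<epsilon>)" using D(2)[OF \<epsilon>] by blast
    have "real (card (Z \<union> Y)) \<le> real (card Z) + real (card Y)"
      using card_Un_le[of Z Y] by linarith
    then have "real (card (Z \<union> Y)) \<le> (C + D) / \<epsilon>" using Z(2) Y(2) by (simp add: add_divide_distrib)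
    then show "\<exists>Z. finite Z \<and> real (card Z) \<le> (C + D) / \<epsilon> \<and> A \<union> B \<subseteq> (\<Union>z\<in>Z. cball z \<epsilon>)"
      using Z Y by (intro exI[of _ "Z \<union> Y"] conjI) auto
  qed (use C D in auto)
qed

lemma curve_covered_empty: "curve_covered {}"
  unfolding curve_covered_def by (intro exI[of _ 0]) auto

lemma curve_covered_UN: "finite I \<Longrightarrow> (\<And>i. i \<in> I \<Longrightarrow> curve_covered (A i)) \<Longrightarrow> curve_covered (\<Union>i\<in>I. A i)"
  by (induction I rule: finite_induct) (auto intro: curve_covered_Un curve_covered_empty)

text \<open>The segment is divided into intervals of length \<open>\<epsilon> / K\<close>, and a center is chosen in the image of each
interval that meets \<open>S\<close>. So \<open>S\<close> may be an arbitrary subset of the segment.\<close>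

lemma curve_covered_lipschitz_segment:
  fixes S :: "(real^2) set"
  assumes K: "1 \<le> K" and \<rho>: "0 < \<rho>" and S: "S \<subseteq> ball x \<rho>" "\<And>y. y \<in> S \<Longrightarrow> y $ 2 = 0"
    and lip: "\<And>y z. \<lbrakk>y \<in> S; z \<in> S\<rbrakk> \<Longrightarrow> dist (g y) (g z) \<le> K * dist y z"
  shows "curve_covered (g ` S)"
  unfolding curve_covered_def
proof (intro exI[of _ "2 * \<rho> * K + 1"] conjI allI impI)
  show "0 \<le> 2 * \<rho> * K + 1" using K \<rho> by simp
  fix \<epsilon> :: real assume \<epsilon>: "0 < \<epsilon> \<and> \<epsilon> \<le> 1"
  define \<eta> where "\<eta> = \<epsilon> / K"
  have \<eta>: "0 < \<eta>" using \<epsilon> K by (simp add: \<eta>_def)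
  define b where "b y = \<lfloor>(y $ 1 - x $ 1 + \<rho>) / \<eta>\<rfloor>" for y :: "real^2"
  have b: "b y \<in> {0..\<lfloor>2 * \<rho> / \<eta>\<rfloor>}" if "y \<in> S" for y
  proof -
    have "\<bar>y $ 1 - x $ 1\<bar> \<le> norm (y - x)" using component_le_norm_cart[of "y - x" 1] by simp
    also have "\<dots> < \<rho>" using S(1) that by (auto simp: dist_norm norm_minus_commute)
    finally have *: "0 \<le> y $ 1 - x $ 1 + \<rho>" "y $ 1 - x $ 1 + \<rho> \<le> 2 * \<rho>" by auto
    then show ?thesis using \<eta> unfolding b_def
      by (auto intro!: floor_mono divide_right_mono)
  qed
  then have bS: "b ` S \<subseteq> {0..\<lfloor>2 * \<rho> / \<eta>\<rfloor>}" by auto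
  have fin: "finite (b ` S)" by (rule finite_subset[OF bS]) simp
  define Z where "Z = (\<lambda>k. g (inv_into S b k)) ` (b ` S)"
  have "card Z \<le> card (b ` S)" unfolding Z_def by (rule card_image_le[OF fin])
  also have "\<dots> \<le> card {0..\<lfloor>2 * \<rho> / \<eta>\<rfloor>}" by (rule card_mono[OF _ bS]) simp
  also have "\<dots> = nat (\<lfloor>2 * \<rho> / \<eta>\<rfloor> + 1)" by simp
  finally have "real (card Z) \<le> real (nat (\<lfloor>2 * \<rho> / \<eta>\<rfloor> + 1))" by simp
  also have "\<dots> \<le> 2 * \<rho> / \<eta> + 1" using \<rho> \<eta> by (simp add: of_nat_nat)
  also have "\<dots> \<le> (2 * \<rho> * K + 1) / \<epsilon>" using \<epsilon> K by (simp add: \<eta>_def add_divide_distrib)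
  finally have card: "real (card Z) \<le> (2 * \<rho> * K + 1) / \<epsilon>" .
  have cover: "g ` S \<subseteq> (\<Union>z\<in>Z. cball z \<epsilon>)"
  proof
    fix w assume "w \<in> g ` S"
    then obtain y where y: "y \<in> S" "w = g y" by auto
    define y' where "y' = inv_into S b (b y)"
    have y': "y' \<in> S" "b y' = b y"
      using inv_into_into[of "b y" b S] f_inv_into_f[of "b y" b S] y(1) by (auto simp: y'_def)
    have "\<bar>(y' $ 1 - x $ 1 + \<rho>) / \<eta> - (y $ 1 - x $ 1 + \<rho>) / \<eta>\<bar> \<le> 1"
      using y'(2) unfolding b_def by linarith
    then have "\<bar>(y' $ 1 - y $ 1) / \<eta>\<bar> \<le> 1" by (simp add: diff_divide_distrib add_divide_distrib)
    then have "\<bar>y' $ 1 - y $ 1\<bar> \<le> \<eta>" using \<eta> by (simp add: abs_divide)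
    moreover have "y' - y = (y' $ 1 - y $ 1) *\<^sub>R axis 1 1"
      using S(2)[OF y(1)] S(2)[OF y'(1)] by (simp add: vec_eq_iff forall_2 axis_def)
    then have "norm (y' - y) = \<bar>y' $ 1 - y $ 1\<bar>" by (metis mult.right_neutral norm_axis_1 norm_scaleR real_norm_def)
    ultimately have "dist y' y \<le> \<eta>" by (simp add: dist_norm)
    then have "K * dist y' y \<le> K * \<eta>" using K by (intro mult_left_mono) auto
    then have "dist (g y') (g y) \<le> \<epsilon>" using lip[OF y'(1) y(1)] K by (simp add: \<eta>_def)
    moreover have "g y' \<in> Z" unfolding Z_def y'_def using y(1) by blast
    ultimately show "w \<in> (\<Union>z\<in>Z. cball z \<epsilon>)" using y(2) by auto
  qed
  show "\<exists>Z. finite Z \<and> real (card Z) \<le> (2 * \<rho> * K + 1) / \<epsilon> \<and> g ` S \<subseteq> (\<Union>z\<in>Z. cball z \<epsilon>)"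
    using card cover fin by (intro exI[of _ Z]) (auto simp: Z_def)
qed

lemma surface_boundary_subset: "surface_boundary M \<subseteq> M"
  unfolding surface_boundary_def using local_param_image_subset by blast

lemma surface_boundary_curve_covered:
  assumes "compact M" "smooth_surface M"
  shows "curve_covered (surface_boundary M)"
proof -
  have local: "\<exists>r>0. curve_covered (surface_boundary M \<inter> ball p r)" if p: "p \<in> M" for p
  proof -
    obtain V \<psi> where lp: "local_param M V \<psi>" and "p \<in> \<psi> ` V"
      using assms(2) p unfolding smooth_surface_def by blast
    then obtain x where x: "x \<in> V" "p = \<psi> x" by auto
    have \<psi>: "smooth_chart V \<psi>" "openin (top_of_set M) (\<psi> ` V)" using lp by (auto simp: local_param_iff)
    have sub: "\<psi> ` V \<subseteq> M" by (rule local_param_image_subset[OF lp])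
    obtain \<rho> K g g' where g: "0 < \<rho>" "1 \<le> K" "C11_on (cball x \<rho>) K g g'" "\<And>y. y \<in> V \<inter> cball x \<rho> \<Longrightarrow> g y = \<psi> y"
      using smooth_on_local_extension[OF smooth_chartD(3)[OF \<psi>(1)] x(1)] by blast
    have "openin (top_of_set M) (\<psi> ` (V \<inter> ball x \<rho>))" by (rule chart_image_openin[OF \<psi>]) simp
    moreover have "p \<in> \<psi> ` (V \<inter> ball x \<rho>)" using x g(1) by auto
    ultimately obtain r where r: "0 < r" "M \<inter> ball p r \<subseteq> \<psi> ` (V \<inter> ball x \<rho>)"
      using openin_contains_ball_part by blast
    define S where "S = {y \<in> V \<inter> ball x \<rho>. y $ 2 = 0}"
    have "curve_covered (\<psi> ` S)"
    proof (rule curve_covered_lipschitz_segment[OF g(2,1)])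
      fix y z assume yz: "y \<in> S" "z \<in> S"
      then have "dist (g y) (g z) \<le> K * dist y z"
        using C11_on_lipschitz[OF g(3) convex_cball, of y z] by (auto simp: S_def dist_norm)
      then show "dist (\<psi> y) (\<psi> z) \<le> K * dist y z"
        using g(4)[of y] g(4)[of z] yz by (auto simp: S_def)
    qed (auto simp: S_def)
    moreover have "surface_boundary M \<inter> ball p r \<subseteq> \<psi> ` S"
    proof
      fix z assume z: "z \<in> surface_boundary M \<inter> ball p r"
      then obtain y where y: "y \<in> V \<inter> ball x \<rho>" "z = \<psi> y" using r(2) surface_boundary_subset by blast
      then have "y $ 2 = 0" using boundary_on_boundary_line[OF \<psi>(1) sub] z by auto
      then show "z \<in> \<psi> ` S" using y by (auto simp: S_def)
    qed
    ultimately show ?thesis using r(1) curve_covered_subset by blast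
  qed
  then obtain r where r: "\<And>p. p \<in> M \<Longrightarrow> 0 < r p \<and> curve_covered (surface_boundary M \<inter> ball p (r p))" by metis
  obtain I where I: "I \<subseteq> M" "finite I" "M \<subseteq> (\<Union>p\<in>I. ball p (r p))"
  proof (rule compactE_image[OF assms(1), of M "\<lambda>p. ball p (r p)"])
    show "M \<subseteq> (\<Union>p\<in>M. ball p (r p))" using r by force
  qed auto
  have "curve_covered (\<Union>p\<in>I. surface_boundary M \<inter> ball p (r p))"
    using I r by (intro curve_covered_UN) auto
  moreover have "surface_boundary M \<subseteq> (\<Union>p\<in>I. surface_boundary M \<inter> ball p (r p))"
    using I(3) surface_boundary_subset by blast
  ultimately show ?thesis by (rule curve_covered_subset)
qed

text \<open>The path length is a Lebesgue integral and the fundamental theorem of calculus gives a gauge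
integral; the two are compared off the finitely many points where the path is not differentiable.\<close>

lemma dist_le_path_length:
  assumes "valid_path \<gamma>"
  shows "ennreal (dist (pathstart \<gamma>) (pathfinish \<gamma>)) \<le> path_length \<gamma>"
proof -
  obtain S where S: "finite S" "\<gamma> C1_differentiable_on ({0..1} - S)" and cont: "continuous_on {0..1} \<gamma>"
    using assms unfolding valid_path_def piecewise_C1_differentiable_on_def by blast
  define T where "T = {0..1} - S"
  let ?v = "\<lambda>t. vector_derivative \<gamma> (at t)"
  have T: "T \<in> sets borel" unfolding T_def using S(1) by (simp add: finite_imp_closed borel_closed)
  have diff: "\<gamma> differentiable at t" if "t \<in> T" for t
    using S(2) that unfolding C1_differentiable_on_eq T_def by auto
  have contv: "continuous_on T ?v" using S(2) unfolding C1_differentiable_on_eq T_def by auto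
  have int: "(?v has_integral (\<gamma> 1 - \<gamma> 0)) {0..1}"
    by (rule fundamental_theorem_of_calculus_interior_strong[OF S(1)])
      (use diff cont in \<open>auto simp: T_def vector_derivative_works\<close>)
  show ?thesis
  proof (cases "path_length \<gamma>" rule: ennreal_cases)
    case top then show ?thesis by simp
  next
    case (real r)
    define n where "n t = indicator T t * norm (?v t)" for t
    have n: "n \<in> borel_measurable borel" unfolding n_def
      by (rule borel_measurable_restrict_indicator[OF continuous_on_norm[OF contv] T])
    have "AE t in lborel. t \<notin> S" using S(1) by (intro AE_not_in finite_imp_null_set_lborel)
    then have "(\<integral>\<^sup>+t. ennreal (n t) \<partial>lborel) = path_length \<gamma>"
      unfolding path_length_def n_def
      by (intro nn_integral_cong_AE) (auto elim!: eventually_mono simp: T_def indicator_def)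
    then have "(n has_integral r) UNIV"
      using real by (intro nn_integral_has_integral[OF n]) (auto simp: n_def)
    then have n01: "((\<lambda>t. norm (?v t)) has_integral r) {0..1}"
    proof -
      have "((\<lambda>t. if t \<in> {0..1} then norm (?v t) else 0) has_integral r) UNIV"
        by (rule has_integral_spike_finite[OF S(1) _ \<open>(n has_integral r) UNIV\<close>])
          (auto simp: n_def T_def indicator_def)
      then show ?thesis by (simp only: has_integral_restrict_UNIV)
    qed
    have "norm (integral {0..1} ?v) \<le> integral {0..1} (\<lambda>t. norm (?v t))"
      by (rule Henstock_Kurzweil_Integration.integral_norm_bound_integral) (use int n01 in \<open>auto simp: has_integral_iff\<close>)
    then have "dist (pathstart \<gamma>) (pathfinish \<gamma>) \<le> r"
      using int n01 by (simp add: has_integral_iff pathstart_def pathfinish_def dist_norm norm_minus_commute)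
    then show ?thesis using real by (simp add: ennreal_leI)
  qed
qed

lemma intrinsic_dist_imp_near:
  assumes "intrinsic_dist S x A \<le> ennreal c" "0 \<le> c" "c < c'"
  obtains z where "z \<in> A" "dist x z \<le> c'"
proof -
  have "intrinsic_dist S x A < ennreal c'"
    using assms by (intro le_less_trans[OF assms(1)] ennreal_lessI) auto
  then obtain \<gamma> where \<gamma>: "valid_path \<gamma>" "pathstart \<gamma> = x" "pathfinish \<gamma> \<in> A" "path_length \<gamma> < ennreal c'"
    unfolding intrinsic_dist_def INF_less_iff by blast
  have "ennreal (dist x (pathfinish \<gamma>)) < ennreal c'"
    using dist_le_path_length[OF \<gamma>(1)] \<gamma>(2,4) by simp
  then have "dist x (pathfinish \<gamma>) \<le> c'" using assms by (simp add: ennreal_less_iff)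
  then show ?thesis using that \<gamma>(3) by blast
qed

section \<open>Shape-regular triangles in space\<close>

lemma simplex_cross_nonzero:
  fixes a b c :: "real^3"
  assumes "2 simplex (convex hull {a, b, c})"
  shows "(b - a) \<times> (c - a) \<noteq> 0"
proof
  assume "(b - a) \<times> (c - a) = 0"
  then have "collinear {b, a, c}" using collinear_3[of b a c] unfolding cross_eq_0 by simp
  then have "aff_dim {a, b, c} \<le> 1" by (simp add: collinear_aff_dim insert_commute)
  moreover have "aff_dim {a, b, c} = 2" using aff_dim_simplex[OF assms] unfolding aff_dim_convex_hull .
  ultimately show False by simp
qed

text \<open>On the triangle, the distance from the line through \<open>a\<close> and \<open>b\<close> varies between 0 and its value at \<open>c\<close>, and
likewise for the line through \<open>a\<close> and \<open>c\<close>.\<close>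

lemma triangle_cross_bound:
  fixes a b c :: "real^3"
  assumes "x \<in> convex hull {a, b, c}" "y \<in> convex hull {a, b, c}"
  shows "norm ((x - y) \<times> (b - a)) \<le> norm ((b - a) \<times> (c - a))"
    and "norm ((x - y) \<times> (c - a)) \<le> norm ((b - a) \<times> (c - a))"
proof -
  obtain s t where x: "x = a + s *\<^sub>R (b - a) + t *\<^sub>R (c - a)" "0 \<le> s" "0 \<le> t" "s + t \<le> 1"
    using assms(1) unfolding convex_hull_3_alt by auto
  obtain s' t' where y: "y = a + s' *\<^sub>R (b - a) + t' *\<^sub>R (c - a)" "0 \<le> s'" "0 \<le> t'" "s' + t' \<le> 1"
    using assms(2) unfolding convex_hull_3_alt by auto
  have e: "x - y = (s - s') *\<^sub>R (b - a) + (t - t') *\<^sub>R (c - a)"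
    by (simp add: x y algebra_simps)
  have "norm ((x - y) \<times> (b - a)) = \<bar>t - t'\<bar> * norm ((c - a) \<times> (b - a))"
    unfolding e by (simp only: cross_add_left cross_mult_left cross_refl) simp
  also have "\<dots> \<le> 1 * norm ((c - a) \<times> (b - a))"
    using x y by (intro mult_right_mono) auto
  also have "\<dots> = norm ((b - a) \<times> (c - a))" by (subst cross_skew) simp
  finally show "norm ((x - y) \<times> (b - a)) \<le> norm ((b - a) \<times> (c - a))" .
  have "norm ((x - y) \<times> (c - a)) = \<bar>s - s'\<bar> * norm ((b - a) \<times> (c - a))"
    unfolding e by (simp only: cross_add_left cross_mult_left cross_refl) simp
  also have "\<dots> \<le> 1 * norm ((b - a) \<times> (c - a))"
    using x y by (intro mult_right_mono) auto
  finally show "norm ((x - y) \<times> (c - a)) \<le> norm ((b - a) \<times> (c - a))" by simp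
qed

text \<open>Moving from \<open>p\<close> by \<open>r\<close> in the plane of the triangle, perpendicularly to the edge \<open>b - a\<close>, does not
leave the triangle, so \<open>r\<close> is at most the height over this edge. Moving by \<open>r\<close> along the edge shows that \<open>r\<close>
is at most its length.\<close>

lemma inscribed_disk_bound:
  fixes a b c :: "real^3"
  assumes T: "T = convex hull {a, b, c}" and nz: "(b - a) \<times> (c - a) \<noteq> 0"
    and p: "p \<in> T" "0 \<le> r" "cball p r \<inter> affine hull T \<subseteq> T"
  shows "r\<^sup>2 \<le> norm ((b - a) \<times> (c - a))"
proof -
  define u where "u = b - a"
  define v where "v = c - a"
  define n where "n = u \<times> v"
  have n: "n \<noteq> 0" using nz by (simp add: n_def u_def v_def)
  then have u: "u \<noteq> 0" by (auto simp: n_def)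
  have inT: "p + w \<in> T" if w: "w = s *\<^sub>R u + t *\<^sub>R v" "norm w \<le> r" for w s t
  proof -
    obtain x y z where pc: "p = x *\<^sub>R a + y *\<^sub>R b + z *\<^sub>R c" "x + y + z = 1"
      using hull_subset[of T affine] p(1) unfolding T affine_hull_convex_hull affine_hull_3 by auto
    have "p + w = (x - s - t) *\<^sub>R a + (y + s) *\<^sub>R b + (z + t) *\<^sub>R c"
      by (simp add: pc(1) w(1) u_def v_def algebra_simps)
    then have "p + w \<in> affine hull T"
      using pc(2) unfolding T affine_hull_convex_hull affine_hull_3 
      by (intro CollectI exI[of _ "x - s - t"] exI[of _ "y + s"] exI[of _ "z + t"]) auto
    moreover have "p + w \<in> cball p r" using w(2) by (simp add: dist_norm)
    ultimately show ?thesis using p(3) by blast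
  qed
  have "r * norm u \<le> norm n"
  proof -
    define w0 where "w0 = n \<times> u"
    have w0: "w0 = (u \<bullet> u) *\<^sub>R v - (v \<bullet> u) *\<^sub>R u"
      by (simp add: w0_def n_def cross3_simps forall_3)
    have "norm w0 = norm n * norm u"
      using norm_cross_dot[of n u] by (simp add: w0_def n_def dot_cross_self power_eq_iff_eq_base)
    then have w0n: "0 < norm w0" using n u by simp
    define w where "w = (r / norm w0) *\<^sub>R w0"
    have "p + w \<in> T"
      using p(2) w0n
      by (intro inT[of _ "- (r / norm w0) * (v \<bullet> u)" "(r / norm w0) * (u \<bullet> u)"])
        (auto simp: w_def w0[symmetric] algebra_simps, simp add: w0 algebra_simps)
    then have "norm ((p + w - p) \<times> u) \<le> norm n"
      using triangle_cross_bound(1)[of "p + w" a b c p] p(1) by (simp add: T u_def v_def n_def)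
    moreover have "norm (w \<times> u) = r * norm u"
    proof -
      have "w \<bullet> u = 0" by (simp add: w_def w0_def dot_cross_self)
      then have "norm (w \<times> u) = norm w * norm u"
        using norm_cross_dot[of w u] by (simp add: power_eq_iff_eq_base)
      then show ?thesis using p(2) w0n by (simp add: w_def)
    qed
    ultimately show ?thesis by simp
  qed
  moreover have "r \<le> norm u"
  proof -
    define w where "w = (r / norm u) *\<^sub>R u"
    have "p + w \<in> T" using p(2) u by (intro inT[of _ "r / norm u" 0]) (auto simp: w_def)
    then have "norm ((p + w - p) \<times> v) \<le> norm n"
      using triangle_cross_bound(2)[of "p + w" a b c p] p(1) by (simp add: T u_def v_def n_def)
    then have "r / norm u * norm n \<le> 1 * norm n"
      using p(2) by (simp add: w_def cross_mult_left n_def)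
    then have "r / norm u \<le> 1" using n by (simp only: mult_le_cancel_right) auto
    then show ?thesis using u by simp
  qed
  ultimately have "r * r \<le> norm n" using p(2) mult_left_mono[of r "norm u" r] by linarith
  then show ?thesis by (simp add: power2_eq_square n_def u_def v_def)
qed

text \<open>The inradius is positive because the triangle has relative interior points, and the supremum in its
definition is over a bounded set by the previous lemma. So there is an inscribed disk whose radius
exceeds half of the bound that shape regularity gives for the inradius.\<close>

lemma shape_regular_area:
  fixes a b c :: "real^3"
  assumes T: "T = convex hull {a, b, c}" and simp: "2 simplex T"
    and C: "0 < C" "diameter T / inradius T \<le> C"
  shows "0 < diameter T" "1 / (4 * C\<^sup>2) * (diameter T)\<^sup>2 \<le> norm ((b - a) \<times> (c - a))"
proof -
  have nz: "(b - a) \<times> (c - a) \<noteq> 0" using simplex_cross_nonzero simp T by simp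
  have bT: "bounded T" unfolding T by (intro bounded_convex_hull finite_imp_bounded) auto
  have ab: "a \<in> T" "b \<in> T" unfolding T by (auto intro: hull_inc)
  have "b \<noteq> a" using nz by auto
  then have "0 < dist a b" by simp
  also have "dist a b \<le> diameter T" using diameter_bounded_bound[OF bT ab] .
  finally show d: "0 < diameter T" .
  let ?R = "{r. 0 \<le> r \<and> (\<exists>c\<in>T. cball c r \<inter> affine hull T \<subseteq> T)}"
  have bound: "r\<^sup>2 \<le> norm ((b - a) \<times> (c - a))" if "r \<in> ?R" for r
    using that inscribed_disk_bound[OF T nz] by auto
  have bdd: "bdd_above ?R"
  proof (rule bdd_aboveI)
    fix r assume "r \<in> ?R"
    then show "r \<le> sqrt (norm ((b - a) \<times> (c - a)))" using real_le_rsqrt[OF bound] by blast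
  qed
  have "convex T" "T \<noteq> {}" using ab unfolding T by auto
  then have "rel_interior T \<noteq> {}" using rel_interior_eq_empty by blast
  then obtain z where "z \<in> rel_interior T" by blast
  then obtain e where e: "z \<in> T" "0 < e" "cball z e \<inter> affine hull T \<subseteq> T"
    unfolding mem_rel_interior_cball by blast
  have eR: "e \<in> ?R" using e by (intro CollectI conjI bexI[of _ z]) auto
  have "e \<le> inradius T" unfolding inradius_def by (rule cSup_upper[OF eR bdd])
  then have inr: "0 < inradius T" using e(2) by linarith
  have "diameter T / (2 * C) < diameter T / C" using d C(1) by (simp add: field_simps)
  also have "\<dots> \<le> inradius T" using C inr by (simp add: field_simps)
  finally have "diameter T / (2 * C) < Sup ?R" by (simp add: inradius_def)
  then obtain r where r: "r \<in> ?R" "diameter T / (2 * C) < r"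
    by (rule less_cSupE) (use eR in auto)
  have "(diameter T / (2 * C))\<^sup>2 \<le> r\<^sup>2" using r d C(1) by (intro power_mono) auto
  then show "1 / (4 * C\<^sup>2) * (diameter T)\<^sup>2 \<le> norm ((b - a) \<times> (c - a))"
    using bound[OF r(1)] by (simp add: power_divide power_mult_distrib)
qed

section \<open>The stretch measure in coordinate patches\<close>

lemma good_patch_mono:
  assumes "good_patch E M f p R K P" "K \<le> L"
  shows "good_patch E M f p R L P"
proof -
  have "norm (x - y) \<le> L * norm (pmap P x - pmap P y)" if "x \<in> pball P" "y \<in> pball P" for x y
  proof -
    have "norm (x - y) \<le> K * norm (pmap P x - pmap P y)" using assms(1) that by (auto simp: good_patch_def)
    also have "\<dots> \<le> L * norm (pmap P x - pmap P y)" using assms(2) by (intro mult_right_mono) auto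
    finally show ?thesis .
  qed
  then show ?thesis using assms unfolding good_patch_def by (auto intro: C11_on_mono)
qed

lemma ennreal_mult3:
  "\<lbrakk>0 \<le> x; 0 \<le> y; 0 \<le> z\<rbrakk> \<Longrightarrow> ennreal x * (ennreal y * ennreal z) = ennreal (x * y * z)"
  by (simp add: ennreal_mult mult.assoc)

text \<open>A finite cover of \<open>M\<close> by patches with a common constant \<open>K\<close>. In the coordinates of a patch, \<open>stretch\<close> is the
density of the energy of \<open>f\<close> and \<open>ratio\<close> is its area ratio. The measure \<open>\<eta>\<close>, whose total mass is
the stretch energy, assigns to a set its share of the energy.\<close>

locale covered_surface =
  fixes E M :: "(real^3) set" and f :: "real^3 \<Rightarrow> real^3" and I :: "(real^3) set"
    and R :: "real^3 \<Rightarrow> real" and K :: real and P :: "real^3 \<Rightarrow> patch"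
  assumes M: "compact M" "smooth_surface M" "M \<subseteq> E" and I: "finite I" "I \<subseteq> M" and K: "1 \<le> K"
    and patches: "\<And>p. p \<in> I \<Longrightarrow> good_patch E M f p (R p) K (P p)"
    and cover: "M \<subseteq> (\<Union>p\<in>I. ball p (R p / 2))"
begin

abbreviation "\<phi> p \<equiv> pmap (P p)"
abbreviation "B p \<equiv> pball (P p)"
abbreviation "\<mu> \<equiv> area_measure M"
definition "J = area_jacobian M f"
definition "dom_density p x = area_factor (pderiv (P p) x)"
definition "img_density p x = area_factor (pfun_deriv (P p) x)"
definition "ratio p x = img_density p x / dom_density p x"
definition "stretch p x = (img_density p x)\<^sup>2 / dom_density p x"
definition "\<eta> = density \<mu> (\<lambda>y. ennreal ((J y)\<^sup>2))"

lemma K0 [simp]: "0 < K" "0 \<le> K" "K \<noteq> 0" using K by auto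

lemma K_power_mono: "m \<le> n \<Longrightarrow> K ^ m \<le> K ^ n"
  by (rule power_increasing[OF _ K])

lemma patchD:
  assumes "p \<in> I"
  shows "0 < R p" "0 < pradius (P p)"
    "C11_on (B p) K (\<phi> p) (pderiv (P p))" "C11_on (B p) K (pfun (P p)) (pfun_deriv (P p))"
    "\<And>x y. \<lbrakk>x \<in> B p; y \<in> B p\<rbrakk> \<Longrightarrow> norm (x - y) \<le> K * norm (\<phi> p x - \<phi> p y)"
    "smooth_chart (pdomain (P p)) (\<phi> p)" "openin (top_of_set E) (\<phi> p ` pdomain (P p))"
    "B p \<subseteq> pdomain (P p)"
    "E \<inter> ball p (R p) \<subseteq> \<phi> p ` ball (pcenter (P p)) (pradius (P p) / 2)"
    "\<And>x. \<lbrakk>x \<in> B p; \<phi> p x \<in> M\<rbrakk> \<Longrightarrow> pfun (P p) x = f (\<phi> p x)"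
    "\<And>x. \<lbrakk>x \<in> B p; \<phi> p x \<in> M\<rbrakk> \<Longrightarrow> J (\<phi> p x) = ratio p x"
  using patches[OF assms] unfolding good_patch_def J_def ratio_def img_density_def dom_density_def by auto

lemma half_ball: "p \<in> I \<Longrightarrow> ball (pcenter (P p)) (pradius (P p) / 2) \<subseteq> B p"
  using patchD(2)[of p] by (auto simp: pball_def)

lemma patch_nondegenerate:
  assumes "p \<in> I" "x \<in> B p"
  shows "norm v \<le> K * norm (pderiv (P p) x v)"
  using expanding_imp_nondegenerate[OF patchD(3)[OF assms(1), unfolded pball_def] K0(2,1)
      assms(2)[unfolded pball_def] patchD(5)[OF assms(1), unfolded pball_def]] .

lemma density_bounds:
  assumes "p \<in> I" "x \<in> B p"
  shows "1 / K\<^sup>2 \<le> dom_density p x" "0 < dom_density p x" "dom_density p x \<le> K\<^sup>2"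
    "0 \<le> img_density p x" "img_density p x \<le> K\<^sup>2"
proof -
  show 1: "1 / K\<^sup>2 \<le> dom_density p x" unfolding dom_density_def
    using patch_nondegenerate[OF assms] C11_on_linear[OF patchD(3)[OF assms(1)] assms(2)]
    by (intro area_factor_ge) auto
  have "0 < 1 / K\<^sup>2" by simp
  then show "0 < dom_density p x" using 1 by linarith
  show "dom_density p x \<le> K\<^sup>2" unfolding dom_density_def
    by (rule area_factor_le[OF C11_onD(2)[OF patchD(3)[OF assms(1)] assms(2)]])
  show "img_density p x \<le> K\<^sup>2" unfolding img_density_def
    by (rule area_factor_le[OF C11_onD(2)[OF patchD(4)[OF assms(1)] assms(2)]])
  show "0 \<le> img_density p x" by (simp add: img_density_def area_factor_def)
qed

lemma density_lipschitz:
  assumes "p \<in> I" "x \<in> B p" "y \<in> B p"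
  shows "\<bar>dom_density p x - dom_density p y\<bar> \<le> 2 * K\<^sup>2 * norm (x - y)"
    "\<bar>img_density p x - img_density p y\<bar> \<le> 2 * K\<^sup>2 * norm (x - y)"
proof -
  have "\<bar>dom_density p x - dom_density p y\<bar> \<le> 2 * K * (K * dist x y)" unfolding dom_density_def
    using C11_onD[OF patchD(3)[OF assms(1)]] assms by (intro area_factor_diff_le) auto
  then show "\<bar>dom_density p x - dom_density p y\<bar> \<le> 2 * K\<^sup>2 * norm (x - y)"
    by (simp add: power2_eq_square dist_norm mult_ac)
  have "\<bar>img_density p x - img_density p y\<bar> \<le> 2 * K * (K * dist x y)" unfolding img_density_def
    using C11_onD[OF patchD(4)[OF assms(1)]] assms by (intro area_factor_diff_le) auto
  then show "\<bar>img_density p x - img_density p y\<bar> \<le> 2 * K\<^sup>2 * norm (x - y)"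
    by (simp add: power2_eq_square dist_norm mult_ac)
qed

lemma ratio_bounds:
  assumes "p \<in> I" "x \<in> B p"
  shows "0 \<le> ratio p x" "ratio p x \<le> K ^ 4"
proof -
  note b = density_bounds[OF assms]
  show "0 \<le> ratio p x" using b by (simp add: ratio_def)
  have "img_density p x \<le> K\<^sup>2 * 1" using b by simp
  also have "1 \<le> K\<^sup>2 * dom_density p x" using b(1) by (simp add: field_simps)
  finally show "ratio p x \<le> K ^ 4" using b(2)
    by (simp add: ratio_def pos_divide_le_eq eval_nat_numeral mult_ac)
qed

lemma ratio_lipschitz:
  assumes "p \<in> I" "x \<in> B p" "y \<in> B p"
  shows "\<bar>ratio p x - ratio p y\<bar> \<le> 4 * K ^ 8 * norm (x - y)"
proof -
  note bx = density_bounds[OF assms(1,2)] and by' = density_bounds[OF assms(1,3)]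
  define D where "D = 2 * K\<^sup>2 * norm (x - y)"
  have D0: "0 \<le> D" by (simp add: D_def)
  have "ratio p x - ratio p y = ((img_density p x - img_density p y) * dom_density p y
      + img_density p y * (dom_density p y - dom_density p x)) * (1 / dom_density p x) * (1 / dom_density p y)"
    using bx(2) by'(2) by (simp add: ratio_def field_simps)
  also have "\<bar>\<dots>\<bar> \<le> (D * K\<^sup>2 + K\<^sup>2 * D) * K\<^sup>2 * K\<^sup>2"
  proof -
    have inv: "\<bar>1 / dom_density p x\<bar> \<le> K\<^sup>2" "\<bar>1 / dom_density p y\<bar> \<le> K\<^sup>2"
      using bx(1,2) by'(1,2) by (auto simp: field_simps)
    have "\<bar>(img_density p x - img_density p y) * dom_density p y + img_density p y * (dom_density p y - dom_density p x)\<bar>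
        \<le> D * K\<^sup>2 + K\<^sup>2 * D"
      using density_lipschitz[OF assms] bx by' D0 unfolding D_def[symmetric]
      by (intro order_trans[OF abs_triangle_ineq] add_mono)
        (auto simp: abs_mult abs_minus_commute intro!: mult_mono)
    then show ?thesis using inv D0 unfolding abs_mult by (intro mult_mono) auto
  qed
  also have "\<dots> = 4 * K ^ 8 * norm (x - y)" by (simp add: D_def eval_nat_numeral)
  finally show ?thesis .
qed

lemma stretch_bounds:
  assumes "p \<in> I" "x \<in> B p"
  shows "0 \<le> stretch p x" "stretch p x \<le> K ^ 10" "stretch p x = (ratio p x)\<^sup>2 * dom_density p x"
proof -
  note b = density_bounds[OF assms] and r = ratio_bounds[OF assms]
  show e: "stretch p x = (ratio p x)\<^sup>2 * dom_density p x"
    using b(2) by (simp add: stretch_def ratio_def power2_eq_square)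
  then show "0 \<le> stretch p x" using b by simp
  have "(ratio p x)\<^sup>2 * dom_density p x \<le> (K ^ 4)\<^sup>2 * K\<^sup>2"
    using b r by (intro mult_mono power_mono) auto
  then show "stretch p x \<le> K ^ 10" using e by (simp add: eval_nat_numeral mult_ac)
qed

lemma M_point_patch:
  assumes "y \<in> M"
  obtains p where "p \<in> I" "y \<in> ball p (R p / 2)"
  using cover assms by blast

lemma M_near_patch:
  assumes "p \<in> I" "y \<in> E" "dist p y < R p"
  obtains x where "x \<in> ball (pcenter (P p)) (pradius (P p) / 2)" "y = \<phi> p x"
  using patchD(9)[OF assms(1)] assms by auto

text \<open>Continuity of the area ratio makes it measurable; otherwise the integral that defines the stretch
energy would be zero by convention.\<close>

lemma J_continuous: "continuous_on M J"
  unfolding continuous_on_iff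
proof (intro ballI allI impI)
  fix y and e :: real assume y: "y \<in> M" and e: "0 < e"
  obtain p where p: "p \<in> I" "y \<in> ball p (R p / 2)" by (rule M_point_patch[OF y])
  have "dist p y < R p" using p patchD(1)[OF p(1)] by auto
  then obtain x where x: "x \<in> ball (pcenter (P p)) (pradius (P p) / 2)" "y = \<phi> p x"
    using M_near_patch[OF p(1)] y M(3) by blast
  have xB: "x \<in> B p" using x(1) half_ball[OF p(1)] by blast
  define d where "d = min (R p / 2) (e / (4 * K ^ 9))"
  show "\<exists>d>0. \<forall>z\<in>M. dist z y < d \<longrightarrow> dist (J z) (J y) < e"
  proof (intro exI conjI ballI impI)
    show "0 < d" using patchD(1)[OF p(1)] e by (simp add: d_def)
    fix z assume z: "z \<in> M" "dist z y < d"
    have "dist p z < R p"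
      using z(2) p(2) dist_triangle[of p z y] by (auto simp: d_def dist_commute)
    then obtain w where w: "w \<in> ball (pcenter (P p)) (pradius (P p) / 2)" "z = \<phi> p w"
      using M_near_patch[OF p(1)] z(1) M(3) by blast
    have wB: "w \<in> B p" using w(1) half_ball[OF p(1)] by blast
    have "\<bar>J z - J y\<bar> \<le> 4 * K ^ 8 * norm (w - x)"
      using ratio_lipschitz[OF p(1) wB xB] patchD(11)[OF p(1)] wB xB w(2) x(2) z(1) y by simp
    also have "\<dots> \<le> 4 * K ^ 8 * (K * norm (z - y))"
      using patchD(5)[OF p(1) wB xB] w(2) x(2) by (intro mult_left_mono) auto
    also have "\<dots> = 4 * K ^ 9 * dist z y" by (simp add: dist_norm eval_nat_numeral)
    also have "\<dots> < e" using z(2) by (simp add: d_def pos_less_divide_eq mult_ac)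
    finally show "dist (J z) (J y) < e" by (simp add: dist_real_def)
  qed
qed

lemma space_mu: "space \<mu> = M" and sets_mu: "sets \<mu> = sets (restrict_space borel M)"
  using area_measure_properties[OF M(1,2)] by auto

lemma M_closed: "closed M" "M \<in> sets borel"
  using M(1) compact_imp_closed by (auto simp: borel_compact)

lemma in_sets_mu: "S \<in> sets \<mu> \<longleftrightarrow> S \<in> sets borel \<and> S \<subseteq> M"
  using M_closed unfolding sets_mu by (simp add: sets_restrict_space_iff conj_commute)

lemma J_measurable [measurable]: "J \<in> borel_measurable \<mu>"
  using borel_measurable_continuous_on_restrict[OF J_continuous]
  by (simp add: measurable_cong_sets[OF sets_mu refl])

lemma image_sets:
  assumes "p \<in> I" "A \<in> sets borel" "A \<subseteq> B p" "\<phi> p ` A \<subseteq> M"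
  shows "\<phi> p ` A \<in> sets \<mu>"
    and "emeasure \<mu> (\<phi> p ` A) = (\<integral>\<^sup>+x\<in>A. ennreal (dom_density p x) \<partial>lborel)"
proof -
  have *: "\<phi> p ` A \<in> sets borel \<and>
      emeasure \<mu> (\<phi> p ` A) = (\<integral>\<^sup>+x\<in>A. ennreal (area_density (pdomain (P p)) (\<phi> p) x) \<partial>lborel)"
    using assms patchD(8)[OF assms(1)]
    by (intro emeasure_area_chart[OF M(1,2) patchD(6,7)[OF assms(1)] M(3)]) auto
  then show "\<phi> p ` A \<in> sets \<mu>" using assms(4) by (simp add: in_sets_mu)
  have "area_density (pdomain (P p)) (\<phi> p) x = dom_density p x" if "x \<in> A" for x
  proof -
    have x: "x \<in> B p" "x \<in> pdomain (P p)" using that assms(3) patchD(8)[OF assms(1)] by auto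
    show ?thesis unfolding area_density_alt dom_density_def
      using chart_derivative(2)[OF patchD(6)[OF assms(1)] x(2)
          has_derivative_at_withinI[OF C11_onD(1)[OF patchD(3)[OF assms(1)] x(1)]]] by simp
  qed
  then show "emeasure \<mu> (\<phi> p ` A) = (\<integral>\<^sup>+x\<in>A. ennreal (dom_density p x) \<partial>lborel)"
    using * by (auto intro!: nn_integral_cong simp: indicator_def)
qed

lemma eta_sets: "sets \<eta> = sets \<mu>" "space \<eta> = M"
  by (simp_all add: \<eta>_def space_mu)

lemma J_image:
  assumes "p \<in> I" "A \<subseteq> B p" "\<phi> p ` A \<subseteq> M" "x \<in> A"
  shows "J (\<phi> p x) = ratio p x"
  using assms by (intro patchD(11)) auto

lemma eta_image_le:
  assumes "p \<in> I" "A \<in> sets borel" "A \<subseteq> B p" "\<phi> p ` A \<subseteq> M"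
    and "\<And>x. x \<in> A \<Longrightarrow> dom_density p x \<le> b" "\<And>x. x \<in> A \<Longrightarrow> (ratio p x)\<^sup>2 \<le> j" "0 \<le> j"
  shows "emeasure \<eta> (\<phi> p ` A) \<le> ennreal j * (ennreal b * emeasure lborel A)"
proof -
  have "emeasure \<eta> (\<phi> p ` A) = (\<integral>\<^sup>+y\<in>\<phi> p ` A. ennreal ((J y)\<^sup>2) \<partial>\<mu>)"
    unfolding \<eta>_def using image_sets(1)[OF assms(1-4)] by (intro emeasure_density) auto
  also have "\<dots> \<le> (\<integral>\<^sup>+y. ennreal j * indicator (\<phi> p ` A) y \<partial>\<mu>)"
  proof (intro nn_integral_mono)
    fix y
    show "ennreal ((J y)\<^sup>2) * indicator (\<phi> p ` A) y \<le> ennreal j * indicator (\<phi> p ` A) y"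
      using assms(5-) J_image[OF assms(1,3,4)] by (auto simp: indicator_def intro!: ennreal_leI)
  qed
  also have "\<dots> = ennreal j * emeasure \<mu> (\<phi> p ` A)"
    by (rule nn_integral_cmult_indicator[OF image_sets(1)[OF assms(1-4)]])
  also have "emeasure \<mu> (\<phi> p ` A) \<le> ennreal b * emeasure lborel A"
  proof -
    have "emeasure \<mu> (\<phi> p ` A) \<le> (\<integral>\<^sup>+x. ennreal b * indicator A x \<partial>lborel)"
      unfolding image_sets(2)[OF assms(1-4)]
      using assms(5) by (intro nn_integral_mono) (auto simp: indicator_def intro!: ennreal_leI)
    also have "\<dots> = ennreal b * emeasure lborel A"
      using assms(2) by (intro nn_integral_cmult_indicator) simp
    finally show ?thesis .
  qed
  finally show ?thesis by (simp add: mult_left_mono)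
qed

lemma eta_image_ge:
  assumes "p \<in> I" "A \<in> sets borel" "A \<subseteq> B p" "\<phi> p ` A \<subseteq> M"
    and "\<And>x. x \<in> A \<Longrightarrow> b \<le> dom_density p x" "\<And>x. x \<in> A \<Longrightarrow> j \<le> (ratio p x)\<^sup>2"
  shows "ennreal j * (ennreal b * emeasure lborel A) \<le> emeasure \<eta> (\<phi> p ` A)"
proof -
  have "ennreal b * emeasure lborel A = (\<integral>\<^sup>+x. ennreal b * indicator A x \<partial>lborel)"
    using assms(2) by (intro nn_integral_cmult_indicator[symmetric]) simp
  also have "\<dots> \<le> emeasure \<mu> (\<phi> p ` A)"
    unfolding image_sets(2)[OF assms(1-4)]
    using assms(5) by (intro nn_integral_mono) (auto simp: indicator_def intro!: ennreal_leI)
  finally have "ennreal j * (ennreal b * emeasure lborel A) \<le> ennreal j * emeasure \<mu> (\<phi> p ` A)"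
    by (rule mult_left_mono) simp
  also have "\<dots> = (\<integral>\<^sup>+y. ennreal j * indicator (\<phi> p ` A) y \<partial>\<mu>)"
    by (rule nn_integral_cmult_indicator[OF image_sets(1)[OF assms(1-4)], symmetric])
  also have "\<dots> \<le> (\<integral>\<^sup>+y\<in>\<phi> p ` A. ennreal ((J y)\<^sup>2) \<partial>\<mu>)"
  proof (intro nn_integral_mono)
    fix y
    show "ennreal j * indicator (\<phi> p ` A) y \<le> ennreal ((J y)\<^sup>2) * indicator (\<phi> p ` A) y"
      using assms(5-) J_image[OF assms(1,3,4)] by (auto simp: indicator_def intro!: ennreal_leI)
  qed
  also have "\<dots> = emeasure \<eta> (\<phi> p ` A)"
    unfolding \<eta>_def using image_sets(1)[OF assms(1-4)] by (intro emeasure_density[symmetric]) auto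
  finally show ?thesis .
qed

lemma patch_emeasure:
  assumes "p \<in> I" "A \<subseteq> B p"
  shows "emeasure lborel A = ennreal (measure lborel A)"
proof -
  have "bounded A" using assms(2) bounded_subset bounded_ball unfolding pball_def by blast
  then have "emeasure lborel A < \<infinity>" by (rule emeasure_bounded_finite)
  then show ?thesis by (intro emeasure_eq_ennreal_measure) auto
qed

lemma eta_crude:
  assumes "p \<in> I" "A \<in> sets borel" "A \<subseteq> B p" "\<phi> p ` A \<subseteq> M"
  shows "emeasure \<eta> (\<phi> p ` A) \<le> ennreal (K ^ 10 * measure lborel A)"
proof -
  have "emeasure \<eta> (\<phi> p ` A) \<le> ennreal ((K ^ 4)\<^sup>2) * (ennreal (K\<^sup>2) * emeasure lborel A)"
  proof (rule eta_image_le[OF assms])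
    fix x assume "x \<in> A"
    then have x: "x \<in> B p" using assms(3) by auto
    show "dom_density p x \<le> K\<^sup>2" by (rule density_bounds(3)[OF assms(1) x])
    show "(ratio p x)\<^sup>2 \<le> (K ^ 4)\<^sup>2" using ratio_bounds[OF assms(1) x] by (intro power_mono)
  qed simp
  also have "\<dots> = ennreal (K ^ 10 * measure lborel A)"
    unfolding patch_emeasure[OF assms(1,3)]
    by (simp add: ennreal_mult[symmetric] eval_nat_numeral mult_ac)
  finally show ?thesis .
qed

lemma M_patch_parts: "M = (\<Union>p\<in>I. \<phi> p ` {x \<in> B p. \<phi> p x \<in> M})"
proof
  show "M \<subseteq> (\<Union>p\<in>I. \<phi> p ` {x \<in> B p. \<phi> p x \<in> M})"
  proof
    fix y assume y: "y \<in> M"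
    obtain p where p: "p \<in> I" "y \<in> ball p (R p / 2)" by (rule M_point_patch[OF y])
    have "dist p y < R p" using p patchD(1)[OF p(1)] by auto
    then obtain x where x: "x \<in> ball (pcenter (P p)) (pradius (P p) / 2)" "y = \<phi> p x"
      using M_near_patch[OF p(1)] y M(3) by blast
    then have "x \<in> {x \<in> B p. \<phi> p x \<in> M}" using y half_ball[OF p(1)] by auto
    then show "y \<in> (\<Union>p\<in>I. \<phi> p ` {x \<in> B p. \<phi> p x \<in> M})" using p(1) x(2) by blast
  qed
qed auto

lemma patch_preimage_borel:
  assumes "p \<in> I" "A \<in> sets borel" "A \<subseteq> B p" "S \<in> sets borel"
  shows "{x \<in> A. \<phi> p x \<in> S} \<in> sets borel"
  using borel_preimage[OF continuous_on_subset[OF C11_on_continuous[OF patchD(3)[OF assms(1)]] assms(3)] assms(2,4)] .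

lemma B_borel [simp]: "B p \<in> sets borel" by (simp add: pball_def)

lemma eta_closed_le:
  assumes "S \<in> sets borel"
  shows "M \<inter> S \<in> sets \<mu>"
    "emeasure \<eta> (M \<inter> S) \<le> ennreal (K ^ 10 * (\<Sum>p\<in>I. measure lborel {x \<in> B p. \<phi> p x \<in> S}))"
proof -
  show MS: "M \<inter> S \<in> sets \<mu>" using assms M_closed by (auto simp: in_sets_mu)
  let ?A = "\<lambda>p. {x \<in> B p. \<phi> p x \<in> M \<inter> S}"
  have A: "?A p \<in> sets borel" if "p \<in> I" for p
    using patch_preimage_borel[OF that B_borel order_refl, of "M \<inter> S"] assms M_closed by simp
  have im: "\<phi> p ` ?A p \<in> sets \<eta>" if "p \<in> I" for p
    unfolding eta_sets using A[OF that] by (intro image_sets(1)[OF that]) auto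
  have "emeasure \<eta> (M \<inter> S) \<le> emeasure \<eta> (\<Union>p\<in>I. \<phi> p ` ?A p)"
  proof (rule emeasure_mono)
    show "M \<inter> S \<subseteq> (\<Union>p\<in>I. \<phi> p ` ?A p)"
    proof
      fix y assume y: "y \<in> M \<inter> S"
      then have "y \<in> (\<Union>p\<in>I. \<phi> p ` {x \<in> B p. \<phi> p x \<in> M})" using M_patch_parts by simp
      then obtain p x where "p \<in> I" "x \<in> B p" "\<phi> p x \<in> M" "y = \<phi> p x" by blast
      then show "y \<in> (\<Union>p\<in>I. \<phi> p ` ?A p)" using y by (intro UN_I[of p] image_eqI[of _ _ x]) auto
    qed
    show "(\<Union>p\<in>I. \<phi> p ` ?A p) \<in> sets \<eta>" using im I(1) by (intro sets.finite_UN) auto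
  qed
  also have "\<dots> \<le> (\<Sum>p\<in>I. emeasure \<eta> (\<phi> p ` ?A p))"
    using im by (intro emeasure_subadditive_finite[OF I(1)]) auto
  also have "\<dots> \<le> (\<Sum>p\<in>I. ennreal (K ^ 10 * measure lborel {x \<in> B p. \<phi> p x \<in> S}))"
  proof (rule sum_mono)
    fix p assume p: "p \<in> I"
    have "emeasure \<eta> (\<phi> p ` ?A p) \<le> ennreal (K ^ 10 * measure lborel (?A p))"
      using A[OF p] by (intro eta_crude[OF p]) auto
    also have "\<dots> \<le> ennreal (K ^ 10 * measure lborel {x \<in> B p. \<phi> p x \<in> S})"
    proof (intro ennreal_leI mult_left_mono measure_mono_fmeasurable)
      have "emeasure lborel {x \<in> B p. \<phi> p x \<in> S} < \<infinity>"
        using patch_emeasure[OF p, of "{x \<in> B p. \<phi> p x \<in> S}"] by auto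
      then show "{x \<in> B p. \<phi> p x \<in> S} \<in> fmeasurable lborel"
        using patch_preimage_borel[OF p B_borel order_refl assms] by (intro fmeasurableI) auto
    qed (use A[OF p] in auto)
    finally show "emeasure \<eta> (\<phi> p ` ?A p) \<le> ennreal (K ^ 10 * measure lborel {x \<in> B p. \<phi> p x \<in> S})" .
  qed
  also have "\<dots> = ennreal (K ^ 10 * (\<Sum>p\<in>I. measure lborel {x \<in> B p. \<phi> p x \<in> S}))"
    by (simp add: sum_distrib_left sum_ennreal)
  finally show "emeasure \<eta> (M \<inter> S) \<le> ennreal (K ^ 10 * (\<Sum>p\<in>I. measure lborel {x \<in> B p. \<phi> p x \<in> S}))" .
qed

lemma eta_finite: "finite_measure \<eta>"
proof
  have "emeasure \<eta> (M \<inter> UNIV) < \<infinity>" by (rule le_less_trans[OF eta_closed_le(2)]) auto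
  then show "emeasure \<eta> (space \<eta>) \<noteq> \<infinity>" by (simp add: eta_sets)
qed

lemma stretch_energy_eq: "stretch_energy M f = measure \<eta> M"
proof -
  have "stretch_energy M f = enn2real (\<integral>\<^sup>+y. ennreal ((J y)\<^sup>2) \<partial>\<mu>)"
    unfolding stretch_energy_def J_def[symmetric] by (intro integral_eq_nn_integral) auto
  also have "(\<integral>\<^sup>+y. ennreal ((J y)\<^sup>2) \<partial>\<mu>) = (\<integral>\<^sup>+y\<in>M. ennreal ((J y)\<^sup>2) \<partial>\<mu>)"
    by (intro nn_integral_cong) (auto simp: space_mu)
  also have "\<dots> = emeasure \<eta> M"
    unfolding \<eta>_def using M_closed by (intro emeasure_density[symmetric]) (auto simp: in_sets_mu)
  finally show ?thesis by (simp add: measure_def)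
qed

text \<open>On the image of \<open>A\<close> the squared area ratio, and on \<open>A\<close> the area density, differ from their values at \<alpha> by
at most a multiple of \<open>r\<close>.\<close>

lemma eta_image_approx:
  assumes "p \<in> I" "A \<in> sets borel" "A \<subseteq> B p" "\<phi> p ` A \<subseteq> M"
    and \<alpha>: "\<alpha> \<in> B p" and r: "0 \<le> r" "r \<le> 1" and near: "\<And>x. x \<in> A \<Longrightarrow> norm (x - \<alpha>) \<le> r"
  shows "measure \<eta> (\<phi> p ` A) \<le> (stretch p \<alpha> + 26 * K ^ 14 * r) * measure lborel A"
    and "(stretch p \<alpha> - 26 * K ^ 14 * r) * measure lborel A \<le> measure \<eta> (\<phi> p ` A)"
proof -
  interpret finite_measure \<eta> by (rule eta_finite)
  let ?b = "dom_density p \<alpha>" and ?j = "(ratio p \<alpha>)\<^sup>2"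
  let ?db = "2 * K\<^sup>2 * r" and ?dj = "8 * K ^ 12 * r"
  note b\<alpha> = density_bounds[OF assms(1) \<alpha>] and r\<alpha> = ratio_bounds[OF assms(1) \<alpha>]
  have db: "\<bar>dom_density p x - ?b\<bar> \<le> ?db" if "x \<in> A" for x
  proof -
    have "\<bar>dom_density p x - ?b\<bar> \<le> 2 * K\<^sup>2 * norm (x - \<alpha>)"
      using that assms(3) by (intro density_lipschitz(1)[OF assms(1) _ \<alpha>]) auto
    also have "\<dots> \<le> ?db" using near[OF that] by (intro mult_left_mono) auto
    finally show ?thesis .
  qed
  have dj: "\<bar>(ratio p x)\<^sup>2 - ?j\<bar> \<le> ?dj" if "x \<in> A" for x
  proof -
    have x: "x \<in> B p" using that assms(3) by auto
    have "\<bar>(ratio p x)\<^sup>2 - ?j\<bar> = \<bar>ratio p x + ratio p \<alpha>\<bar> * \<bar>ratio p x - ratio p \<alpha>\<bar>"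
      by (simp add: abs_mult[symmetric] power2_eq_square algebra_simps)
    also have "\<dots> \<le> (2 * K ^ 4) * (4 * K ^ 8 * r)"
    proof (intro mult_mono)
      show "\<bar>ratio p x + ratio p \<alpha>\<bar> \<le> 2 * K ^ 4" using ratio_bounds[OF assms(1) x] r\<alpha> by auto
      have "\<bar>ratio p x - ratio p \<alpha>\<bar> \<le> 4 * K ^ 8 * norm (x - \<alpha>)" by (rule ratio_lipschitz[OF assms(1) x \<alpha>])
      also have "\<dots> \<le> 4 * K ^ 8 * r" using near[OF that] by (intro mult_left_mono) auto
      finally show "\<bar>ratio p x - ratio p \<alpha>\<bar> \<le> 4 * K ^ 8 * r" .
    qed auto
    also have "\<dots> = ?dj" by (simp add: eval_nat_numeral)
    finally show ?thesis .
  qed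
  have dn: "0 \<le> ?db" "0 \<le> ?dj" using r by auto
  have jK: "?j \<le> K ^ 8" using power_mono[OF r\<alpha>(2,1), of 2] by (simp add: power_mult[symmetric])
  have err: "?j * ?db + ?dj * ?b + ?dj * ?db \<le> 26 * K ^ 14 * r"
  proof -
    have "?j * ?db \<le> K ^ 8 * ?db" using jK dn by (intro mult_right_mono) auto
    also have "\<dots> = 2 * K ^ 10 * r" by (simp add: eval_nat_numeral)
    also have "\<dots> \<le> 2 * K ^ 14 * r" using r by (intro mult_right_mono mult_left_mono K_power_mono) auto
    finally have 1: "?j * ?db \<le> 2 * K ^ 14 * r" .
    have "?dj * ?b \<le> ?dj * K\<^sup>2" using b\<alpha> dn by (intro mult_left_mono) auto
    also have "\<dots> = 8 * K ^ 14 * r" by (simp add: eval_nat_numeral)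
    finally have 2: "?dj * ?b \<le> 8 * K ^ 14 * r" .
    have "?dj * ?db = 16 * K ^ 14 * r * r" by (simp add: eval_nat_numeral)
    also have "\<dots> \<le> 16 * K ^ 14 * r * 1" using r by (intro mult_left_mono) auto
    finally show ?thesis using 1 2 by simp
  qed
  have st: "stretch p \<alpha> = ?j * ?b" by (rule stretch_bounds(3)[OF assms(1) \<alpha>])
  have "emeasure \<eta> (\<phi> p ` A) \<le> ennreal (?j + ?dj) * (ennreal (?b + ?db) * emeasure lborel A)"
  proof (rule eta_image_le[OF assms(1-4)])
    show "dom_density p x \<le> ?b + ?db" if "x \<in> A" for x using db[OF that] by linarith
    show "(ratio p x)\<^sup>2 \<le> ?j + ?dj" if "x \<in> A" for x using dj[OF that] by linarith
  qed (use dn in auto)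
  also have "\<dots> = ennreal ((?j + ?dj) * (?b + ?db) * measure lborel A)"
    unfolding patch_emeasure[OF assms(1,3)] using dn b\<alpha> by (intro ennreal_mult3) auto
  finally have "measure \<eta> (\<phi> p ` A) \<le> (?j + ?dj) * (?b + ?db) * measure lborel A"
    unfolding emeasure_eq_measure using dn b\<alpha> by (subst (asm) ennreal_le_iff) auto
  also have "\<dots> \<le> (stretch p \<alpha> + 26 * K ^ 14 * r) * measure lborel A"
    using err unfolding st by (intro mult_right_mono) (auto simp: algebra_simps)
  finally show "measure \<eta> (\<phi> p ` A) \<le> (stretch p \<alpha> + 26 * K ^ 14 * r) * measure lborel A" .
  let ?jlow = "max 0 (?j - ?dj)" and ?blow = "max 0 (?b - ?db)"
  have "ennreal ?jlow * (ennreal ?blow * emeasure lborel A) \<le> emeasure \<eta> (\<phi> p ` A)"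
  proof (rule eta_image_ge[OF assms(1-4)])
    fix x assume xA: "x \<in> A"
    then have "x \<in> B p" using assms(3) by auto
    then have "0 < dom_density p x" using density_bounds(2)[OF assms(1)] by blast
    then show "?blow \<le> dom_density p x" using db[OF xA] by auto
    show "?jlow \<le> (ratio p x)\<^sup>2" using dj[OF xA] by auto
  qed
  then have "ennreal (?jlow * ?blow * measure lborel A) \<le> emeasure \<eta> (\<phi> p ` A)"
    unfolding patch_emeasure[OF assms(1,3)] by (subst (asm) ennreal_mult3) auto
  then have lower: "?jlow * ?blow * measure lborel A \<le> measure \<eta> (\<phi> p ` A)"
    unfolding emeasure_eq_measure by (subst (asm) ennreal_le_iff) auto
  have "stretch p \<alpha> - 26 * K ^ 14 * r \<le> ?jlow * ?blow"
  proof (cases "?dj \<le> ?j \<and> ?db \<le> ?b")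
    case True
    have "?jlow * ?blow = (?j - ?dj) * (?b - ?db)" using True by simp
    also have "\<dots> = ?j * ?b - ?j * ?db - ?dj * ?b + ?dj * ?db" by (simp add: algebra_simps)
    finally show ?thesis using err mult_nonneg_nonneg[OF dn(2,1)] unfolding st by linarith
  next
    case False
    then have "?j * ?b \<le> ?dj * ?b \<or> ?j * ?b \<le> ?j * ?db"
      using b\<alpha> by (meson less_imp_le linear mult_left_mono mult_right_mono not_le zero_le_power2)
    moreover have "0 \<le> ?dj * ?b" by (intro mult_nonneg_nonneg dn(2) less_imp_le[OF b\<alpha>(2)])
    moreover have "0 \<le> ?j * ?db" by (intro mult_nonneg_nonneg dn(1)) simp
    moreover have "0 \<le> ?dj * ?db" by (rule mult_nonneg_nonneg[OF dn(2,1)])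
    ultimately have "stretch p \<alpha> \<le> 26 * K ^ 14 * r" using err unfolding st by linarith
    moreover have "0 \<le> ?jlow * ?blow" by simp
    ultimately show ?thesis by linarith
  qed
  then have "(stretch p \<alpha> - 26 * K ^ 14 * r) * measure lborel A \<le> ?jlow * ?blow * measure lborel A"
    by (intro mult_right_mono) auto
  then show "(stretch p \<alpha> - 26 * K ^ 14 * r) * measure lborel A \<le> measure \<eta> (\<phi> p ` A)"
    using lower by linarith
qed

end

section \<open>Meshes of projected triangles\<close>

lemma closest_point_properties:
  assumes "projection_well_defined S X" "x \<in> X"
  shows "closest_point S x \<in> S" "y \<in> S \<Longrightarrow> dist x (closest_point S x) \<le> dist x y"
    "\<lbrakk>p \<in> S; \<And>y. y \<in> S \<Longrightarrow> dist x p \<le> dist x y\<rbrakk> \<Longrightarrow> closest_point S x = p"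
proof -
  have ex: "\<exists>!p. p \<in> S \<and> (\<forall>q\<in>S. dist x p \<le> dist x q)"
    using assms unfolding projection_well_defined_def by blast
  have cp: "closest_point S x \<in> S \<and> (\<forall>q\<in>S. dist x (closest_point S x) \<le> dist x q)"
    unfolding closest_point_def by (rule someI_ex) (use ex in blast)
  then show "closest_point S x \<in> S" "y \<in> S \<Longrightarrow> dist x (closest_point S x) \<le> dist x y" by auto
  show "closest_point S x = p" if "p \<in> S" "\<And>y. y \<in> S \<Longrightarrow> dist x p \<le> dist x y"
    using ex cp that by blast
qed

text \<open>The set \<open>S\<close> need not be closed, so a limit of closest points could leave \<open>S\<close>. The compact part \<open>C\<close> of \<open>S\<close>
prevents this; uniqueness of closest points then makes the graph closed.\<close>

lemma closest_point_continuous: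
  assumes pw: "projection_well_defined S X" and T: "compact T" "T \<subseteq> X"
    and C: "compact C" "C \<subseteq> S" "closest_point S ` T \<subseteq> C"
  shows "continuous_on T (closest_point S)"
proof (rule continuous_from_closed_graph[OF C(1)])
  show "closest_point S \<in> T \<rightarrow> C" using C(3) by auto
  have inf: "infdist x S = dist x (closest_point S x)" if "x \<in> T" for x
  proof (rule antisym)
    have x: "x \<in> X" using that T(2) by auto
    show "infdist x S \<le> dist x (closest_point S x)"
      by (rule infdist_le[OF closest_point_properties(1)[OF pw x]])
    have "S \<noteq> {}" using closest_point_properties(1)[OF pw x] by auto
    then show "dist x (closest_point S x) \<le> infdist x S"
      unfolding infdist_def using closest_point_properties(2)[OF pw x] by (auto intro: cINF_greatest)
  qed
  have "(\<lambda>x. (x, closest_point S x)) ` T = (SIGMA x:T. C) \<inter> {z. dist (fst z) (snd z) \<le> infdist (fst z) S}"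
  proof
    show "(\<lambda>x. (x, closest_point S x)) ` T \<subseteq> (SIGMA x:T. C) \<inter> {z. dist (fst z) (snd z) \<le> infdist (fst z) S}"
      using C(3) inf by auto
    show "(SIGMA x:T. C) \<inter> {z. dist (fst z) (snd z) \<le> infdist (fst z) S} \<subseteq> (\<lambda>x. (x, closest_point S x)) ` T"
    proof
      fix z assume z: "z \<in> (SIGMA x:T. C) \<inter> {z. dist (fst z) (snd z) \<le> infdist (fst z) S}"
      then have x: "fst z \<in> T" "snd z \<in> S" using C(2) by auto
      have "closest_point S (fst z) = snd z"
        using z infdist_le[of _ S "fst z"] x T(2) by (intro closest_point_properties(3)[OF pw]) force+
      then show "z \<in> (\<lambda>x. (x, closest_point S x)) ` T" using x(1) by (intro image_eqI[of _ _ "fst z"]) auto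
    qed
  qed
  moreover have "closed ((SIGMA x:T. C) \<inter> {z. dist (fst z) (snd z) \<le> infdist (fst z) S})"
    by (intro closed_Int closed_Times compact_imp_closed T C closed_Collect_le continuous_intros)
  ultimately show "closed ((\<lambda>x. (x, closest_point S x)) ` T)" by simp
qed

fun face_energy :: "(real^3 \<Rightarrow> real^3) \<Rightarrow> face \<Rightarrow> real" where
  "face_energy g \<tau> = (face_area (image_face g \<tau>))\<^sup>2 / face_area \<tau>"

text \<open>What the sum over the faces has to know about one face: its patch, the planar sets core and halo, the
area of the planar triangle, and the stretch density at one corner.\<close>

record cell =
  cpatch :: "real^3"
  ccore :: "(real^2) set"
  chalo :: "(real^2) set"
  carea :: real
  cstretch :: real

text \<open>The number \<open>r0\<close> is a lower bound for the sizes of the patches. The smallness conditions on \<open>h\<close> ensure that a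
face and its projection lie in one patch and that the halo stays inside its disk.\<close>

locale projected_mesh = covered_surface +
  fixes F :: "face set" and g :: "real^3 \<Rightarrow> real^3" and \<kappa> h r0 :: real
  assumes mesh: "simplicial_surface F" "vertices F \<subseteq> M" "mesh_size F = h" "0 < h"
    and \<kappa>: "0 < \<kappa>"
    and shape: "\<And>a b c. (a, b, c) \<in> F \<Longrightarrow>
        0 < diameter (triangle (a, b, c)) \<and>
        \<kappa> * (diameter (triangle (a, b, c)))\<^sup>2 \<le> norm ((b - a) \<times> (c - a))"
    and proj: "projection_well_defined E (carrier F)" "inj_on (closest_point E) (carrier F)"
    and g: "pl_interpolant F f g"
    and r0: "\<And>p. p \<in> I \<Longrightarrow> r0 \<le> R p \<and> r0 \<le> pradius (P p)"
    and small: "192 * K ^ 7 * h \<le> \<kappa>" "4 * h \<le> r0" "4 * K * h \<le> r0" "2 * K * h \<le> 1" "h \<le> 1"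
begin

definition "cE = (4 * K ^ 9 / \<kappa> + 4 * K ^ 13 / \<kappa>\<^sup>2) * (2 * K\<^sup>2 / \<kappa>)"
definition "cA = 192 * K ^ 7 / \<kappa>"
definition "cS = 52 * K ^ 15"

abbreviation "\<pi> \<equiv> closest_point E"

definition good_cell :: "face \<Rightarrow> cell \<Rightarrow> bool" where
  "good_cell \<tau> X \<longleftrightarrow> cpatch X \<in> I \<and> compact (ccore X) \<and> compact (chalo X) \<and>
     ccore X \<subseteq> B (cpatch X) \<and> chalo X \<subseteq> B (cpatch X) \<and>
     0 < carea X \<and> 0 \<le> cstretch X \<and> cstretch X \<le> K ^ 10 \<and>
     \<bar>face_energy g \<tau> - cstretch X * carea X\<bar> \<le> cE * h * carea X \<and>
     measure lborel (chalo X) \<le> (1 + cA * h) * carea X \<and>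
     (1 - cA * h) * carea X \<le> measure lborel (ccore X) \<and>
     carea X \<le> 4 * measure lborel (ccore X) \<and> measure lborel (ccore X) \<le> carea X \<and>
     (\<forall>A\<in>sets borel. A \<subseteq> ccore X \<or> A \<subseteq> chalo X \<longrightarrow> \<phi> (cpatch X) ` A \<subseteq> M \<longrightarrow>
        measure \<eta> (\<phi> (cpatch X) ` A) \<le> (cstretch X + cS * h) * measure lborel A \<and>
        (cstretch X - cS * h) * measure lborel A \<le> measure \<eta> (\<phi> (cpatch X) ` A)) \<and>
     (\<forall>z\<in>triangle \<tau>. \<exists>y\<in>chalo X. \<pi> z = \<phi> (cpatch X) y) \<and>
     (\<forall>y\<in>ccore X. \<exists>z\<in>triangle \<tau>. \<pi> z = \<phi> (cpatch X) y) \<and>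
     (\<forall>y\<in>ccore X. \<forall>z\<in>triangle \<tau>. \<pi> z = \<phi> (cpatch X) y \<longrightarrow>
        (\<forall>w\<in>triangle \<tau>. \<exists>t>0. z + t *\<^sub>R (z - w) \<in> triangle \<tau>))"

lemma patch_image_subset: "p \<in> I \<Longrightarrow> \<phi> p ` B p \<subseteq> E"
  using openin_imp_subset[OF patchD(7)] patchD(8)[of p] by blast

text \<open>The patch is chosen by one corner of the face. Projections stay within twice the diameter of that
corner, because the corner itself lies on the surface and competes with the closest point.\<close>

lemma good_cell_exists:
  assumes \<tau>: "\<tau> \<in> F"
  shows "\<exists>X. good_cell \<tau> X"
proof -
  obtain a b c where abc: "\<tau> = (a, b, c)" by (cases \<tau>) auto
  define T where "T = triangle \<tau>"
  define d where "d = diameter T"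
  have T: "T = convex hull {a, b, c}" by (simp add: T_def abc triangle_def)
  have corners: "a \<in> T" "b \<in> T" "c \<in> T" unfolding T by (auto intro: hull_inc)
  have compT: "compact T" unfolding T by (intro compact_convex_hull finite_imp_compact) auto
  have Tcar: "T \<subseteq> carrier F" using \<tau> by (auto simp: carrier_def T_def)
  have verts: "a \<in> vertices F" "b \<in> vertices F" "c \<in> vertices F"
    using \<tau> unfolding vertices_def abc by force+
  then have abcM: "a \<in> M" "b \<in> M" "c \<in> M" using mesh(2) by auto
  have d: "0 < d" and shp: "\<kappa> * d\<^sup>2 \<le> norm ((b - a) \<times> (c - a))"
    using shape[of a b c] \<tau> by (auto simp: d_def T_def abc)
  have dh: "d \<le> h"
    unfolding d_def T_def using mesh(1,3) \<tau> unfolding mesh_size_def simplicial_surface_def by (auto intro!: Max_ge)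
  have distT: "dist x y \<le> d" if "x \<in> T" "y \<in> T" for x y
    unfolding d_def using diameter_bounded_bound[OF compact_imp_bounded[OF compT] that] .
  obtain p where p: "p \<in> I" "a \<in> ball p (R p / 2)" by (rule M_point_patch[OF abcM(1)])
  have r0p: "r0 \<le> R p" "r0 \<le> pradius (P p)" using r0[OF p(1)] by auto
  let ?H = "ball (pcenter (P p)) (pradius (P p) / 2)"
  have near: "\<exists>y\<in>?H. x = \<phi> p y" if x: "x \<in> E" "dist a x \<le> 2 * d" for x
  proof -
    have "dist p x < R p"
      using p(2) x(2) dist_triangle[of p x a] small(2) dh r0p(1) by auto
    then show ?thesis using M_near_patch[OF p(1) x(1)] by metis
  qed
  have pi_near: "\<pi> x \<in> E" "dist a (\<pi> x) \<le> 2 * d" if x: "x \<in> T" for x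
  proof -
    have xc: "x \<in> carrier F" using x Tcar by auto
    show "\<pi> x \<in> E" by (rule closest_point_properties(1)[OF proj(1) xc])
    have "dist x (\<pi> x) \<le> dist x a"
      using closest_point_properties(2)[OF proj(1) xc] abcM(1) M(3) by auto
    then show "dist a (\<pi> x) \<le> 2 * d"
      using distT[OF x corners(1)] dist_triangle[of a "\<pi> x" x] by (simp add: dist_commute)
  qed
  have E3: "a \<in> E" "b \<in> E" "c \<in> E" using abcM M(3) by auto
  have da: "dist a a \<le> 2 * d" "dist a b \<le> 2 * d" "dist a c \<le> 2 * d"
    using distT[OF corners(1,2)] distT[OF corners(1,3)] d by auto
  obtain \<alpha> where \<alpha>: "\<alpha> \<in> ?H" "a = \<phi> p \<alpha>" using near[OF E3(1) da(1)] by blast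
  obtain \<beta> where \<beta>: "\<beta> \<in> ?H" "b = \<phi> p \<beta>" using near[OF E3(2) da(2)] by blast
  obtain \<gamma> where \<gamma>: "\<gamma> \<in> ?H" "c = \<phi> p \<gamma>" using near[OF E3(3) da(3)] by blast
  have inB: "\<alpha> \<in> B p" "\<beta> \<in> B p" "\<gamma> \<in> B p" using \<alpha>(1) \<beta>(1) \<gamma>(1) half_ball[OF p(1)] by blast+
  have hull: "convex hull {\<phi> p \<alpha>, \<phi> p \<beta>, \<phi> p \<gamma>} = T" by (simp add: T \<alpha>(2) \<beta>(2) \<gamma>(2))
  have contT: "continuous_on T \<pi>"
  proof (rule closest_point_continuous[OF proj(1) compT Tcar])
    let ?C = "\<phi> p ` cball (pcenter (P p)) (pradius (P p) / 2)"
    have sub: "cball (pcenter (P p)) (pradius (P p) / 2) \<subseteq> B p" using patchD(2)[OF p(1)] by (auto simp: pball_def)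
    show "compact ?C"
      by (intro compact_continuous_image continuous_on_subset[OF C11_on_continuous[OF patchD(3)[OF p(1)]] sub]) auto
    show "?C \<subseteq> E" using sub patch_image_subset[OF p(1)] by blast
    show "\<pi> ` T \<subseteq> ?C" using near[OF pi_near] by fastforce
  qed
  interpret T: projected_triangle "B p" K \<kappa> d "\<phi> p" "pfun (P p)" "pderiv (P p)" "pfun_deriv (P p)" \<alpha> \<beta> \<gamma> E \<pi>
  proof unfold_locales
    show "convex (B p)" by (simp add: pball_def)
    show "norm (\<phi> p \<beta> - \<phi> p \<alpha>) \<le> d" "norm (\<phi> p \<gamma> - \<phi> p \<alpha>) \<le> d"
      using distT[OF corners(1,2)] distT[OF corners(1,3)] \<alpha>(2) \<beta>(2) \<gamma>(2) by (auto simp: dist_norm norm_minus_commute)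
    show "\<kappa> * d\<^sup>2 \<le> norm ((\<phi> p \<beta> - \<phi> p \<alpha>) \<times> (\<phi> p \<gamma> - \<phi> p \<alpha>))" using shp \<alpha>(2) \<beta>(2) \<gamma>(2) by simp
    have "192 * K ^ 7 * d \<le> 192 * K ^ 7 * h" using dh by (intro mult_left_mono) auto
    then show "192 * K ^ 7 * d \<le> \<kappa>" using small(1) by linarith
    show "dist x (\<pi> x) \<le> dist x e" if "x \<in> convex hull {\<phi> p \<alpha>, \<phi> p \<beta>, \<phi> p \<gamma>}" "e \<in> E" for x e
      using closest_point_properties(2)[OF proj(1), of x e] that Tcar unfolding hull by blast
    show "\<pi> x \<in> \<phi> p ` B p" if "x \<in> convex hull {\<phi> p \<alpha>, \<phi> p \<beta>, \<phi> p \<gamma>}" for x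
      using near[OF pi_near] that half_ball[OF p(1)] unfolding hull by blast
    show "continuous_on (convex hull {\<phi> p \<alpha>, \<phi> p \<beta>, \<phi> p \<gamma>}) \<pi>" unfolding hull by (rule contT)
  qed (use K \<kappa> d inB patchD[OF p(1)] patch_image_subset[OF p(1)] patch_nondegenerate[OF p(1)] in auto)
  define X where "X = \<lparr>cpatch = p, ccore = T.core, chalo = T.halo, carea = \<bar>T.\<delta>\<bar> / 2, cstretch = stretch p \<alpha>\<rparr>"
  have q: "T.q \<alpha> = stretch p \<alpha>" by (simp add: T.q_def stretch_def img_density_def dom_density_def)
  have r: "2 * K * d \<le> 2 * K * h" using dh by (intro mult_left_mono) auto
  have haloB: "T.halo \<subseteq> B p"
  proof
    fix x assume "x \<in> T.halo"
    then have "norm (x - \<alpha>) \<le> 2 * K * d" by (rule T.halo_dist)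
    also have "\<dots> \<le> 2 * K * h" by (rule r)
    also have "\<dots> \<le> pradius (P p) / 2" using small(3) r0p(2) by simp
    finally show "x \<in> B p" using \<alpha>(1) dist_triangle[of "pcenter (P p)" x \<alpha>]
      by (simp add: pball_def dist_norm norm_minus_commute)
  qed
  have coreB: "T.core \<subseteq> B p" using T.core_subset T.t_subset(1) by blast
  have core_dist: "norm (x - \<alpha>) \<le> 2 * K * d" if "x \<in> T.core" for x
  proof -
    have "norm (x - \<alpha>) \<le> K * d" using T.t_dist T.core_subset that by blast
    also have "\<dots> \<le> 2 * K * d" using d by simp
    finally show ?thesis .
  qed
  have pos: "0 < \<bar>T.\<delta>\<bar> / 2" using T.delta_nz by simp
  have s: "T.s = 48 * K ^ 7 / \<kappa> * d" by (simp add: T.s_def)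
  have s4: "4 * T.s \<le> cA * h"
  proof -
    have "4 * T.s = cA * d" by (simp add: s cA_def)
    also have "\<dots> \<le> cA * h" using dh \<kappa> by (intro mult_left_mono) (auto simp: cA_def)
    finally show ?thesis .
  qed
  have leb: "measure lebesgue T.halo = measure lborel T.halo" "measure lebesgue T.core = measure lborel T.core"
    using T.compact_halo T.compact_core by (simp_all add: borel_compact)
  have energy: "\<bar>face_energy g \<tau> - stretch p \<alpha> * (\<bar>T.\<delta>\<bar> / 2)\<bar> \<le> cE * h * (\<bar>T.\<delta>\<bar> / 2)"
  proof -
    have gv: "g a = pfun (P p) \<alpha>" "g b = pfun (P p) \<beta>" "g c = pfun (P p) \<gamma>"
      using g verts abcM patchD(10)[OF p(1)] inB \<alpha>(2) \<beta>(2) \<gamma>(2) by (auto simp: pl_interpolant_def)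
    have "face_energy g \<tau> = (norm ((pfun (P p) \<beta> - pfun (P p) \<alpha>) \<times> (pfun (P p) \<gamma> - pfun (P p) \<alpha>)) / 2)\<^sup>2 /
        (norm ((\<phi> p \<beta> - \<phi> p \<alpha>) \<times> (\<phi> p \<gamma> - \<phi> p \<alpha>)) / 2)"
      by (simp add: abc gv) (simp add: \<alpha>(2) \<beta>(2) \<gamma>(2))
    then have "\<bar>face_energy g \<tau> - stretch p \<alpha> * (\<bar>T.\<delta>\<bar> / 2)\<bar> \<le> cE * d * (\<bar>T.\<delta>\<bar> / 2)"
      using T.face_energy_approx unfolding q T.c_energy_def cE_def by simp
    also have "\<dots> \<le> cE * h * (\<bar>T.\<delta>\<bar> / 2)"
      using dh \<kappa> by (intro mult_right_mono mult_left_mono) (auto simp: cE_def)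
    finally show ?thesis .
  qed
  have approx: "measure \<eta> (\<phi> p ` A) \<le> (stretch p \<alpha> + cS * h) * measure lborel A \<and>
      (stretch p \<alpha> - cS * h) * measure lborel A \<le> measure \<eta> (\<phi> p ` A)"
    if A: "A \<in> sets borel" "A \<subseteq> T.core \<or> A \<subseteq> T.halo" "\<phi> p ` A \<subseteq> M" for A
  proof -
    have AB: "A \<subseteq> B p" using A(2) coreB haloB by blast
    have "norm (x - \<alpha>) \<le> 2 * K * h" if "x \<in> A" for x
      using A(2) that core_dist T.halo_dist r by (meson order_trans subsetD)
    note e = eta_image_approx[OF p(1) A(1) AB A(3) inB(1) _ small(4) this]
    have c: "26 * K ^ 14 * (2 * K * h) = cS * h" by (simp add: cS_def eval_nat_numeral)
    show ?thesis using e mesh(4) unfolding c by simp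
  qed
  have "good_cell \<tau> X"
    unfolding good_cell_def X_def cell.simps T_def[symmetric]
  proof (intro conjI ballI impI)
    show "stretch p \<alpha> \<le> K ^ 10" "0 \<le> stretch p \<alpha>" using stretch_bounds[OF p(1) inB(1)] by auto
    have "(1 + T.s)\<^sup>2 \<le> 1 + 4 * T.s" using T.s_pos T.s_le mult_mono[of T.s "1/4" T.s T.s]
      by (simp add: power2_eq_square algebra_simps)
    then have "(1 + T.s)\<^sup>2 \<le> 1 + cA * h" using s4 by linarith
    then show "measure lborel T.halo \<le> (1 + cA * h) * (\<bar>T.\<delta>\<bar> / 2)"
      unfolding leb[symmetric] T.measure_halo using pos by (intro mult_right_mono) auto
    have "1 - 4 * T.s \<le> (1 - 2 * T.s)\<^sup>2" by (simp add: power2_eq_square algebra_simps)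
    then have "1 - cA * h \<le> (1 - 2 * T.s)\<^sup>2" using s4 by linarith
    then show "(1 - cA * h) * (\<bar>T.\<delta>\<bar> / 2) \<le> measure lborel T.core"
      unfolding leb[symmetric] T.measure_core using pos by (intro mult_right_mono) auto
    have "(1 / 2)\<^sup>2 \<le> (1 - 2 * T.s)\<^sup>2" using T.s_le by (intro power_mono) auto
    then have "1 \<le> 4 * (1 - 2 * T.s)\<^sup>2" by (simp add: power_divide)
    then have "1 * (\<bar>T.\<delta>\<bar> / 2) \<le> 4 * (1 - 2 * T.s)\<^sup>2 * (\<bar>T.\<delta>\<bar> / 2)" using pos by (intro mult_right_mono) auto
    then show "\<bar>T.\<delta>\<bar> / 2 \<le> 4 * measure lborel T.core"
      unfolding leb[symmetric] T.measure_core by simp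
    have "(1 - 2 * T.s)\<^sup>2 \<le> 1\<^sup>2" using T.s_le T.s_pos by (intro power_mono) auto
    then have "(1 - 2 * T.s)\<^sup>2 * (\<bar>T.\<delta>\<bar> / 2) \<le> 1 * (\<bar>T.\<delta>\<bar> / 2)" using pos by (intro mult_right_mono) auto
    then show "measure lborel T.core \<le> \<bar>T.\<delta>\<bar> / 2"
      unfolding leb[symmetric] T.measure_core by simp
    show "\<exists>y\<in>T.halo. \<pi> z = \<phi> p y" if "z \<in> T" for z
      using T.proj_in_halo[of z] that unfolding hull by blast
    show "\<exists>z\<in>T. \<pi> z = \<phi> p y" if "y \<in> T.core" for y
      using T.core_covered[OF that] unfolding hull by blast
    show "\<exists>t>0. z + t *\<^sub>R (z - w) \<in> T" if "y \<in> T.core" "z \<in> T" "\<pi> z = \<phi> p y" "w \<in> T" for y z w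
      using T.core_deep[OF that(1) _ that(3), of w] that(2,4) unfolding hull by blast
  qed (use p(1) T.compact_core T.compact_halo coreB haloB pos energy approx in auto)
  then show ?thesis by blast
qed

text \<open>If \<open>z\<close> is interior to the first face, every point \<open>w\<close> of that face is an end of a segment through \<open>z\<close> in
it, and the intersection of the two faces is a face of the first one.\<close>

lemma face_subset_if_interior_point:
  assumes "\<tau> \<in> F" "\<sigma> \<in> F" "z \<in> triangle \<tau>" "z \<in> triangle \<sigma>"
    and "\<And>w. w \<in> triangle \<tau> \<Longrightarrow> \<exists>t>0. z + t *\<^sub>R (z - w) \<in> triangle \<tau>"
  shows "triangle \<tau> \<subseteq> triangle \<sigma>"
proof
  fix w assume w: "w \<in> triangle \<tau>"
  have "triangle \<tau> \<inter> triangle \<sigma> face_of triangle \<tau>"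
    using mesh(1) assms(1,2) unfolding simplicial_surface_def triangulation_def by blast
  note face = face_ofD[OF this]
  show "w \<in> triangle \<sigma>"
  proof (cases "w = z")
    case False
    obtain t where t: "0 < t" "z + t *\<^sub>R (z - w) \<in> triangle \<tau>" using assms(5)[OF w] by blast
    have "z \<in> open_segment w (z + t *\<^sub>R (z - w))"
      unfolding in_segment
    proof (intro conjI exI[of _ "1 / (1 + t)"])
      show "w \<noteq> z + t *\<^sub>R (z - w)"
      proof
        assume "w = z + t *\<^sub>R (z - w)"
        then have "(1 + t) *\<^sub>R (z - w) = 0" by (simp add: algebra_simps)
        then show False using t(1) False by simp
      qed
      have "(1 + t) *\<^sub>R ((1 - 1 / (1 + t)) *\<^sub>R w + (1 / (1 + t)) *\<^sub>R (z + t *\<^sub>R (z - w))) = (1 + t) *\<^sub>R z"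
        using t(1) by (simp add: scaleR_add_right scaleR_diff_right scaleR_diff_left scaleR_add_left right_diff_distrib)
      then show "z = (1 - 1 / (1 + t)) *\<^sub>R w + (1 / (1 + t)) *\<^sub>R (z + t *\<^sub>R (z - w))"
        using t(1) by simp
    qed (use t(1) in auto)
    then have "w \<in> triangle \<tau> \<inter> triangle \<sigma>" using face[OF _ w t(2)] assms(3,4) by blast
    then show ?thesis by blast
  qed (use assms(4) in simp)
qed

text \<open>A common point is the projection of a point of each of the two triangles. By injectivity it is the same
point of the mesh, and it is interior to both.\<close>

lemma cores_disjoint:
  assumes X: "good_cell \<tau> X" "\<tau> \<in> F" and Y: "good_cell \<sigma> Y" "\<sigma> \<in> F"
    and y: "x \<in> ccore X" "y \<in> ccore Y" "\<phi> (cpatch X) x = \<phi> (cpatch Y) y"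
  shows "\<tau> = \<sigma>"
proof -
  obtain z where z: "z \<in> triangle \<tau>" "\<pi> z = \<phi> (cpatch X) x" using X(1) y(1) unfolding good_cell_def by blast
  obtain w where w: "w \<in> triangle \<sigma>" "\<pi> w = \<phi> (cpatch Y) y" using Y(1) y(2) unfolding good_cell_def by blast
  have "z \<in> carrier F" "w \<in> carrier F" using z(1) w(1) X(2) Y(2) by (auto simp: carrier_def)
  moreover have "\<pi> z = \<pi> w" using z(2) w(2) y(3) by simp
  ultimately have zw: "z = w" using inj_onD[OF proj(2)] by blast
  have "triangle \<tau> \<subseteq> triangle \<sigma>"
    by (rule face_subset_if_interior_point[OF X(2) Y(2) z(1)]) (use X(1) y(1) z w zw in \<open>auto simp: good_cell_def\<close>)
  moreover have "triangle \<sigma> \<subseteq> triangle \<tau>"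
    by (rule face_subset_if_interior_point[OF Y(2) X(2) w(1)]) (use Y(1) y(2) z w zw in \<open>auto simp: good_cell_def\<close>)
  ultimately have "triangle \<tau> = triangle \<sigma>" by blast
  then show ?thesis using mesh(1) X(2) Y(2) unfolding simplicial_surface_def by (auto dest: inj_onD)
qed

text \<open>The estimate for one mesh, with explicit constants. The set \<open>S\<close> is a neighborhood of the boundary that
accounts for the difference between the projected mesh and the surface.\<close>

theorem mesh_energy_estimate:
  fixes \<sigma> :: real
  assumes S: "S \<in> sets borel" "sym_diff (lift E F) M \<subseteq> S"
    and \<sigma>: "\<And>p. p \<in> I \<Longrightarrow> measure lborel {x \<in> B p. \<phi> p x \<in> S} \<le> \<sigma>"
  shows "\<bar>discrete_stretch_energy F g - stretch_energy M f\<bar>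
    \<le> (cE + K ^ 10 * cA + cS + cS * cA) * h * (4 * (\<Sum>p\<in>I. measure lborel (B p))) + K ^ 10 * (card I * \<sigma>)"
proof -
  interpret finite_measure \<eta> by (rule eta_finite)
  have finF: "finite F" using mesh(1) by (simp add: simplicial_surface_def)
  have "\<forall>\<tau>\<in>F. \<exists>X. good_cell \<tau> X" using good_cell_exists by blast
  from bchoice[OF this] obtain X where X: "\<And>\<tau>. \<tau> \<in> F \<Longrightarrow> good_cell \<tau> (X \<tau>)" by blast
  define p where "p \<tau> = cpatch (X \<tau>)" for \<tau>
  define core where "core \<tau> = ccore (X \<tau>)" for \<tau>
  define halo where "halo \<tau> = chalo (X \<tau>)" for \<tau>
  define t where "t \<tau> = carea (X \<tau>)" for \<tau>
  define q where "q \<tau> = cstretch (X \<tau>)" for \<tau>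
  define inM where "inM \<tau> A = {x \<in> A. \<phi> (p \<tau>) x \<in> M}" for \<tau> A
  define offM where "offM \<tau> = {x \<in> core \<tau>. \<phi> (p \<tau>) x \<notin> M}" for \<tau>
  note defs = p_def core_def halo_def t_def q_def
  have pI: "p \<tau> \<in> I" and core: "compact (core \<tau>)" "core \<tau> \<subseteq> B (p \<tau>)" and halo: "compact (halo \<tau>)" "halo \<tau> \<subseteq> B (p \<tau>)"
    and t0: "0 < t \<tau>" and q0: "0 \<le> q \<tau>" "q \<tau> \<le> K ^ 10"
    and energy: "\<bar>face_energy g \<tau> - q \<tau> * t \<tau>\<bar> \<le> cE * h * t \<tau>"
    and halo_le: "measure lborel (halo \<tau>) \<le> (1 + cA * h) * t \<tau>"
    and core_ge: "(1 - cA * h) * t \<tau> \<le> measure lborel (core \<tau>)" "t \<tau> \<le> 4 * measure lborel (core \<tau>)"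
    and core_le: "measure lborel (core \<tau>) \<le> t \<tau>"
    and proj_halo: "\<And>z. z \<in> triangle \<tau> \<Longrightarrow> \<exists>y\<in>halo \<tau>. \<pi> z = \<phi> (p \<tau>) y"
    and core_cov: "\<And>y. y \<in> core \<tau> \<Longrightarrow> \<exists>z\<in>triangle \<tau>. \<pi> z = \<phi> (p \<tau>) y"
    if "\<tau> \<in> F" for \<tau>
    using X[OF that] unfolding good_cell_def defs by blast+
  have approx: "measure \<eta> (\<phi> (p \<tau>) ` A) \<le> (q \<tau> + cS * h) * measure lborel A"
      "(q \<tau> - cS * h) * measure lborel A \<le> measure \<eta> (\<phi> (p \<tau>) ` A)"
    if "\<tau> \<in> F" "A \<in> sets borel" "A \<subseteq> core \<tau> \<or> A \<subseteq> halo \<tau>" "\<phi> (p \<tau>) ` A \<subseteq> M" for \<tau> A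
    using X[OF that(1)] that(2-4) unfolding good_cell_def defs by blast+
  have coeffs: "0 \<le> cE" "0 \<le> cA" "0 \<le> cS" "0 \<le> h"
    using \<kappa> mesh(4) by (auto simp: cE_def cA_def cS_def)
  have borel: "core \<tau> \<in> sets borel" "halo \<tau> \<in> sets borel" if "\<tau> \<in> F" for \<tau>
    using core(1)[OF that] halo(1)[OF that] by (simp_all add: borel_compact)
  have inM_borel: "inM \<tau> A \<in> sets borel" if "\<tau> \<in> F" "A \<in> sets borel" "A \<subseteq> B (p \<tau>)" for \<tau> A
    unfolding inM_def by (rule patch_preimage_borel[OF pI[OF that(1)] that(2,3) M_closed(2)])
  have inM_sub: "inM \<tau> A \<subseteq> A" "\<phi> (p \<tau>) ` inM \<tau> A \<subseteq> M" for \<tau> A by (auto simp: inM_def)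
  have fm: "A \<in> fmeasurable lborel" if "\<tau> \<in> I" "A \<in> sets borel" "A \<subseteq> B \<tau>" for A \<tau>
    using patch_emeasure[OF that(1,3)] that(2) by (intro fmeasurableI) auto
  have dis: "\<tau> = \<tau>'" if "\<tau> \<in> F" "\<tau>' \<in> F" "x \<in> core \<tau>" "y \<in> core \<tau>'" "\<phi> (p \<tau>) x = \<phi> (p \<tau>') y" for \<tau> \<tau>' x y
    using cores_disjoint[OF X[OF that(1)] that(1) X[OF that(2)] that(2)] that(3-5) unfolding defs by blast
  \<comment> \<open>Within one patch the cores are disjoint planar sets, so their areas sum up to at most the area there.\<close>
  have packing: "(\<Sum>\<tau>\<in>F. measure lborel (A \<tau>)) \<le> (\<Sum>r\<in>I. measure lborel (D r))"
    if A: "\<And>\<tau>. \<tau> \<in> F \<Longrightarrow> A \<tau> \<in> sets borel" "\<And>\<tau>. \<tau> \<in> F \<Longrightarrow> A \<tau> \<subseteq> core \<tau>" "\<And>\<tau>. \<tau> \<in> F \<Longrightarrow> A \<tau> \<subseteq> D (p \<tau>)"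
      and D: "\<And>r. r \<in> I \<Longrightarrow> D r \<in> sets borel" "\<And>r. r \<in> I \<Longrightarrow> D r \<subseteq> B r" for A D
  proof -
    have "(\<Sum>\<tau>\<in>F. measure lborel (A \<tau>)) = (\<Sum>r\<in>I. \<Sum>\<tau>\<in>{\<tau>\<in>F. p \<tau> = r}. measure lborel (A \<tau>))"
      by (rule sum.group[symmetric, OF finF I(1)]) (use pI in auto)
    also have "\<dots> \<le> (\<Sum>r\<in>I. measure lborel (D r))"
    proof (rule sum_mono)
      fix r assume r: "r \<in> I"
      let ?F = "{\<tau>\<in>F. p \<tau> = r}"
      have "(\<Sum>\<tau>\<in>?F. measure lborel (A \<tau>)) = measure lborel (\<Union>\<tau>\<in>?F. A \<tau>)"
      proof (rule measure_UNION'[symmetric])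
        show "finite ?F" using finF by simp
        show "A \<tau> \<in> fmeasurable lborel" if "\<tau> \<in> ?F" for \<tau>
        proof -
          have \<tau>: "\<tau> \<in> F" "p \<tau> = r" using that by auto
          have "A \<tau> \<subseteq> B r" using A(2)[OF \<tau>(1)] core(2)[OF \<tau>(1)] \<tau>(2) by blast
          then show ?thesis by (rule fm[OF r A(1)[OF \<tau>(1)]])
        qed
        show "pairwise (\<lambda>\<tau> \<tau>'. disjnt (A \<tau>) (A \<tau>')) ?F"
          unfolding pairwise_def disjnt_def
        proof (intro ballI impI)
          fix \<tau> \<tau>' assume *: "\<tau> \<in> ?F" "\<tau>' \<in> ?F" "\<tau> \<noteq> \<tau>'"
          have "False" if "x \<in> A \<tau>" "x \<in> A \<tau>'" for x
          proof -
            have F: "\<tau> \<in> F" "\<tau>' \<in> F" "p \<tau> = p \<tau>'" using * by auto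
            have "x \<in> core \<tau>" "x \<in> core \<tau>'" using A(2)[OF F(1)] A(2)[OF F(2)] that by blast+
            then show False using dis[OF F(1,2), of x x] F(3) *(3) by simp
          qed
          then show "A \<tau> \<inter> A \<tau>' = {}" by blast
        qed
      qed
      also have "\<dots> \<le> measure lborel (D r)"
      proof (rule measure_mono_fmeasurable)
        show "(\<Union>\<tau>\<in>?F. A \<tau>) \<subseteq> D r" using A(3) by blast
        show "(\<Union>\<tau>\<in>?F. A \<tau>) \<in> sets lborel"
          unfolding sets_lborel by (intro sets.finite_UN A(1)) (use finF in auto)
        show "D r \<in> fmeasurable lborel" by (rule fm[OF r D(1)[OF r] D(2)[OF r]])
      qed
      finally show "(\<Sum>\<tau>\<in>?F. measure lborel (A \<tau>)) \<le> measure lborel (D r)" .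
    qed
    finally show ?thesis .
  qed
  define \<Lambda> where "\<Lambda> = 4 * (\<Sum>r\<in>I. measure lborel (B r))"
  have sum_t: "(\<Sum>\<tau>\<in>F. t \<tau>) \<le> \<Lambda>"
  proof -
    have "(\<Sum>\<tau>\<in>F. t \<tau>) \<le> (\<Sum>\<tau>\<in>F. 4 * measure lborel (core \<tau>))" by (intro sum_mono core_ge)
    also have "\<dots> = 4 * (\<Sum>\<tau>\<in>F. measure lborel (core \<tau>))" by (simp add: sum_distrib_left)
    also have "\<dots> \<le> \<Lambda>" unfolding \<Lambda>_def
      by (intro mult_left_mono packing borel core(2) B_borel) simp_all
    finally show ?thesis .
  qed
  have sum_\<sigma>: "(\<Sum>r\<in>I. measure lborel {x \<in> B r. \<phi> r x \<in> S}) \<le> card I * \<sigma>"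
    using sum_bounded_above[of I "\<lambda>r. measure lborel {x \<in> B r. \<phi> r x \<in> S}" \<sigma>] \<sigma> by simp
  have S_borel: "{x \<in> B r. \<phi> r x \<in> S} \<in> sets borel" if "r \<in> I" for r
    by (rule patch_preimage_borel[OF that B_borel order_refl S(1)])
  have offM_S: "\<phi> (p \<tau>) x \<in> S" if \<tau>: "\<tau> \<in> F" and x: "x \<in> offM \<tau>" for \<tau> x
  proof -
    have "x \<in> core \<tau>" "\<phi> (p \<tau>) x \<notin> M" using x by (auto simp: offM_def)
    moreover obtain z where "z \<in> triangle \<tau>" "\<pi> z = \<phi> (p \<tau>) x"
      using core_cov[OF \<tau> \<open>x \<in> core \<tau>\<close>] by blast
    then have "\<phi> (p \<tau>) x \<in> lift E F" using \<tau> unfolding lift_def carrier_def by force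
    ultimately show ?thesis using S(2) by blast
  qed
  have offM_borel: "offM \<tau> \<in> sets borel" if "\<tau> \<in> F" for \<tau>
  proof -
    have "offM \<tau> = core \<tau> - inM \<tau> (core \<tau>)" by (auto simp: offM_def inM_def)
    then show ?thesis using borel(1)[OF that] inM_borel[OF that borel(1)[OF that] core(2)[OF that]] by simp
  qed
  have sum_offM: "(\<Sum>\<tau>\<in>F. measure lborel (offM \<tau>)) \<le> card I * \<sigma>"
  proof (rule order_trans[OF packing sum_\<sigma>])
    show "offM \<tau> \<subseteq> {x \<in> B (p \<tau>). \<phi> (p \<tau>) x \<in> S}" if "\<tau> \<in> F" for \<tau>
      using offM_S[OF that] core(2)[OF that] by (auto simp: offM_def)
    show "offM \<tau> \<subseteq> core \<tau>" for \<tau> by (auto simp: offM_def)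
  qed (use offM_borel S_borel in blast)+
  have img: "\<phi> (p \<tau>) ` inM \<tau> A \<in> sets \<eta>" if "\<tau> \<in> F" "A \<in> sets borel" "A \<subseteq> B (p \<tau>)" for \<tau> A
    unfolding eta_sets
    by (rule image_sets(1)[OF pI[OF that(1)] inM_borel[OF that] subset_trans[OF inM_sub(1) that(3)] inM_sub(2)])
  have M_sets: "M \<in> sets \<eta>" using M_closed by (simp add: eta_sets in_sets_mu)
  \<comment> \<open>A point of the surface is the projection of a point of some face, hence in a halo, unless it is in \<open>S\<close>.\<close>
  have upper: "measure \<eta> M \<le> (\<Sum>\<tau>\<in>F. q \<tau> * t \<tau>) + (K ^ 10 * cA + cS + cS * cA) * h * \<Lambda> + K ^ 10 * (card I * \<sigma>)"
  proof -
    have U: "(\<Union>\<tau>\<in>F. \<phi> (p \<tau>) ` inM \<tau> (halo \<tau>)) \<in> sets \<eta>"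
      by (intro sets.finite_UN finF img borel halo)
    have MS: "M \<inter> S \<in> sets \<eta>" using eta_closed_le(1)[OF S(1)] by (simp add: eta_sets)
    have "M \<subseteq> (\<Union>\<tau>\<in>F. \<phi> (p \<tau>) ` inM \<tau> (halo \<tau>)) \<union> (M \<inter> S)"
    proof
      fix y assume y: "y \<in> M"
      show "y \<in> (\<Union>\<tau>\<in>F. \<phi> (p \<tau>) ` inM \<tau> (halo \<tau>)) \<union> (M \<inter> S)"
      proof (cases "y \<in> lift E F")
        case True
        then obtain \<tau> z where z: "\<tau> \<in> F" "z \<in> triangle \<tau>" "y = \<pi> z" by (auto simp: lift_def carrier_def)
        obtain x where "x \<in> halo \<tau>" "\<pi> z = \<phi> (p \<tau>) x" using proj_halo[OF z(1,2)] by blast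
        then have "y \<in> \<phi> (p \<tau>) ` inM \<tau> (halo \<tau>)" using y z(3) unfolding inM_def by auto
        then show ?thesis using z(1) by blast
      qed (use y S(2) in blast)
    qed
    then have "measure \<eta> M \<le> measure \<eta> ((\<Union>\<tau>\<in>F. \<phi> (p \<tau>) ` inM \<tau> (halo \<tau>)) \<union> (M \<inter> S))"
      using U MS by (intro finite_measure_mono) auto
    also have "\<dots> \<le> measure \<eta> (\<Union>\<tau>\<in>F. \<phi> (p \<tau>) ` inM \<tau> (halo \<tau>)) + measure \<eta> (M \<inter> S)"
      by (rule measure_Un_le[OF U MS])
    also have "measure \<eta> (\<Union>\<tau>\<in>F. \<phi> (p \<tau>) ` inM \<tau> (halo \<tau>)) \<le> (\<Sum>\<tau>\<in>F. measure \<eta> (\<phi> (p \<tau>) ` inM \<tau> (halo \<tau>)))"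
      by (intro finite_measure_subadditive_finite finF image_subsetI img borel halo)
    also have "\<dots> \<le> (\<Sum>\<tau>\<in>F. q \<tau> * t \<tau> + (K ^ 10 * cA + cS + cS * cA) * h * t \<tau>)"
    proof (rule sum_mono)
      fix \<tau> assume \<tau>: "\<tau> \<in> F"
      have "measure \<eta> (\<phi> (p \<tau>) ` inM \<tau> (halo \<tau>)) \<le> (q \<tau> + cS * h) * measure lborel (inM \<tau> (halo \<tau>))"
        by (rule approx(1)[OF \<tau> inM_borel[OF \<tau> borel(2)[OF \<tau>] halo(2)[OF \<tau>]] disjI2[OF inM_sub(1)] inM_sub(2)])
      also have "\<dots> \<le> (q \<tau> + cS * h) * ((1 + cA * h) * t \<tau>)"
      proof (intro mult_left_mono order_trans[OF _ halo_le[OF \<tau>]] measure_mono_fmeasurable)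
        show "halo \<tau> \<in> fmeasurable lborel" by (rule fm[OF pI[OF \<tau>] borel(2)[OF \<tau>] halo(2)[OF \<tau>]])
        show "inM \<tau> (halo \<tau>) \<in> sets lborel" using inM_borel[OF \<tau> borel(2)[OF \<tau>] halo(2)[OF \<tau>]] by simp
        show "inM \<tau> (halo \<tau>) \<subseteq> halo \<tau>" by (rule inM_sub(1))
        show "0 \<le> q \<tau> + cS * h" using q0[OF \<tau>] coeffs by simp
      qed
      also have "\<dots> = q \<tau> * t \<tau> + (q \<tau> * cA + cS + cS * cA * h) * (h * t \<tau>)" by (simp add: algebra_simps)
      also have "\<dots> \<le> q \<tau> * t \<tau> + (K ^ 10 * cA + cS + cS * cA * 1) * (h * t \<tau>)"
        using q0[OF \<tau>] coeffs t0[OF \<tau>] small(5)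
        by (intro add_left_mono mult_right_mono add_mono mult_left_mono) auto
      finally show "measure \<eta> (\<phi> (p \<tau>) ` inM \<tau> (halo \<tau>)) \<le> q \<tau> * t \<tau> + (K ^ 10 * cA + cS + cS * cA) * h * t \<tau>"
        by (simp add: mult.assoc)
    qed
    also have "\<dots> = (\<Sum>\<tau>\<in>F. q \<tau> * t \<tau>) + (K ^ 10 * cA + cS + cS * cA) * h * (\<Sum>\<tau>\<in>F. t \<tau>)"
      by (simp add: sum.distrib sum_distrib_left)
    also have "\<dots> \<le> (\<Sum>\<tau>\<in>F. q \<tau> * t \<tau>) + (K ^ 10 * cA + cS + cS * cA) * h * \<Lambda>"
      using coeffs by (intro add_left_mono mult_left_mono sum_t) auto
    also have "measure \<eta> (M \<inter> S) \<le> K ^ 10 * (\<Sum>r\<in>I. measure lborel {x \<in> B r. \<phi> r x \<in> S})"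
      using eta_closed_le(2)[OF S(1)] unfolding emeasure_eq_measure
      by (subst (asm) ennreal_le_iff) (auto intro!: mult_nonneg_nonneg sum_nonneg)
    also have "\<dots> \<le> K ^ 10 * (card I * \<sigma>)" by (intro mult_left_mono sum_\<sigma>) auto
    finally show ?thesis by simp
  qed
  \<comment> \<open>The image of a core point is in the lift, so it lies on the surface unless it is in \<open>S\<close>.\<close>
  have lower: "(\<Sum>\<tau>\<in>F. q \<tau> * t \<tau>) - (K ^ 10 * cA + cS) * h * \<Lambda> - K ^ 10 * (card I * \<sigma>) \<le> measure \<eta> M"
  proof -
    have "(\<Sum>\<tau>\<in>F. q \<tau> * t \<tau>) - (K ^ 10 * cA + cS) * h * \<Lambda> - K ^ 10 * (card I * \<sigma>)
        \<le> (\<Sum>\<tau>\<in>F. q \<tau> * t \<tau>) - (K ^ 10 * cA + cS) * h * (\<Sum>\<tau>\<in>F. t \<tau>) - K ^ 10 * (\<Sum>\<tau>\<in>F. measure lborel (offM \<tau>))"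
      using coeffs by (intro diff_mono mult_left_mono sum_t sum_offM order_refl) auto
    also have "\<dots> = (\<Sum>\<tau>\<in>F. q \<tau> * t \<tau> - (K ^ 10 * cA + cS) * h * t \<tau> - K ^ 10 * measure lborel (offM \<tau>))"
      by (simp add: sum_subtractf sum_distrib_left)
    also have "\<dots> \<le> (\<Sum>\<tau>\<in>F. measure \<eta> (\<phi> (p \<tau>) ` inM \<tau> (core \<tau>)))"
    proof (rule sum_mono)
      fix \<tau> assume \<tau>: "\<tau> \<in> F"
      have b: "inM \<tau> (core \<tau>) \<in> sets borel" by (rule inM_borel[OF \<tau> borel(1)[OF \<tau>] core(2)[OF \<tau>]])
      let ?a = "measure lborel (inM \<tau> (core \<tau>))"
      have "measure lborel (inM \<tau> (core \<tau>) \<union> offM \<tau>) = ?a + measure lborel (offM \<tau>)"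
      proof (rule measure_Un3[THEN trans])
        show "inM \<tau> (core \<tau>) \<in> fmeasurable lborel" 
          by (rule fm[OF pI[OF \<tau>] b subset_trans[OF inM_sub(1) core(2)[OF \<tau>]]])
        show "offM \<tau> \<in> fmeasurable lborel"
          using offM_borel[OF \<tau>] core(2)[OF \<tau>] by (intro fm[OF pI[OF \<tau>]]) (auto simp: offM_def)
        have "inM \<tau> (core \<tau>) \<inter> offM \<tau> = {}" by (auto simp: inM_def offM_def)
        then show "?a + measure lborel (offM \<tau>) - measure lborel (inM \<tau> (core \<tau>) \<inter> offM \<tau>) = ?a + measure lborel (offM \<tau>)"
          by simp
      qed
      moreover have "inM \<tau> (core \<tau>) \<union> offM \<tau> = core \<tau>" by (auto simp: inM_def offM_def)
      ultimately have a: "?a = measure lborel (core \<tau>) - measure lborel (offM \<tau>)" by simp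
      have m0: "0 \<le> measure lborel (offM \<tau>)" by simp
      have "q \<tau> * t \<tau> - (K ^ 10 * cA + cS) * h * t \<tau> - K ^ 10 * measure lborel (offM \<tau>)
          \<le> q \<tau> * t \<tau> - q \<tau> * cA * h * t \<tau> - q \<tau> * measure lborel (offM \<tau>) - cS * h * t \<tau>"
      proof -
        have "q \<tau> * cA * h * t \<tau> \<le> K ^ 10 * cA * h * t \<tau>"
          using q0[OF \<tau>] coeffs t0[OF \<tau>] by (intro mult_right_mono) auto
        moreover have "q \<tau> * measure lborel (offM \<tau>) \<le> K ^ 10 * measure lborel (offM \<tau>)"
          using q0[OF \<tau>] by (intro mult_right_mono) auto
        ultimately show ?thesis by (simp add: distrib_right)
      qed
      also have "\<dots> = q \<tau> * ((1 - cA * h) * t \<tau> - measure lborel (offM \<tau>)) - cS * h * t \<tau>"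
        by (simp add: algebra_simps)
      also have "\<dots> \<le> q \<tau> * ?a - cS * h * ?a"
      proof (rule diff_mono)
        have "(1 - cA * h) * t \<tau> - measure lborel (offM \<tau>) \<le> ?a"
          unfolding a using core_ge(1)[OF \<tau>] by linarith
        then show "q \<tau> * ((1 - cA * h) * t \<tau> - measure lborel (offM \<tau>)) \<le> q \<tau> * ?a"
          by (rule mult_left_mono[OF _ q0(1)[OF \<tau>]])
        have "?a \<le> t \<tau>" unfolding a using core_le[OF \<tau>] m0 by linarith
        then show "cS * h * ?a \<le> cS * h * t \<tau>"
          by (rule mult_left_mono[OF _ mult_nonneg_nonneg[OF coeffs(3,4)]])
      qed
      also have "\<dots> = (q \<tau> - cS * h) * ?a" by (simp add: algebra_simps)
      also have "\<dots> \<le> measure \<eta> (\<phi> (p \<tau>) ` inM \<tau> (core \<tau>))"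
        by (rule approx(2)[OF \<tau> b disjI1[OF inM_sub(1)] inM_sub(2)])
      finally show "q \<tau> * t \<tau> - (K ^ 10 * cA + cS) * h * t \<tau> - K ^ 10 * measure lborel (offM \<tau>)
          \<le> measure \<eta> (\<phi> (p \<tau>) ` inM \<tau> (core \<tau>))" .
    qed
    also have "\<dots> = measure \<eta> (\<Union>\<tau>\<in>F. \<phi> (p \<tau>) ` inM \<tau> (core \<tau>))"
    proof (rule finite_measure_finite_Union[symmetric, OF finF])
      show "(\<lambda>\<tau>. \<phi> (p \<tau>) ` inM \<tau> (core \<tau>)) ` F \<subseteq> sets \<eta>"
        by (intro image_subsetI img borel core)
      show "disjoint_family_on (\<lambda>\<tau>. \<phi> (p \<tau>) ` inM \<tau> (core \<tau>)) F"
        unfolding disjoint_family_on_def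
      proof (intro ballI impI)
        fix \<tau> \<tau>' assume *: "\<tau> \<in> F" "\<tau>' \<in> F" "\<tau> \<noteq> \<tau>'"
        have False if "y \<in> \<phi> (p \<tau>) ` inM \<tau> (core \<tau>)" "y \<in> \<phi> (p \<tau>') ` inM \<tau>' (core \<tau>')" for y
        proof -
          from that(1) obtain a where a: "a \<in> core \<tau>" "y = \<phi> (p \<tau>) a" by (auto simp: inM_def)
          from that(2) obtain b where b: "b \<in> core \<tau>'" "y = \<phi> (p \<tau>') b" by (auto simp: inM_def)
          show False using dis[OF *(1,2) a(1) b(1)] a(2) b(2) *(3) by simp
        qed
        then show "\<phi> (p \<tau>) ` inM \<tau> (core \<tau>) \<inter> \<phi> (p \<tau>') ` inM \<tau>' (core \<tau>') = {}" by blast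
      qed
    qed
    also have "\<dots> \<le> measure \<eta> M"
      by (rule finite_measure_mono[OF _ M_sets]) (auto simp: inM_def)
    finally show ?thesis .
  qed
  have "\<bar>(\<Sum>\<tau>\<in>F. face_energy g \<tau>) - (\<Sum>\<tau>\<in>F. q \<tau> * t \<tau>)\<bar> \<le> cE * h * \<Lambda>"
  proof -
    have "\<bar>(\<Sum>\<tau>\<in>F. face_energy g \<tau>) - (\<Sum>\<tau>\<in>F. q \<tau> * t \<tau>)\<bar> \<le> (\<Sum>\<tau>\<in>F. cE * h * t \<tau>)"
      unfolding sum_subtractf[symmetric] by (intro order_trans[OF sum_abs] sum_mono energy)
    also have "\<dots> = cE * h * (\<Sum>\<tau>\<in>F. t \<tau>)" by (simp add: sum_distrib_left)
    also have "\<dots> \<le> cE * h * \<Lambda>" using coeffs by (intro mult_left_mono sum_t) auto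
    finally show ?thesis .
  qed
  moreover have "discrete_stretch_energy F g = (\<Sum>\<tau>\<in>F. face_energy g \<tau>)"
    by (simp add: discrete_stretch_energy_def)
  moreover have "0 \<le> cS * cA * h * \<Lambda>" unfolding \<Lambda>_def
    using coeffs by (intro mult_nonneg_nonneg sum_nonneg) auto
  ultimately show ?thesis
    using upper lower unfolding stretch_energy_eq \<Lambda>_def[symmetric] by (simp add: distrib_right)
qed

end

section \<open>Uniformity in the mesh size\<close>

text \<open>The coordinates of two points of the ball differ by at most \<open>K\<close> times its diameter.\<close>

lemma (in covered_surface) patch_preimage_cball:
  assumes "p \<in> I" "0 \<le> \<epsilon>"
  shows "measure lborel {x \<in> B p. \<phi> p x \<in> cball z \<epsilon>} \<le> pi * (2 * K * \<epsilon>)\<^sup>2"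
proof (cases "{x \<in> B p. \<phi> p x \<in> cball z \<epsilon>} = {}")
  case False
  then obtain y where y: "y \<in> B p" "\<phi> p y \<in> cball z \<epsilon>" by blast
  have "{x \<in> B p. \<phi> p x \<in> cball z \<epsilon>} \<subseteq> cball y (2 * K * \<epsilon>)"
  proof
    fix x assume x: "x \<in> {x \<in> B p. \<phi> p x \<in> cball z \<epsilon>}"
    have "norm (y - x) \<le> K * norm (\<phi> p y - \<phi> p x)" using x by (intro patchD(5)[OF assms(1) y(1)]) auto
    also have "norm (\<phi> p y - \<phi> p x) \<le> 2 * \<epsilon>"
      using x y(2) dist_triangle[of "\<phi> p y" "\<phi> p x" z] by (auto simp: dist_norm norm_minus_commute)
    finally show "x \<in> cball y (2 * K * \<epsilon>)" by (simp add: dist_norm mult_ac)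
  qed
  then have "measure lborel {x \<in> B p. \<phi> p x \<in> cball z \<epsilon>} \<le> measure lborel (cball y (2 * K * \<epsilon>))"
    using patch_preimage_borel[OF assms(1) B_borel order_refl, of "cball z \<epsilon>"]
    by (intro measure_mono_fmeasurable) (auto intro: fmeasurable_compact)
  also have "\<dots> = pi * (2 * K * \<epsilon>)\<^sup>2"
    using assms(2) by (simp add: content_cball unit_ball_vol_2)
  finally show ?thesis .
next
  case True
  then show ?thesis by (simp only: True) simp
qed

lemma (in covered_surface) patch_preimage_strip:
  assumes p: "p \<in> I" and \<epsilon>: "0 < \<epsilon>" and Z: "finite Z" "real (card Z) \<le> C / \<epsilon>"
  shows "measure lborel {x \<in> B p. \<phi> p x \<in> (\<Union>z\<in>Z. cball z (2 * \<epsilon>))} \<le> 16 * pi * K\<^sup>2 * C * \<epsilon>"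
proof -
  have "{x \<in> B p. \<phi> p x \<in> (\<Union>z\<in>Z. cball z (2 * \<epsilon>))} = (\<Union>z\<in>Z. {x \<in> B p. \<phi> p x \<in> cball z (2 * \<epsilon>)})" by auto
  also have "measure lborel \<dots> \<le> (\<Sum>z\<in>Z. measure lborel {x \<in> B p. \<phi> p x \<in> cball z (2 * \<epsilon>)})"
  proof (rule measure_UNION_le[OF Z(1)])
    show "{x \<in> B p. \<phi> p x \<in> cball z (2 * \<epsilon>)} \<in> sets lborel" for z
      using patch_preimage_borel[OF p B_borel order_refl, of "cball z (2 * \<epsilon>)"] by simp
  qed
  also have "\<dots> \<le> (\<Sum>z\<in>Z. pi * (2 * K * (2 * \<epsilon>))\<^sup>2)"
    using \<epsilon> by (intro sum_mono patch_preimage_cball[OF p]) auto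
  also have "\<dots> = real (card Z) * (pi * (2 * K * (2 * \<epsilon>))\<^sup>2)" by simp
  also have "\<dots> \<le> C / \<epsilon> * (pi * (2 * K * (2 * \<epsilon>))\<^sup>2)" using Z(2) by (intro mult_right_mono) auto
  also have "\<dots> = 16 * pi * K\<^sup>2 * C * \<epsilon>" using \<epsilon> by (simp add: power2_eq_square field_simps)
  finally show ?thesis .
qed

lemma patch_cover_exists:
  assumes "compact M" "smooth_surface M" and E: "smooth_surface E" "M \<subseteq> E - surface_boundary E"
    and f: "smooth_on M f"
  obtains I R K P where "covered_surface E M f I R K P"
proof -
  have "\<exists>R K P. good_patch E M f p R K P" if "p \<in> M" for p
    by (rule good_patch_exists[OF E assms(2) f that]) blast
  then have "\<forall>p\<in>M. \<exists>x. good_patch E M f p (fst x) (fst (snd x)) (snd (snd x))" by fastforce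
  from bchoice[OF this] obtain x where
    x: "\<And>p. p \<in> M \<Longrightarrow> good_patch E M f p (fst (x p)) (fst (snd (x p))) (snd (snd (x p)))" by blast
  define R where "R p = fst (x p)" for p
  define L where "L p = fst (snd (x p))" for p
  define P where "P p = snd (snd (x p))" for p
  have g: "good_patch E M f p (R p) (L p) (P p)" if "p \<in> M" for p using x[OF that] by (simp add: R_def L_def P_def)
  obtain I where I: "I \<subseteq> M" "finite I" "M \<subseteq> (\<Union>p\<in>I. ball p (R p / 2))"
  proof (rule compactE_image[OF assms(1), of M "\<lambda>p. ball p (R p / 2)"])
    show "M \<subseteq> (\<Union>p\<in>M. ball p (R p / 2))"
    proof
      fix p assume p: "p \<in> M"
      then have "0 < R p" using g by (simp add: good_patch_def)
      then show "p \<in> (\<Union>p\<in>M. ball p (R p / 2))" using p by (intro UN_I[of p]) auto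
    qed
  qed auto
  define K where "K = Max (insert 1 (L ` I))"
  have K: "1 \<le> K" "\<And>p. p \<in> I \<Longrightarrow> L p \<le> K" using I(2) by (auto simp: K_def intro: Max_ge)
  have "covered_surface E M f I R K P"
  proof
    show "good_patch E M f p (R p) K (P p)" if "p \<in> I" for p
      using good_patch_mono[OF g K(2)] that I(1) by blast
  qed (use assms I K E(2) in auto)
  then show ?thesis by (rule that)
qed

text \<open>For a closed surface, \<open>E\<close> is the surface itself; the projection is onto, so the last condition is vacuous.
For a surface with boundary, \<open>E\<close> is the extension, and intrinsic distances are bounded below by distances
in space; the constant grows by 1 because an infimum of path lengths need not be attained.\<close>

lemma triangulation_assumption_cases:
  assumes M: "smooth_surface M" and T: "triangulation_assumption M Me H Mh"
  obtains E C where "smooth_surface E" "M \<subseteq> E - surface_boundary E"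
    "\<And>h. h \<in> H \<Longrightarrow> projection_well_defined E (carrier (Mh h)) \<and> inj_on (closest_point E) (carrier (Mh h))"
    "0 < C"
    "\<And>h x. \<lbrakk>h \<in> H; x \<in> sym_diff (lift E (Mh h)) M\<rbrakk> \<Longrightarrow> \<exists>z\<in>surface_boundary M. dist x z \<le> C * h\<^sup>2"
proof (cases "surface_boundary M = {}")
  case True
  then have *: "closed_projection_condition M H Mh" using T by (simp add: triangulation_assumption_def)
  show ?thesis
  proof (rule that[of M 1])
    fix h assume h: "h \<in> H"
    obtain U where U: "carrier (Mh h) \<subseteq> U" "projection_well_defined M U"
      and bij: "bij_betw (closest_point M) (carrier (Mh h)) M"
      using * h unfolding closed_projection_condition_def by blast
    show "projection_well_defined M (carrier (Mh h)) \<and> inj_on (closest_point M) (carrier (Mh h))"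
      using U bij unfolding projection_well_defined_def bij_betw_def by blast
    have "lift M (Mh h) = M" using bij unfolding lift_def bij_betw_def by simp
    then show "\<exists>z\<in>surface_boundary M. dist x z \<le> 1 * h\<^sup>2" if "x \<in> sym_diff (lift M (Mh h)) M" for x
      using that by simp
  qed (use M True in auto)
next
  case False
  then have ext: "smooth_extension M Me" and pr: "extension_projection_condition Me H Mh"
    and bd: "boundary_condition M Me H Mh" using T by (simp_all add: triangulation_assumption_def)
  obtain C where C: "0 < C" and strip: "\<And>h. h \<in> H \<Longrightarrow> sym_diff (lift Me (Mh h)) M
        \<subseteq> {x\<in>Me. intrinsic_dist Me x (surface_boundary M) \<le> ennreal (C * h\<^sup>2)}"
    using bd unfolding boundary_condition_def by blast
  have hpos: "0 < h" if "h \<in> H" for h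
    using T that by (simp add: triangulation_assumption_def simplicial_approximations_def)
  show ?thesis
  proof (rule that[of Me "C + 1"])
    show "smooth_surface Me" "M \<subseteq> Me - surface_boundary Me" using ext by (auto simp: smooth_extension_def)
    fix h assume h: "h \<in> H"
    show "projection_well_defined Me (carrier (Mh h)) \<and> inj_on (closest_point Me) (carrier (Mh h))"
      using pr h unfolding extension_projection_condition_def bij_betw_def by blast
    fix x assume "x \<in> sym_diff (lift Me (Mh h)) M"
    then have "intrinsic_dist Me x (surface_boundary M) \<le> ennreal (C * h\<^sup>2)" using strip[OF h] by blast
    moreover have "C * h\<^sup>2 < (C + 1) * h\<^sup>2" using hpos[OF h] by simp
    ultimately show "\<exists>z\<in>surface_boundary M. dist x z \<le> (C + 1) * h\<^sup>2"
      using C intrinsic_dist_imp_near[of Me x "surface_boundary M" "C * h\<^sup>2" "(C + 1) * h\<^sup>2"] by (metis less_imp_le mult_nonneg_nonneg zero_le_power2)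
  qed (use C in auto)
qed

theorem theorem10:
  fixes M N Me :: "(real^3) set"
    and \<nu>M \<nu>N ft :: "real^3 \<Rightarrow> real^3"
    and H :: "real set"
    and Mh :: "real \<Rightarrow> face set"
    and f :: "real \<Rightarrow> real^3 \<Rightarrow> real^3"
  assumes "compact M" "connected M" "smooth_surface M" "surface_orientation M \<nu>M"
    and "compact N" "connected N" "smooth_surface N" "surface_orientation N \<nu>N"
    and "triangulation_assumption M Me H Mh"
    and "diffeomorphism M N ft"
    and "\<And>h. h \<in> H \<Longrightarrow> pl_interpolant (Mh h) ft (f h)"
  shows "\<exists>C>0. \<exists>h0>0. \<forall>h\<in>H. h < h0 \<longrightarrow>
    \<bar>discrete_stretch_energy (Mh h) (f h) - stretch_energy M ft\<bar> \<le> C * h"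
proof -
  note surf = assms(1,3) and T = assms(9)
  have ft: "smooth_on M ft" using assms(10) by (simp add: diffeomorphism_def)
  obtain E C0 where E: "smooth_surface E" "M \<subseteq> E - surface_boundary E"
    and proj: "\<And>h. h \<in> H \<Longrightarrow> projection_well_defined E (carrier (Mh h)) \<and> inj_on (closest_point E) (carrier (Mh h))"
    and C0: "0 < C0"
    and strip: "\<And>h x. \<lbrakk>h \<in> H; x \<in> sym_diff (lift E (Mh h)) M\<rbrakk> \<Longrightarrow> \<exists>z\<in>surface_boundary M. dist x z \<le> C0 * h\<^sup>2"
    using triangulation_assumption_cases[OF surf(2) T] by blast
  obtain I R K P where cs: "covered_surface E M ft I R K P"
    by (rule patch_cover_exists[OF surf E ft])
  interpret covered_surface E M ft I R K P by (rule cs)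
  obtain C1 where C1: "0 \<le> C1" "\<And>\<epsilon>. 0 < \<epsilon> \<and> \<epsilon> \<le> 1 \<Longrightarrow>
      \<exists>Z. finite Z \<and> real (card Z) \<le> C1 / \<epsilon> \<and> surface_boundary M \<subseteq> (\<Union>z\<in>Z. cball z \<epsilon>)"
    using surface_boundary_curve_covered[OF surf] unfolding curve_covered_def by blast
  obtain Cs where Cs: "0 < Cs" "\<And>h \<tau>. \<lbrakk>h \<in> H; \<tau> \<in> Mh h\<rbrakk> \<Longrightarrow> diameter (triangle \<tau>) / inradius (triangle \<tau>) \<le> Cs"
    using T unfolding triangulation_assumption_def shape_regular_def by blast
  define \<kappa> where "\<kappa> = 1 / (4 * Cs\<^sup>2)"
  have \<kappa>: "0 < \<kappa>" using Cs(1) by (simp add: \<kappa>_def)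
  define r0 where "r0 = Min (insert 1 ((\<lambda>p. min (R p) (pradius (P p))) ` I))"
  have r0: "0 < r0" "\<And>p. p \<in> I \<Longrightarrow> r0 \<le> min (R p) (pradius (P p))"
    using I(1) patchD(1,2) unfolding r0_def by (auto intro!: Min_le simp del: min.bounded_iff)
  \<comment> \<open>The last bound makes the strip of width \<open>C0 * h\<^sup>2\<close> narrower than \<open>h\<close>.\<close>
  define h0 where "h0 = Min {\<kappa> / (192 * K ^ 7), r0 / (4 * K), 1 / (2 * K), 1 / C0}"
  have h0: "0 < h0" using \<kappa> r0(1) C0 by (simp add: h0_def)
  define cE where "cE = (4 * K ^ 9 / \<kappa> + 4 * K ^ 13 / \<kappa>\<^sup>2) * (2 * K\<^sup>2 / \<kappa>)"
  define cA where "cA = 192 * K ^ 7 / \<kappa>"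
  define cS where "cS = 52 * K ^ 15"
  define C where "C = (cE + K ^ 10 * cA + cS + cS * cA) * (4 * (\<Sum>p\<in>I. measure lborel (B p)))
      + K ^ 10 * (card I * (16 * pi * K\<^sup>2 * C1)) + 1"
  have C: "0 < C"
    unfolding C_def cE_def cA_def cS_def using \<kappa> C1(1)
    by (intro add_nonneg_pos add_nonneg_nonneg mult_nonneg_nonneg sum_nonneg) auto
  have "\<bar>discrete_stretch_energy (Mh h) (f h) - stretch_energy M ft\<bar> \<le> C * h" if h: "h \<in> H" "h < h0" for h
  proof -
    have approx: "0 < h" "simplicial_surface (Mh h)" "mesh_size (Mh h) = h" "vertices (Mh h) \<subseteq> M"
      using T h(1) by (auto simp: triangulation_assumption_def simplicial_approximations_def)
    have hb: "h < \<kappa> / (192 * K ^ 7)" "h < r0 / (4 * K)" "h < 1 / (2 * K)" "h < 1 / C0"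
      using h(2) by (auto simp: h0_def)
    have small: "192 * K ^ 7 * h \<le> \<kappa>" "4 * K * h \<le> r0" "2 * K * h \<le> 1" "C0 * h \<le> 1"
      using hb C0 by (simp_all add: pos_less_divide_eq mult_ac)
    have Kh: "h \<le> K * h" using K approx(1) by simp
    have shape: "0 < diameter (triangle (a, b, c)) \<and>
        \<kappa> * (diameter (triangle (a, b, c)))\<^sup>2 \<le> norm ((b - a) \<times> (c - a))" if \<tau>: "(a, b, c) \<in> Mh h" for a b c
    proof -
      have tri: "triangle (a, b, c) = convex hull {a, b, c}" by (simp add: triangle_def)
      have "2 simplex (triangle (a, b, c))" using approx(2) \<tau> by (auto simp: simplicial_surface_def)
      from shape_regular_area[OF tri this Cs(1) Cs(2)[OF h(1) \<tau>]] show ?thesis by (simp add: \<kappa>_def)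
    qed
    interpret mesh: projected_mesh E M ft I R K P "Mh h" "f h" \<kappa> h r0
    proof unfold_locales
      show "4 * h \<le> r0" "h \<le> 1" using Kh small by linarith+
      show "r0 \<le> R p \<and> r0 \<le> pradius (P p)" if "p \<in> I" for p using r0(2)[OF that] by simp
    qed (use approx \<kappa> shape proj[OF h(1)] assms(11)[OF h(1)] small in auto)
    have h1: "0 < h \<and> h \<le> 1" using Kh small approx(1) by linarith
    obtain Z where Z: "finite Z" "real (card Z) \<le> C1 / h" "surface_boundary M \<subseteq> (\<Union>z\<in>Z. cball z h)"
      using C1(2)[OF h1] by blast
    define S where "S = (\<Union>z\<in>Z. cball z (2 * h))"
    have "S \<in> sets borel" using Z(1) by (auto simp: S_def)
    moreover have "sym_diff (lift E (Mh h)) M \<subseteq> S"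
    proof
      fix x assume "x \<in> sym_diff (lift E (Mh h)) M"
      then obtain y where y: "y \<in> surface_boundary M" "dist x y \<le> C0 * h\<^sup>2" using strip[OF h(1)] by blast
      have "C0 * h\<^sup>2 = (C0 * h) * h" by (simp add: power2_eq_square)
      also have "\<dots> \<le> 1 * h" using small(4) approx(1) by (intro mult_right_mono) auto
      finally have xy: "dist x y \<le> h" using y(2) by simp
      obtain z where z: "z \<in> Z" "dist z y \<le> h" using y(1) Z(3) by auto
      have "dist z x \<le> 2 * h" using dist_triangle[of z x y] z(2) xy by (simp add: dist_commute)
      then show "x \<in> S" using z(1) by (auto simp: S_def)
    qed
    moreover have "measure lborel {x \<in> B p. \<phi> p x \<in> S} \<le> 16 * pi * K\<^sup>2 * C1 * h" if "p \<in> I" for p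
      unfolding S_def by (rule patch_preimage_strip[OF that approx(1) Z(1,2)])
    ultimately have "\<bar>discrete_stretch_energy (Mh h) (f h) - stretch_energy M ft\<bar>
      \<le> (cE + K ^ 10 * cA + cS + cS * cA) * h * (4 * (\<Sum>p\<in>I. measure lborel (B p)))
        + K ^ 10 * (card I * (16 * pi * K\<^sup>2 * C1 * h))"
      using mesh.mesh_energy_estimate[of S "16 * pi * K\<^sup>2 * C1 * h"]
      unfolding mesh.cE_def mesh.cA_def mesh.cS_def cE_def cA_def cS_def by blast
    also have "\<dots> \<le> C * h" using approx(1) by (simp add: C_def algebra_simps)
    finally show ?thesis .
  qed
  then show ?thesis using C h0 by blast
qed

end
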